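(* The representation $\rho$ of $S_n$ on $V_n$ (determined by $\rho(s)C_w=\mathrm{sign}(s;w)C_{sws}$ for $s\in S$, $w\in I_n$) is a Gelfand model for $S_n$: over $\mathbb{C}$, it is isomorphic to the direct sum of all irreducible representations of $S_n$, each appearing exactly once.
   Context: $S=\{s_i=(i,i+1):1\le i\le n-1\}$; $I_n=\{\pi\in S_n:\pi^2=\mathrm{id}\}$; $V_n$ is the $\mathbb{Q}$-vector space with basis $\{C_w:w\in I_n\}$; $\mathrm{sign}(s;w)=-1$ if $sws=w$ and $s\in\mathrm{Des}(w)$, and $1$ otherwise, where $s_i\in\mathrm{Des}(w)$ iff $w(i)>w(i+1)$. *)

theory Defs
  imports Complex_Main "HOL-Combinatorics.Permutations" "HOL-Combinatorics.Transposition"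
begin

definition perms :: "nat \<Rightarrow> (nat \<Rightarrow> nat) set" where
  "perms n = {p. p permutes {1..n}}"

definition invols :: "nat \<Rightarrow> (nat \<Rightarrow> nat) set" where
  "invols n = {w \<in> perms n. w \<circ> w = id}"

definition sgen :: "nat \<Rightarrow> nat \<Rightarrow> nat" where
  "sgen i = Transposition.transpose i (Suc i)"

definition in_des :: "nat \<Rightarrow> (nat \<Rightarrow> nat) \<Rightarrow> bool" where
  "in_des i w \<longleftrightarrow> w i > w (Suc i)"

definition sign_sw :: "nat \<Rightarrow> (nat \<Rightarrow> nat) \<Rightarrow> complex" where
  "sign_sw i w = (if sgen i \<circ> w \<circ> sgen i = w \<and> in_des i w then -1 else 1)"

definition mmult :: "'b set \<Rightarrow> ('a \<Rightarrow> 'b \<Rightarrow> complex) \<Rightarrow> ('b \<Rightarrow> 'c \<Rightarrow> complex) \<Rightarrow> 'a \<Rightarrow> 'c \<Rightarrow> complex" where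
  "mmult J A B = (\<lambda>x z. \<Sum>y\<in>J. A x y * B y z)"

definition mid :: "'a \<Rightarrow> 'a \<Rightarrow> complex" where
  "mid = (\<lambda>x y. if x = y then 1 else 0)"

definition vecs :: "'a set \<Rightarrow> ('a \<Rightarrow> complex) set" where
  "vecs I = {v. \<forall>x. x \<notin> I \<longrightarrow> v x = 0}"

definition mvec :: "'a set \<Rightarrow> ('a \<Rightarrow> 'a \<Rightarrow> complex) \<Rightarrow> ('a \<Rightarrow> complex) \<Rightarrow> 'a \<Rightarrow> complex" where
  "mvec I A v = (\<lambda>x. if x \<in> I then (\<Sum>y\<in>I. A x y * v y) else 0)"

definition is_rep :: "nat \<Rightarrow> 'a set \<Rightarrow> ((nat \<Rightarrow> nat) \<Rightarrow> 'a \<Rightarrow> 'a \<Rightarrow> complex) \<Rightarrow> bool" where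
  "is_rep n I \<rho> \<longleftrightarrow> finite I \<and>
     (\<forall>x\<in>I. \<forall>y\<in>I. \<rho> id x y = mid x y) \<and>
     (\<forall>p\<in>perms n. \<forall>q\<in>perms n. \<forall>x\<in>I. \<forall>y\<in>I. \<rho> (p \<circ> q) x y = mmult I (\<rho> p) (\<rho> q) x y)"

definition invariant_subspace :: "nat \<Rightarrow> 'a set \<Rightarrow> ((nat \<Rightarrow> nat) \<Rightarrow> 'a \<Rightarrow> 'a \<Rightarrow> complex) \<Rightarrow> ('a \<Rightarrow> complex) set \<Rightarrow> bool" where
  "invariant_subspace n I \<rho> W \<longleftrightarrow> W \<subseteq> vecs I \<and> (\<lambda>x. 0) \<in> W \<and>
     (\<forall>v\<in>W. \<forall>w\<in>W. (\<lambda>x. v x + w x) \<in> W) \<and>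
     (\<forall>c. \<forall>v\<in>W. (\<lambda>x. c * v x) \<in> W) \<and>
     (\<forall>p\<in>perms n. \<forall>v\<in>W. mvec I (\<rho> p) v \<in> W)"

definition irreducible_rep :: "nat \<Rightarrow> 'a set \<Rightarrow> ((nat \<Rightarrow> nat) \<Rightarrow> 'a \<Rightarrow> 'a \<Rightarrow> complex) \<Rightarrow> bool" where
  "irreducible_rep n I \<rho> \<longleftrightarrow> is_rep n I \<rho> \<and> I \<noteq> {} \<and>
     (\<forall>W. invariant_subspace n I \<rho> W \<longrightarrow> W = {\<lambda>x. 0} \<or> W = vecs I)"

definition rep_iso :: "nat \<Rightarrow> 'a set \<Rightarrow> ((nat \<Rightarrow> nat) \<Rightarrow> 'a \<Rightarrow> 'a \<Rightarrow> complex)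
    \<Rightarrow> 'b set \<Rightarrow> ((nat \<Rightarrow> nat) \<Rightarrow> 'b \<Rightarrow> 'b \<Rightarrow> complex) \<Rightarrow> bool" where
  "rep_iso n I \<rho> J \<sigma> \<longleftrightarrow> (\<exists>(T :: 'b \<Rightarrow> 'a \<Rightarrow> complex) (U :: 'a \<Rightarrow> 'b \<Rightarrow> complex).
     (\<forall>x\<in>I. \<forall>y\<in>I. mmult J U T x y = mid x y) \<and>
     (\<forall>x\<in>J. \<forall>y\<in>J. mmult I T U x y = mid x y) \<and>
     (\<forall>p\<in>perms n. \<forall>x\<in>J. \<forall>y\<in>I. mmult J (\<sigma> p) T x y = mmult I T (\<rho> p) x y))"

definition dsum :: "(nat \<Rightarrow> (nat \<Rightarrow> nat) \<Rightarrow> nat \<Rightarrow> nat \<Rightarrow> complex) \<Rightarrow> (nat \<Rightarrow> nat) \<Rightarrow> nat \<times> nat \<Rightarrow> nat \<times> nat \<Rightarrow> complex" where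
  "dsum \<sigma> p = (\<lambda>(j, a) (j', b). if j = j' then \<sigma> j p a b else 0)"

definition gelfand_model :: "nat \<Rightarrow> 'a set \<Rightarrow> ((nat \<Rightarrow> nat) \<Rightarrow> 'a \<Rightarrow> 'a \<Rightarrow> complex) \<Rightarrow> bool" where
  "gelfand_model n I \<rho> \<longleftrightarrow> (\<exists>(k::nat) (d :: nat \<Rightarrow> nat) \<sigma>.
     (\<forall>j<k. irreducible_rep n {..<d j} (\<sigma> j)) \<and>
     (\<forall>i<k. \<forall>j<k. i \<noteq> j \<longrightarrow> \<not> rep_iso n {..<d i} (\<sigma> i) {..<d j} (\<sigma> j)) \<and>
     (\<forall>(m::nat) \<tau>. irreducible_rep n {..<m} \<tau> \<longrightarrow> (\<exists>j<k. rep_iso n {..<m} \<tau> {..<d j} (\<sigma> j))) \<and>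
     rep_iso n I \<rho> (SIGMA j:{..<k}. {..<d j}) (dsum \<sigma>))"

text \<open>The defining relations of \<rho> on generators: \<rho>(s_i) C_w = sign(s_i;w) C_{s_i w s_i};
  entry (u,w) of the matrix is the coefficient of C_u in \<rho>(s_i) C_w.\<close>
definition gen_action :: "nat \<Rightarrow> ((nat \<Rightarrow> nat) \<Rightarrow> (nat \<Rightarrow> nat) \<Rightarrow> (nat \<Rightarrow> nat) \<Rightarrow> complex) \<Rightarrow> bool" where
  "gen_action n \<rho> \<longleftrightarrow> (\<forall>i\<in>{1..<n}. \<forall>w\<in>invols n. \<forall>u\<in>invols n.
     \<rho> (sgen i) u w = (if u = sgen i \<circ> w \<circ> sgen i then sign_sw i w else 0))"

end

theory Submission
  imports Defs "HOL-Library.Function_Algebras" "HOL-Combinatorics.Cycles" "Jordan_Normal_Form.Spectral_Radius"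
begin

text \<open>
  The representation is \<open>\<rho>(p) C\<^sub>w = \<plusminus> C\<^bsub>p w p\<^sup>-\<^sup>1\<^esub>\<close>, the sign being \<open>-1\<close> to the number of 2-cycles of \<open>w\<close> whose
  points \<open>p\<close> puts in the opposite order. An endomorphism is a matrix \<open>K(u, w)\<close> indexed by pairs of
  involutions. Such a pair is a graph whose components are paths and even cycles. If some path has an
  even number of points, its reflection stabilises the pair with sign \<open>-1\<close>, so \<open>K(u, w) = 0\<close>; otherwise
  \<open>u\<close> and \<open>w\<close> can be swapped by a conjugation of sign \<open>1\<close>. Hence every \<open>K\<close> is symmetric, endomorphisms
  commute, and the representation is multiplicity free. Conversely, cutting each odd cycle of a
  permutation into a path and keeping each even cycle gives a pair on whose stabiliser the sign is
  trivial, and pairs from different conjugacy classes are inequivalent. So there are at least as many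
  independent endomorphisms, hence distinct irreducible constituents, as conjugacy classes. By
  orthogonality of characters there are no other irreducible representations.
\<close>

text \<open>The obstacle is that the sign is defined through the order of the points, while the
  components of a pair of involutions are understood only up to relabelling. It is overcome by
  computing the sign over an arbitrary choice of one point from each 2-cycle: such a choice can
  follow a path or a cycle, and the order disappears from every sign that has to be evaluated. For a
  permutation \<open>p\<close> swapping \<open>u\<close> and \<open>w\<close> the individual signs
  stay unknown. Only their agreement on \<open>u\<close> and \<open>w\<close> matters, and their
  product is the sign of \<open>p \<circ> p\<close> on \<open>u\<close>, where
  \<open>p \<circ> p\<close> stabilises \<open>u\<close>. The number of irreducibles is controlled
  by counting scalars: on a sum of pairwise non-isomorphic irreducibles Schur's lemma leaves one
  scalar per constituent, so independent endomorphisms are bounded by the number of constituents.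
  This holds over the complex numbers because an endomorphism of an irreducible has an
  eigenvalue.\<close>

lemma sum_fun_apply: "(\<Sum>i\<in>A. f i) x = (\<Sum>i\<in>A. f i x)" for f :: "'i \<Rightarrow> 'a \<Rightarrow> 'b::comm_monoid_add"
  by (induction A rule: infinite_finite_induct) auto

text \<open>Gaussian elimination, one equation per induction step. All later dimension arguments
  (bounds on left inverses, on irreducibles, on intertwiners) reduce to this.\<close>

lemma underdetermined_system:
  fixes M :: "'b \<Rightarrow> 'a \<Rightarrow> complex"
  assumes "finite B" "finite A" "card B < card A"
  shows "\<exists>x. (\<exists>a\<in>A. x a \<noteq> 0) \<and> (\<forall>b\<in>B. (\<Sum>a\<in>A. M b a * x a) = 0)"
  using assms
proof (induction B arbitrary: A M rule: finite_induct)
  case empty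
  then obtain a where "a \<in> A" by fastforce
  then show ?case by (intro exI[of _ "\<lambda>_. 1"]) auto
next
  case (insert b0 B)
  show ?case
  proof (cases "\<forall>a\<in>A. M b0 a = 0")
    case True
    have "card B < card A" using insert by simp
    from insert.IH[OF insert.prems(1) this, of M] True show ?thesis by auto
  next
    case False
    then obtain a0 where a0: "a0 \<in> A" "M b0 a0 \<noteq> 0" by auto
    let ?A = "A - {a0}"
    have "card B < card ?A" using insert a0 by simp
    from insert.IH[of ?A "\<lambda>b a. M b a - M b a0 * M b0 a / M b0 a0", OF _ this] insert.prems(1)
    obtain x where x: "\<exists>a\<in>?A. x a \<noteq> 0"
      "\<And>b. b \<in> B \<Longrightarrow> (\<Sum>a\<in>?A. (M b a - M b a0 * M b0 a / M b0 a0) * x a) = 0" by auto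
    \<comment> \<open>The pivot unknown \<open>a0\<close> is solved for in equation
      \<open>b0\<close>. The system handed to the induction hypothesis has exactly this value
      already substituted into the other equations.\<close>
    define y where "y = x(a0 := - (\<Sum>a\<in>?A. M b0 a * x a) / M b0 a0)"
    have split: "(\<Sum>a\<in>A. M b a * y a) = M b a0 * y a0 + (\<Sum>a\<in>?A. M b a * x a)" for b
    proof -
      have "(\<Sum>a\<in>A. M b a * y a) = M b a0 * y a0 + (\<Sum>a\<in>?A. M b a * y a)"
        by (rule sum.remove[OF insert.prems(1) a0(1)])
      also have "(\<Sum>a\<in>?A. M b a * y a) = (\<Sum>a\<in>?A. M b a * x a)"
        by (rule sum.cong) (auto simp: y_def)
      finally show ?thesis .
    qed
    have "(\<Sum>a\<in>A. M b a * y a) = 0" if "b \<in> B" for b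
    proof -
      have "(\<Sum>a\<in>?A. (M b a - M b a0 * M b0 a / M b0 a0) * x a)
          = (\<Sum>a\<in>?A. M b a * x a) - M b a0 / M b0 a0 * (\<Sum>a\<in>?A. M b0 a * x a)"
        by (simp add: algebra_simps sum_subtractf sum_distrib_left)
      with x(2)[OF that] show ?thesis
        unfolding split by (simp add: y_def)
    qed
    moreover have "(\<Sum>a\<in>A. M b0 a * y a) = 0"
      unfolding split using a0 by (simp add: y_def)
    moreover have "\<exists>a\<in>A. y a \<noteq> 0" using x(1) by (auto simp: y_def)
    ultimately show ?thesis by blast
  qed
qed

subsection \<open>Matrices over finite index sets\<close>

text \<open>\<open>is_rep\<close> and \<open>rep_iso\<close> constrain entries only inside the index
  sets. Requiring zeros outside turns entrywise agreement into equality of functions, so matrix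
  identities can be rewritten with.\<close>

definition mats :: "'a set \<Rightarrow> 'b set \<Rightarrow> ('a \<Rightarrow> 'b \<Rightarrow> complex) set" where
  "mats I J = {M. \<forall>x y. M x y \<noteq> 0 \<longrightarrow> x \<in> I \<and> y \<in> J}"

definition idm :: "'a set \<Rightarrow> 'a \<Rightarrow> 'a \<Rightarrow> complex" where
  "idm I = (\<lambda>x y. if x = y \<and> x \<in> I then 1 else 0)"

definition smul :: "complex \<Rightarrow> ('a \<Rightarrow> 'b \<Rightarrow> complex) \<Rightarrow> 'a \<Rightarrow> 'b \<Rightarrow> complex" where
  "smul c M = (\<lambda>x y. c * M x y)"

definition mapply :: "'b set \<Rightarrow> ('a \<Rightarrow> 'b \<Rightarrow> complex) \<Rightarrow> ('b \<Rightarrow> complex) \<Rightarrow> 'a \<Rightarrow> complex" where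
  "mapply J M v = (\<lambda>x. \<Sum>y\<in>J. M x y * v y)"

definition mrestrict :: "'a set \<Rightarrow> 'b set \<Rightarrow> ('a \<Rightarrow> 'b \<Rightarrow> complex) \<Rightarrow> 'a \<Rightarrow> 'b \<Rightarrow> complex" where
  "mrestrict I J M = (\<lambda>x y. if x \<in> I \<and> y \<in> J then M x y else 0)"

lemma matsD:
  assumes "M \<in> mats I J"
  shows "x \<notin> I \<Longrightarrow> M x y = 0" "y \<notin> J \<Longrightarrow> M x y = 0"
  using assms unfolding mats_def by blast+

lemma matsI:
  assumes "\<And>x y. x \<notin> I \<Longrightarrow> M x y = 0" "\<And>x y. y \<notin> J \<Longrightarrow> M x y = 0"
  shows "M \<in> mats I J"
  using assms unfolding mats_def by blast

lemma mats_eqI: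
  assumes "M \<in> mats I J" "N \<in> mats I J" "\<And>x y. x \<in> I \<Longrightarrow> y \<in> J \<Longrightarrow> M x y = N x y"
  shows "M = N"
proof (intro ext)
  fix x y show "M x y = N x y"
    using assms(3)[of x y] matsD[OF assms(1)] matsD[OF assms(2)] by (cases "x \<in> I"; cases "y \<in> J") simp_all
qed

lemma mrestrict_mats [simp]: "mrestrict I J M \<in> mats I J"
  by (auto simp: mrestrict_def mats_def)

lemma idm_mats [simp]: "idm I \<in> mats I I"
  by (auto simp: idm_def mats_def)

lemma zero_mats [simp]: "0 \<in> mats I J"
  by (auto simp: mats_def)

lemma smul_mats [simp]: "M \<in> mats I J \<Longrightarrow> smul c M \<in> mats I J"
  by (auto simp: mats_def smul_def)

lemma add_mats [simp]: "M \<in> mats I J \<Longrightarrow> N \<in> mats I J \<Longrightarrow> M + N \<in> mats I J"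
  by (rule matsI) (simp_all add: matsD)

lemma diff_mats [simp]: "M \<in> mats I J \<Longrightarrow> N \<in> mats I J \<Longrightarrow> M - N \<in> mats I J"
  by (rule matsI) (simp_all add: matsD)

lemma sum_mats: "(\<And>i. i \<in> A \<Longrightarrow> f i \<in> mats I J) \<Longrightarrow> (\<Sum>i\<in>A. f i) \<in> mats I J"
  by (induction A rule: infinite_finite_induct) auto

lemma mmult_mats [simp]:
  assumes "M \<in> mats I J" "N \<in> mats J K" shows "mmult J M N \<in> mats I K"
  by (rule matsI) (use assms in \<open>auto simp: mmult_def matsD\<close>)

lemma mmult_assoc:
  assumes "finite J" "finite K"
  shows "mmult K (mmult J M N) P = mmult J M (mmult K N P)"
  unfolding mmult_def
  by (intro ext, simp add: sum_distrib_left sum_distrib_right mult.assoc, rule sum.swap)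

lemma mmult_idm_left:
  assumes "finite I" "M \<in> mats I J" shows "mmult I (idm I) M = M"
proof (intro ext)
  fix x y
  have "mmult I (idm I) M x y = (\<Sum>z\<in>I. if z = x then M z y else 0)"
    unfolding mmult_def idm_def by (intro sum.cong) auto
  also have "\<dots> = M x y" using assms by (simp add: matsD)
  finally show "mmult I (idm I) M x y = M x y" .
qed

lemma mmult_idm_right:
  assumes "finite J" "M \<in> mats I J" shows "mmult J M (idm J) = M"
proof (intro ext)
  fix x y
  have "mmult J M (idm J) x y = (\<Sum>z\<in>J. if z = y then M x z else 0)"
    unfolding mmult_def idm_def by (intro sum.cong) auto
  also have "\<dots> = M x y" using assms by (simp add: matsD)
  finally show "mmult J M (idm J) x y = M x y" .
qed

lemma mmult_zero [simp]: "mmult J 0 M = 0" "mmult J N 0 = 0"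
  by (auto simp: mmult_def fun_eq_iff)

lemma mmult_smul: "mmult J (smul c M) N = smul c (mmult J M N)" "mmult J M (smul c N) = smul c (mmult J M N)"
  by (auto simp: mmult_def smul_def fun_eq_iff sum_distrib_left mult_ac)

lemma mmult_diff: "mmult J (M - M') N = mmult J M N - mmult J M' N" "mmult J P (N - N') = mmult J P N - mmult J P N'"
  by (auto simp: mmult_def fun_eq_iff sum_subtractf algebra_simps)

lemma mmult_sum_left: "mmult J (\<Sum>i\<in>A. f i) N = (\<Sum>i\<in>A. mmult J (f i) N)"
  unfolding mmult_def by (auto simp: fun_eq_iff sum_fun_apply sum_distrib_right intro: sum.swap)

lemma mmult_sum_right: "mmult J N (\<Sum>i\<in>A. f i) = (\<Sum>i\<in>A. mmult J N (f i))"
  unfolding mmult_def by (auto simp: fun_eq_iff sum_fun_apply sum_distrib_left intro: sum.swap)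

lemma smul_smul: "smul c (smul d M) = smul (c * d) M" "smul 1 M = M" "smul c 0 = 0"
  by (auto simp: smul_def mult_ac fun_eq_iff)

lemma smul_const_sum: "(\<Sum>i\<in>A. M) = smul (of_nat (card A)) M"
  by (auto simp: smul_def fun_eq_iff sum_fun_apply)

lemma mapply_mmult:
  assumes "finite J" "finite K"
  shows "mapply K (mmult J M N) v = mapply J M (mapply K N v)"
  unfolding mmult_def mapply_def
  by (intro ext, simp add: sum_distrib_left sum_distrib_right mult.assoc, rule sum.swap)

lemma mapply_idm:
  assumes "finite I" "v \<in> vecs I" shows "mapply I (idm I) v = v"
proof
  fix x
  have "mapply I (idm I) v x = (\<Sum>z\<in>I. if z = x then v z else 0)"
    unfolding mapply_def idm_def by (intro sum.cong) auto
  also have "\<dots> = v x" using assms by (simp add: vecs_def)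
  finally show "mapply I (idm I) v x = v x" .
qed

lemma mapply_vecs [simp]: "M \<in> mats I J \<Longrightarrow> mapply J M v \<in> vecs I"
  by (auto simp: vecs_def mapply_def matsD)

lemma mapply_zero [simp]: "mapply J M (\<lambda>_. 0) = (\<lambda>_. 0)" "mapply J 0 v = (\<lambda>_. 0)"
  "mapply J (\<lambda>_ _. 0) v = (\<lambda>_. 0)"
  by (auto simp: mapply_def)

lemma mapply_add: "mapply J M (\<lambda>x. v x + w x) = (\<lambda>x. mapply J M v x + mapply J M w x)"
  by (auto simp: mapply_def sum.distrib algebra_simps)

lemma mapply_scale: "mapply J M (\<lambda>x. c * v x) = (\<lambda>x. c * mapply J M v x)"
  by (auto simp: mapply_def sum_distrib_left mult_ac)

lemma mapply_diff_left: "mapply J (M - N) v = (\<lambda>x. mapply J M v x - mapply J N v x)"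
  by (auto simp: mapply_def sum_subtractf algebra_simps)

lemma mapply_smul: "mapply J (smul c M) v = (\<lambda>x. c * mapply J M v x)"
  by (auto simp: mapply_def smul_def sum_distrib_left mult_ac)

definition unit_vec :: "'a \<Rightarrow> 'a \<Rightarrow> complex" where "unit_vec a = (\<lambda>x. if x = a then 1 else 0)"

lemma unit_vec_vecs: "a \<in> I \<Longrightarrow> unit_vec a \<in> vecs I"
  by (auto simp: unit_vec_def vecs_def)

lemma mapply_unit_vec: "finite J \<Longrightarrow> a \<in> J \<Longrightarrow> mapply J M (unit_vec a) = (\<lambda>x. M x a)"
  by (auto simp: unit_vec_def mapply_def if_distrib cong: if_cong)

lemma mats_eqI_mapply:
  assumes "finite J" "M \<in> mats I J" "N \<in> mats I J" "\<And>v. v \<in> vecs J \<Longrightarrow> mapply J M v = mapply J N v"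
  shows "M = N"
proof (rule mats_eqI[OF assms(2,3)])
  fix x y assume "y \<in> J"
  with assms(4)[OF unit_vec_vecs[OF this]] assms(1) show "M x y = N x y"
    by (simp add: mapply_unit_vec fun_eq_iff)
qed

section \<open>Left inverses and bases of subspaces\<close>

lemma card_le_of_left_inverse:
  assumes "finite I" "finite D" "A \<in> mats I D" "mmult I B A = idm D"
  shows "card D \<le> card I"
proof (rule ccontr)
  assume "\<not> ?thesis"
  then have "card I < card D" by simp
  from underdetermined_system[OF assms(1,2) this, of A] obtain x a where
    x: "a \<in> D" "x a \<noteq> 0" "\<forall>b\<in>I. (\<Sum>a\<in>D. A b a * x a) = 0" by blast
  define y where "y = (\<lambda>a. if a \<in> D then x a else 0)"
  have y: "y \<in> vecs D" by (auto simp: y_def vecs_def)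
  have "mapply D A y = (\<lambda>_. 0)"
  proof
    fix b
    have "mapply D A y b = (\<Sum>a\<in>D. A b a * x a)" unfolding mapply_def by (intro sum.cong) (auto simp: y_def)
    also have "\<dots> = 0" using x(3) assms(3) by (cases "b \<in> I") (auto simp: matsD)
    finally show "mapply D A y b = 0" .
  qed
  then have "mapply D (mmult I B A) y = (\<lambda>_. 0)" by (simp add: mapply_mmult assms(1,2))
  then have "y = (\<lambda>_. 0)" using assms y by (simp add: mapply_idm)
  with x show False by (auto simp: y_def fun_eq_iff split: if_splits)
qed

definition subspace_of :: "'a set \<Rightarrow> ('a \<Rightarrow> complex) set \<Rightarrow> bool" where
  "subspace_of I W \<longleftrightarrow> W \<subseteq> vecs I \<and> (\<lambda>x. 0) \<in> W \<and>
     (\<forall>v\<in>W. \<forall>w\<in>W. (\<lambda>x. v x + w x) \<in> W) \<and> (\<forall>c. \<forall>v\<in>W. (\<lambda>x. c * v x) \<in> W)"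

lemma subspace_of_sum:
  assumes "subspace_of I W" "\<And>j. j \<in> S \<Longrightarrow> f j \<in> W"
  shows "(\<lambda>x. \<Sum>j\<in>S. c j * f j x) \<in> W"
  using assms(2)
proof (induction S rule: infinite_finite_induct)
  case (insert j S)
  have "(\<lambda>x. c j * f j x) \<in> W" "(\<lambda>x. \<Sum>j\<in>S. c j * f j x) \<in> W"
    using insert assms(1) by (auto simp: subspace_of_def)
  then have "(\<lambda>x. c j * f j x + (\<Sum>j\<in>S. c j * f j x)) \<in> W"
    using assms(1) unfolding subspace_of_def by fast
  with insert show ?case by simp
qed (use assms in \<open>auto simp: subspace_of_def\<close>)

text \<open>The columns of \<open>A\<close> are a basis of \<open>W\<close>, and \<open>B\<close>
  reads off coordinates, so \<open>A B\<close> is a projection onto \<open>W\<close>. Both come from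
  the largest \<open>d\<close> for which independent columns in \<open>W\<close>, witnessed by a
  left inverse, exist. A vector of \<open>W\<close> not reproduced by \<open>A B\<close> would
  supply one more column.\<close>

lemma subspace_basis:
  assumes I: "finite I" and W: "subspace_of I W"
  obtains d :: nat and A B where "A \<in> mats I {..<d}" "B \<in> mats {..<d} I" "mmult I B A = idm {..<d}"
    "\<And>c. mapply {..<d} A c \<in> W" "\<And>v. v \<in> W \<Longrightarrow> mapply {..<d} A (mapply I B v) = v"
proof -
  define good where "good d A B \<longleftrightarrow> A \<in> mats I {..<d} \<and> B \<in> mats {..<d} I \<and> mmult I B A = idm {..<d} \<and>
    (\<forall>j<d. (\<lambda>x. A x j) \<in> W)" for d :: nat and A B
  define S where "S = {d. \<exists>A B. good d A B}"
  have "good 0 0 0"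
    by (auto simp: good_def idm_def fun_eq_iff)
  then have "0 \<in> S" unfolding S_def by blast
  moreover have "finite S"
  proof (rule finite_subset)
    show "S \<subseteq> {..card I}"
      using card_le_of_left_inverse[of I] I by (fastforce simp: good_def S_def)
  qed simp
  ultimately have Max: "Max S \<in> S" "\<And>d. d \<in> S \<Longrightarrow> d \<le> Max S"
    using Max_in[of S] Max_ge[of S] by blast+
  define d where "d = Max S"
  have d: "\<exists>A B. good d A B" "\<And>d' A B. good d' A B \<Longrightarrow> d' \<le> d"
    using Max unfolding S_def d_def by blast+
  from d(1) obtain A B where g: "good d A B" by blast
  then have A: "A \<in> mats I {..<d}" and B: "B \<in> mats {..<d} I" and BA: "mmult I B A = idm {..<d}"
    and col: "\<And>j. j < d \<Longrightarrow> (\<lambda>x. A x j) \<in> W" by (auto simp: good_def)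
  have range: "mapply {..<d} A c \<in> W" for c
    using subspace_of_sum[OF W, of "{..<d}" "\<lambda>j x. A x j" c] col by (simp add: mapply_def mult.commute)
  have "mapply {..<d} A (mapply I B v) = v" if v: "v \<in> W" for v
  proof (rule ccontr)
    assume neq: "mapply {..<d} A (mapply I B v) \<noteq> v"
    define r where "r = (\<lambda>x. v x + (-1) * mapply {..<d} A (mapply I B v) x)"
    have vI: "v \<in> vecs I" using v W by (auto simp: subspace_of_def)
    have "(\<lambda>x. (-1) * mapply {..<d} A (mapply I B v) x) \<in> W"
      using range W unfolding subspace_of_def by fast
    with v have rW: "r \<in> W" using W unfolding subspace_of_def r_def by fast
    have Br: "mapply I B r = (\<lambda>_. 0)"
    proof -
      have "mapply I B r = (\<lambda>x. mapply I B v x + (-1) * mapply {..<d} (mmult I B A) (mapply I B v) x)"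
        unfolding r_def by (simp only: mapply_add mapply_scale mapply_mmult[OF I finite_lessThan])
      also have "\<dots> = (\<lambda>_. 0)" using B by (simp add: BA mapply_idm)
      finally show ?thesis .
    qed
    from neq obtain i0 where "mapply {..<d} A (mapply I B v) i0 \<noteq> v i0" by (auto simp: fun_eq_iff)
    then have i0: "r i0 \<noteq> 0" by (simp add: r_def)
    have i0I: "i0 \<in> I" using i0 rW W by (auto simp: subspace_of_def vecs_def)
    define A' where "A' = (\<lambda>x j. if j = d then r x else A x j)"
    \<comment> \<open>The complementary projection kills the columns of \<open>A\<close> and fixes
      the residual \<open>r\<close>, and \<open>B\<close> kills \<open>r\<close>. So row
      \<open>i0\<close> of \<open>F\<close>, divided by \<open>r i0\<close>, is the missing row of a
      left inverse for the enlarged \<open>A'\<close>.\<close>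
    define F where "F = (idm I - mmult {..<d} A B)"
    define B' where "B' = (\<lambda>j x. if j = d then F i0 x / r i0 else B j x)"
    have FA: "mmult I F A = 0"
      using A B BA I by (simp add: F_def mmult_diff mmult_idm_left mmult_assoc mmult_idm_right)
    have Fr: "mapply I F r = r"
      using rW W I by (simp add: F_def mapply_diff_left mapply_mmult Br mapply_idm subspace_of_def subset_eq)
    have Fm: "F \<in> mats I I" using A B by (simp add: F_def)
    have "good (Suc d) A' B'" unfolding good_def
    proof (intro conjI allI impI)
      show "A' \<in> mats I {..<Suc d}" using A rW W
        by (auto simp: A'_def mats_def subspace_of_def vecs_def less_Suc_eq split: if_splits)
      show "B' \<in> mats {..<Suc d} I" using B Fm
        by (auto simp: B'_def mats_def less_Suc_eq split: if_splits)
      show "mmult I B' A' = idm {..<Suc d}"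
      proof (rule mats_eqI[of _ "{..<Suc d}" "{..<Suc d}"])
        show "mmult I B' A' \<in> mats {..<Suc d} {..<Suc d}"
          using \<open>A' \<in> mats I {..<Suc d}\<close> \<open>B' \<in> mats {..<Suc d} I\<close> by simp
        fix i j assume ij: "i \<in> {..<Suc d}" "j \<in> {..<Suc d}"
        have 1: "(\<Sum>x\<in>I. F i0 x * A x j) = 0" for j
          using FA by (simp add: mmult_def fun_eq_iff)
        have 2: "(\<Sum>x\<in>I. F i0 x * r x) = r i0"
          using Fr by (simp add: mapply_def fun_eq_iff)
        have 3: "(\<Sum>x\<in>I. B i x * r x) = 0" for i
          using Br by (simp add: mapply_def fun_eq_iff)
        have 4: "(\<Sum>x\<in>I. B i x * A x j) = idm {..<d} i j" for i j
          using BA by (simp add: mmult_def fun_eq_iff)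
        show "mmult I B' A' i j = idm {..<Suc d} i j"
          using ij i0 1[of j] 2 3[of i] 4[of i j]
          by (auto simp: mmult_def A'_def B'_def idm_def less_Suc_eq sum_divide_distrib[symmetric])
      qed simp
      fix j assume "j < Suc d"
      then show "(\<lambda>x. A' x j) \<in> W" using rW col by (auto simp: A'_def less_Suc_eq)
    qed
    from d(2)[OF this] show False by simp
  qed
  with A B BA range that show ?thesis by blast
qed

text \<open>Adjoining \<open>v\<close> as an extra column gives more columns than rows, hence a
  linear relation. The coefficient of \<open>v\<close> in it is nonzero because the columns of
  \<open>A\<close> are independent.\<close>

lemma left_inverse_imp_surj:
  assumes I: "finite I" and A: "A \<in> mats I {..<d}" and BA: "mmult I B A = idm {..<d}"
    and d: "card I \<le> d" and v: "v \<in> vecs I"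
  shows "\<exists>c. v = mapply {..<d} A c"
proof -
  define M where "M = (\<lambda>x j. if j = d then v x else A x j)"
  from underdetermined_system[of I "{..<Suc d}" M] I d obtain c where
    c: "\<exists>j<Suc d. c j \<noteq> 0" "\<And>x. x \<in> I \<Longrightarrow> (\<Sum>j<Suc d. M x j * c j) = 0" by auto
  have eq: "mapply {..<d} A c x + c d * v x = 0" for x
  proof (cases "x \<in> I")
    case True
    from c(2)[OF this] show ?thesis by (simp add: M_def mapply_def mult.commute)
  next
    case False
    then show ?thesis using v A by (simp add: mapply_def matsD vecs_def)
  qed
  have "c d \<noteq> 0"
  proof
    assume "c d = 0"
    with eq have z: "mapply {..<d} A c = (\<lambda>_. 0)" by auto
    define c' where "c' = (\<lambda>j. if j < d then c j else 0)"
    have "mapply {..<d} A c' = mapply {..<d} A c" by (auto simp: mapply_def c'_def)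
    with z have "mapply {..<d} (mmult I B A) c' = (\<lambda>_. 0)" using I by (simp add: mapply_mmult)
    moreover have "c' \<in> vecs {..<d}" by (auto simp: c'_def vecs_def)
    ultimately have "c' = (\<lambda>_. 0)" by (simp add: BA mapply_idm)
    then have "\<forall>j<d. c j = 0" by (metis c'_def)
    with c(1) \<open>c d = 0\<close> show False by (auto simp: less_Suc_eq)
  qed
  then have "v = mapply {..<d} A (\<lambda>j. (- 1 / c d) * c j)"
    unfolding mapply_scale using eq by (auto simp: fun_eq_iff field_simps add_eq_0_iff)
  then show ?thesis by blast
qed

unbundle no m_inv_syntax

subsection \<open>Representations and intertwiners\<close>

text \<open>The supported form of \<open>is_rep\<close>: the same conditions as equalities of
  functions.\<close>

definition srep :: "nat \<Rightarrow> 'a set \<Rightarrow> ((nat \<Rightarrow> nat) \<Rightarrow> 'a \<Rightarrow> 'a \<Rightarrow> complex) \<Rightarrow> bool" where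
  "srep n I \<rho> \<longleftrightarrow> finite I \<and> (\<forall>p\<in>perms n. \<rho> p \<in> mats I I) \<and> \<rho> id = idm I \<and>
     (\<forall>p\<in>perms n. \<forall>q\<in>perms n. \<rho> (p \<circ> q) = mmult I (\<rho> p) (\<rho> q))"

definition intw :: "nat \<Rightarrow> 'a set \<Rightarrow> ((nat \<Rightarrow> nat) \<Rightarrow> 'a \<Rightarrow> 'a \<Rightarrow> complex) \<Rightarrow>
    'b set \<Rightarrow> ((nat \<Rightarrow> nat) \<Rightarrow> 'b \<Rightarrow> 'b \<Rightarrow> complex) \<Rightarrow> ('b \<Rightarrow> 'a \<Rightarrow> complex) \<Rightarrow> bool" where
  "intw n I \<rho> J \<tau> T \<longleftrightarrow> T \<in> mats J I \<and> (\<forall>p\<in>perms n. mmult J (\<tau> p) T = mmult I T (\<rho> p))"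

lemma perms_id [simp]: "id \<in> perms n"
  by (simp add: perms_def permutes_id)

lemma perms_comp [simp]: "p \<in> perms n \<Longrightarrow> q \<in> perms n \<Longrightarrow> p \<circ> q \<in> perms n"
  by (simp add: perms_def permutes_compose)

lemma perms_inv [simp]: "p \<in> perms n \<Longrightarrow> inv p \<in> perms n"
  by (simp add: perms_def permutes_inv)

lemma finite_perms [simp]: "finite (perms n)"
  by (simp add: perms_def finite_permutations)

lemma perms_bij: "p \<in> perms n \<Longrightarrow> bij p"
  by (simp add: perms_def permutes_bij)

lemma perms_inv_o:
  assumes "p \<in> perms n" shows "inv p \<circ> p = id" "p \<circ> inv p = id"
  using assms permutes_inv_o by (auto simp: perms_def)

lemma perms_inv_comp: "p \<in> perms n \<Longrightarrow> q \<in> perms n \<Longrightarrow> inv (p \<circ> q) = inv q \<circ> inv p"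
  by (simp add: o_inv_distrib perms_bij)

lemma sum_perms_left:
  assumes h: "h \<in> perms n"
  shows "(\<Sum>g\<in>perms n. f (h \<circ> g)) = (\<Sum>g\<in>perms n. f g)"
proof (rule sum.reindex_bij_witness[of _ "\<lambda>g. inv h \<circ> g" "\<lambda>g. h \<circ> g"])
  fix g assume "g \<in> perms n"
  show "inv h \<circ> (h \<circ> g) = g" "h \<circ> (inv h \<circ> g) = g"
    using perms_inv_o[OF h] by (simp_all add: o_assoc)
qed (use h in auto)

lemma srepD:
  assumes "srep n I \<rho>"
  shows "finite I" "p \<in> perms n \<Longrightarrow> \<rho> p \<in> mats I I" "\<rho> id = idm I"
    "p \<in> perms n \<Longrightarrow> q \<in> perms n \<Longrightarrow> mmult I (\<rho> p) (\<rho> q) = \<rho> (p \<circ> q)"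
  using assms by (auto simp: srep_def)

lemma intwD:
  assumes "intw n I \<rho> J \<tau> T"
  shows "T \<in> mats J I" "p \<in> perms n \<Longrightarrow> mmult J (\<tau> p) T = mmult I T (\<rho> p)"
  using assms by (auto simp: intw_def)

lemma mvec_eq_mapply: "M \<in> mats I I \<Longrightarrow> mvec I M v = mapply I M v"
  by (auto simp: mvec_def mapply_def matsD)

lemma srep_imp_is_rep: "srep n I \<rho> \<Longrightarrow> is_rep n I \<rho>"
  by (auto simp: srep_def is_rep_def idm_def mid_def)

lemma is_rep_imp_srep:
  assumes "is_rep n I \<rho>" shows "srep n I (\<lambda>p. mrestrict I I (\<rho> p))"
  unfolding srep_def
proof (intro conjI ballI)
  show "finite I" using assms by (simp add: is_rep_def)
  show "mrestrict I I (\<rho> id) = idm I"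
    using assms by (auto simp: is_rep_def mid_def mrestrict_def idm_def fun_eq_iff)
  fix p q assume pq: "p \<in> perms n" "q \<in> perms n"
  show "mrestrict I I (\<rho> (p \<circ> q)) = mmult I (mrestrict I I (\<rho> p)) (mrestrict I I (\<rho> q))"
  proof (rule mats_eqI[of _ I I])
    fix x y assume "x \<in> I" "y \<in> I"
    then show "mrestrict I I (\<rho> (p \<circ> q)) x y = mmult I (mrestrict I I (\<rho> p)) (mrestrict I I (\<rho> q)) x y"
      using assms pq by (auto simp: is_rep_def mmult_def mrestrict_def intro!: sum.cong)
  qed (auto intro: mmult_mats)
qed simp

lemma intw_comp:
  assumes "finite I" "finite J" "finite K" "intw n I \<rho> J \<tau> T" "intw n J \<tau> K \<kappa> S"
  shows "intw n I \<rho> K \<kappa> (mmult J S T)"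
  unfolding intw_def
proof (intro conjI ballI)
  show "mmult J S T \<in> mats K I" using assms by (auto simp: intw_def intro: mmult_mats)
  fix p assume p: "p \<in> perms n"
  have "mmult K (\<kappa> p) (mmult J S T) = mmult J (mmult K (\<kappa> p) S) T" using assms by (simp add: mmult_assoc)
  also have "\<dots> = mmult J S (mmult J (\<tau> p) T)" using assms p by (simp add: mmult_assoc intwD(2)[OF assms(5)])
  also have "\<dots> = mmult I (mmult J S T) (\<rho> p)" using assms p by (simp add: mmult_assoc intwD(2)[OF assms(4)])
  finally show "mmult K (\<kappa> p) (mmult J S T) = mmult I (mmult J S T) (\<rho> p)" .
qed

lemma intw_smul: "intw n I \<rho> J \<tau> T \<Longrightarrow> intw n I \<rho> J \<tau> (smul c T)"
  by (auto simp: intw_def mmult_smul)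

lemma intw_diff: "intw n I \<rho> J \<tau> T \<Longrightarrow> intw n I \<rho> J \<tau> S \<Longrightarrow> intw n I \<rho> J \<tau> (T - S)"
  by (auto simp: intw_def mmult_diff)

lemma intw_sum: "(\<And>i. i \<in> A \<Longrightarrow> intw n I \<rho> J \<tau> (f i)) \<Longrightarrow> intw n I \<rho> J \<tau> (\<Sum>i\<in>A. f i)"
  by (auto simp: intw_def mmult_sum_left mmult_sum_right sum_mats intro!: sum.cong)

lemma intw_idm: "srep n I \<rho> \<Longrightarrow> intw n I \<rho> I \<rho> (idm I)"
  unfolding intw_def srep_def by (auto simp: mmult_idm_left mmult_idm_right)

text \<open>The sum is not divided by the group order, so an intertwiner is multiplied by that
  order. Applied to matrix units it yields both the orthogonality relations and the independent
  endomorphisms.\<close>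

definition average where
  "average n I \<rho> J \<tau> E = (\<Sum>g\<in>perms n. mmult J (\<tau> g) (mmult I E (\<rho> (inv g))))"

lemma average_intw:
  assumes \<rho>: "srep n I \<rho>" and \<tau>: "srep n J \<tau>" and E: "E \<in> mats J I"
  shows "intw n I \<rho> J \<tau> (average n I \<rho> J \<tau> E)"
  unfolding intw_def
proof (intro conjI ballI)
  note fin = srepD(1)[OF \<rho>] srepD(1)[OF \<tau>]
  show "average n I \<rho> J \<tau> E \<in> mats J I"
    unfolding average_def 
    using srepD(2)[OF \<rho>] srepD(2)[OF \<tau>] E
    by (intro sum_mats mmult_mats[of _ J J] mmult_mats[of _ J I]) auto
  fix h assume h: "h \<in> perms n"
  have "mmult J (\<tau> h) (average n I \<rho> J \<tau> E) = (\<Sum>g\<in>perms n. mmult J (\<tau> (h \<circ> g)) (mmult I E (\<rho> (inv g))))"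
    unfolding average_def mmult_sum_right using h \<tau> fin
    by (intro sum.cong refl) (simp add: mmult_assoc[symmetric] srepD)
  also have "\<dots> = (\<Sum>g\<in>perms n. (\<lambda>g. mmult J (\<tau> g) (mmult I E (\<rho> (inv g \<circ> h)))) (h \<circ> g))"
    using h by (intro sum.cong refl) (simp add: perms_inv_comp o_assoc[symmetric] perms_inv_o)
  also have "\<dots> = (\<Sum>g\<in>perms n. mmult J (\<tau> g) (mmult I E (\<rho> (inv g \<circ> h))))"
    by (rule sum_perms_left[OF h])
  also have "\<dots> = mmult I (average n I \<rho> J \<tau> E) (\<rho> h)"
    unfolding average_def mmult_sum_left using h \<rho> fin
    by (intro sum.cong refl) (simp add: mmult_assoc srepD)
  finally show "mmult J (\<tau> h) (average n I \<rho> J \<tau> E) = mmult I (average n I \<rho> J \<tau> E) (\<rho> h)" .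
qed

text \<open>Only \<open>T\<close> is required to intertwine in \<open>rep_iso\<close>; its inverse
  \<open>U\<close> then does so as well. Cutting both down to their index sets makes the inverse
  laws equalities of functions.\<close>

lemma rep_iso_supported:
  assumes "rep_iso n I \<rho> J \<sigma>" and \<rho>: "srep n I \<rho>" and \<sigma>: "srep n J \<sigma>"
  obtains T U where "intw n I \<rho> J \<sigma> T" "intw n J \<sigma> I \<rho> U" "mmult J U T = idm I" "mmult I T U = idm J"
proof -
  from assms(1) obtain T U where
    UT: "\<forall>x\<in>I. \<forall>y\<in>I. mmult J U T x y = mid x y" and
    TU: "\<forall>x\<in>J. \<forall>y\<in>J. mmult I T U x y = mid x y" and
    tw: "\<forall>p\<in>perms n. \<forall>x\<in>J. \<forall>y\<in>I. mmult J (\<sigma> p) T x y = mmult I T (\<rho> p) x y"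
    unfolding rep_iso_def by blast
  note fin = srepD(1)[OF \<rho>] srepD(1)[OF \<sigma>]
  define T' where "T' = mrestrict J I T"
  define U' where "U' = mrestrict I J U"
  have [simp]: "T' \<in> mats J I" "U' \<in> mats I J" by (auto simp: T'_def U'_def)
  have UT': "mmult J U' T' = idm I"
  proof (rule mats_eqI[of _ I I])
    fix x y assume "x \<in> I" "y \<in> I"
    then show "mmult J U' T' x y = idm I x y"
      using UT[rule_format, of x y] by (simp add: mmult_def T'_def U'_def mrestrict_def idm_def mid_def)
  qed (auto intro: mmult_mats)
  have TU': "mmult I T' U' = idm J"
  proof (rule mats_eqI[of _ J J])
    fix x y assume "x \<in> J" "y \<in> J"
    then show "mmult I T' U' x y = idm J x y"
      using TU[rule_format, of x y] by (simp add: mmult_def T'_def U'_def mrestrict_def idm_def mid_def)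
  qed (auto intro: mmult_mats)
  have tw': "mmult J (\<sigma> p) T' = mmult I T' (\<rho> p)" if p: "p \<in> perms n" for p
  proof (rule mats_eqI[of _ J I])
    show "mmult J (\<sigma> p) T' \<in> mats J I" "mmult I T' (\<rho> p) \<in> mats J I"
      using p \<rho> \<sigma> by (auto intro!: mmult_mats simp: srepD)
    fix x y assume "x \<in> J" "y \<in> I"
    then show "mmult J (\<sigma> p) T' x y = mmult I T' (\<rho> p) x y"
      using tw[rule_format, OF p, of x y] by (simp add: mmult_def T'_def mrestrict_def)
  qed
  have "mmult I (\<rho> p) U' = mmult J U' (\<sigma> p)" if p: "p \<in> perms n" for p
  proof -
    have "mmult I (\<rho> p) U' = mmult I (mmult J U' T') (mmult I (\<rho> p) U')"
      using p \<rho> fin by (subst UT', subst mmult_idm_left[of I _ J]) (auto intro: mmult_mats simp: srepD)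
    also have "\<dots> = mmult J U' (mmult I (mmult I T' (\<rho> p)) U')" using fin by (simp add: mmult_assoc)
    also have "\<dots> = mmult J U' (mmult J (\<sigma> p) (mmult I T' U'))" using fin p by (simp add: tw'[symmetric] mmult_assoc)
    also have "\<dots> = mmult J U' (\<sigma> p)"
      using mmult_idm_right[OF fin(2) srepD(2)[OF \<sigma> p]] by (simp add: TU')
    finally show ?thesis .
  qed
  with tw' UT' TU' that[of T' U'] show ?thesis by (auto simp: intw_def)
qed

lemma rep_isoI:
  assumes "finite I" "intw n I \<rho> J \<sigma> T" "mmult J U T = idm I" "mmult I T U = idm J"
  shows "rep_iso n I \<rho> J \<sigma>"
  unfolding rep_iso_def using assms
  by (intro exI[of _ T] exI[of _ U]) (auto simp: intw_def idm_def mid_def)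

lemma rep_iso_sym:
  assumes "rep_iso n I \<rho> J \<sigma>" "srep n I \<rho>" "srep n J \<sigma>"
  shows "rep_iso n J \<sigma> I \<rho>"
  using assms by (metis rep_iso_supported rep_isoI srepD(1))

lemma rep_iso_cong:
  assumes "\<And>p x y. p \<in> perms n \<Longrightarrow> x \<in> I \<Longrightarrow> y \<in> I \<Longrightarrow> \<rho> p x y = \<rho>' p x y" "rep_iso n I \<rho> J \<sigma>"
  shows "rep_iso n I \<rho>' J \<sigma>"
proof -
  from assms(2) obtain T U where
    *: "\<forall>x\<in>I. \<forall>y\<in>I. mmult J U T x y = mid x y" "\<forall>x\<in>J. \<forall>y\<in>J. mmult I T U x y = mid x y"
       "\<forall>p\<in>perms n. \<forall>x\<in>J. \<forall>y\<in>I. mmult J (\<sigma> p) T x y = mmult I T (\<rho> p) x y"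
    unfolding rep_iso_def by blast
  have "mmult I T (\<rho> p) x y = mmult I T (\<rho>' p) x y" if "p \<in> perms n" "y \<in> I" for p x y
    using that assms(1) by (auto simp: mmult_def intro!: sum.cong)
  with * show ?thesis unfolding rep_iso_def by (intro exI[of _ T] exI[of _ U]) auto
qed

section \<open>Invariant subspaces and Schur's lemma\<close>

lemma irreducible_rep_mrestrict:
  assumes "irreducible_rep n I \<rho>"
  shows "irreducible_rep n I (\<lambda>p. mrestrict I I (\<rho> p))"
proof -
  have "mvec I (mrestrict I I M) = mvec I M" for M
    by (auto simp: mvec_def mrestrict_def fun_eq_iff)
  then have "invariant_subspace n I (\<lambda>p. mrestrict I I (\<rho> p)) W \<longleftrightarrow> invariant_subspace n I \<rho> W" for W
    by (simp add: invariant_subspace_def)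
  with assms show ?thesis
    by (auto simp: irreducible_rep_def intro: srep_imp_is_rep is_rep_imp_srep)
qed

lemma invariant_subspace_alt:
  assumes "srep n I \<rho>"
  shows "invariant_subspace n I \<rho> W \<longleftrightarrow> subspace_of I W \<and> (\<forall>p\<in>perms n. \<forall>v\<in>W. mapply I (\<rho> p) v \<in> W)"
  using assms by (auto simp: invariant_subspace_def subspace_of_def mvec_eq_mapply srepD)

lemma intw_mapply:
  assumes "intw n I \<rho> J \<tau> T" "srep n I \<rho>" "srep n J \<tau>" "p \<in> perms n"
  shows "mapply J (\<tau> p) (mapply I T v) = mapply I T (mapply I (\<rho> p) v)"
  using assms by (simp add: mapply_mmult[symmetric] intwD srepD(1))

lemma kernel_invariant:
  assumes T: "intw n I \<rho> J \<tau> T" and \<rho>: "srep n I \<rho>" and \<tau>: "srep n J \<tau>"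
  shows "invariant_subspace n I \<rho> {v \<in> vecs I. mapply I T v = (\<lambda>_. 0)}"
  unfolding invariant_subspace_alt[OF \<rho>] subspace_of_def
proof (intro conjI ballI allI)
  fix p v assume p: "p \<in> perms n" and v: "v \<in> {v \<in> vecs I. mapply I T v = (\<lambda>_. 0)}"
  have "mapply I T (mapply I (\<rho> p) v) = (\<lambda>_. 0)"
    using intw_mapply[OF T \<rho> \<tau> p, of v] v by simp
  with srepD(2)[OF \<rho> p] show "mapply I (\<rho> p) v \<in> {v \<in> vecs I. mapply I T v = (\<lambda>_. 0)}"
    by simp
qed (auto simp: mapply_add mapply_scale vecs_def)

lemma image_invariant:
  assumes T: "intw n I \<rho> J \<tau> T" and \<rho>: "srep n I \<rho>" and \<tau>: "srep n J \<tau>" and W: "invariant_subspace n I \<rho> W"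
  shows "invariant_subspace n J \<tau> (mapply I T ` W)"
  unfolding invariant_subspace_alt[OF \<tau>] subspace_of_def
proof (intro conjI ballI allI subsetI)
  have W': "subspace_of I W" "\<And>p v. p \<in> perms n \<Longrightarrow> v \<in> W \<Longrightarrow> mapply I (\<rho> p) v \<in> W"
    using W by (auto simp: invariant_subspace_alt[OF \<rho>])
  show "(\<lambda>x. 0) \<in> mapply I T ` W"
    using W' by (auto simp: subspace_of_def intro!: image_eqI[of _ _ "\<lambda>_. 0"])
  fix v assume "v \<in> mapply I T ` W"
  then obtain v' where v: "v = mapply I T v'" "v' \<in> W" by auto
  show "v \<in> vecs J" using v T by (auto simp: intwD)
  show "(\<lambda>x. c * v x) \<in> mapply I T ` W" for c
    using v W' by (auto simp: mapply_scale[symmetric] subspace_of_def)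
  show "mapply J (\<tau> p) v \<in> mapply I T ` W" if "p \<in> perms n" for p
    using v W' that by (auto simp: intw_mapply[OF T \<rho> \<tau>])
  fix w assume "w \<in> mapply I T ` W"
  then obtain w' where w: "w = mapply I T w'" "w' \<in> W" by auto
  show "(\<lambda>x. v x + w x) \<in> mapply I T ` W"
    using v w W' unfolding subspace_of_def by (auto simp: mapply_add[symmetric])
qed

lemma invariant_subspace_vecs:
  assumes "srep n I \<rho>" shows "invariant_subspace n I \<rho> (vecs I)"
  unfolding invariant_subspace_alt[OF assms] subspace_of_def
  using assms by (auto simp: srepD) (auto simp: vecs_def)

text \<open>The kernel and the image of \<open>T\<close> are invariant; since \<open>T\<close> is
  nonzero, the kernel is zero and the image is everything. Preimages of the unit vectors are the
  columns of a right inverse, which is two-sided because \<open>T\<close> is injective.\<close>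

lemma schur:
  assumes \<rho>: "irreducible_rep n I \<rho>" "srep n I \<rho>" and \<tau>: "irreducible_rep n J \<tau>" "srep n J \<tau>"
    and T: "intw n I \<rho> J \<tau> T" and "T \<noteq> 0"
  shows "rep_iso n I \<rho> J \<tau>"
proof -
  note fin = srepD(1)[OF \<rho>(2)] srepD(1)[OF \<tau>(2)]
  have Tm: "T \<in> mats J I" using T by (simp add: intwD)
  have ne: "\<exists>v\<in>vecs I. mapply I T v \<noteq> (\<lambda>_. 0)"
  proof (rule ccontr)
    assume "\<not> ?thesis"
    then have "T = 0" by (intro mats_eqI_mapply[OF fin(1) Tm]) auto
    with \<open>T \<noteq> 0\<close> show False by simp
  qed
  let ?K = "{v \<in> vecs I. mapply I T v = (\<lambda>_. 0)}"
  have "?K = {\<lambda>_. 0} \<or> ?K = vecs I"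
    using \<rho>(1) kernel_invariant[OF T \<rho>(2) \<tau>(2)] unfolding irreducible_rep_def by blast
  with ne have K: "?K = {\<lambda>_. 0}" by blast
  have "mapply I T ` vecs I = {\<lambda>_. 0} \<or> mapply I T ` vecs I = vecs J"
    using \<tau>(1) image_invariant[OF T \<rho>(2) \<tau>(2) invariant_subspace_vecs[OF \<rho>(2)]]
    unfolding irreducible_rep_def by blast
  with ne have im: "mapply I T ` vecs I = vecs J" by blast
  have "\<exists>u. u \<in> vecs I \<and> mapply I T u = unit_vec y" if "y \<in> J" for y
    using im unit_vec_vecs[OF that] by (metis imageE)
  then obtain u where u: "\<And>y. y \<in> J \<Longrightarrow> u y \<in> vecs I" "\<And>y. y \<in> J \<Longrightarrow> mapply I T (u y) = unit_vec y"
    by metis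
  define U where "U = (\<lambda>x y. if y \<in> J then u y x else 0)"
  have U: "U \<in> mats I J" using u(1) by (auto simp: U_def mats_def vecs_def)
  have TU: "mmult I T U = idm J"
  proof (rule mats_eqI[of _ J J])
    show "mmult I T U \<in> mats J J" using U Tm by (auto intro: mmult_mats)
    fix x y assume "x \<in> J" "y \<in> J"
    with u(2)[of y] show "mmult I T U x y = idm J x y"
      by (simp add: mmult_def U_def mapply_def fun_eq_iff idm_def unit_vec_def)
  qed simp
  have "mmult J U T = idm I"
  proof (rule mats_eqI_mapply[OF fin(1)])
    show "mmult J U T \<in> mats I I" using U Tm by (auto intro: mmult_mats)
    fix v assume v: "v \<in> vecs I"
    define w where "w = mapply I (mmult J U T - idm I) v"
    have wv: "w \<in> vecs I" unfolding w_def using U Tm by (intro mapply_vecs) (auto intro: mmult_mats)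
    have "mapply I T w = mapply I (mmult I T (mmult J U T - idm I)) v"
      unfolding w_def using fin by (simp add: mapply_mmult)
    also have "mmult I T (mmult J U T - idm I) = 0"
      using fin Tm by (simp add: mmult_diff mmult_assoc[symmetric] TU mmult_idm_left mmult_idm_right)
    finally have "w \<in> ?K" using wv by simp
    with K show "mapply I (mmult J U T) v = mapply I (idm I) v"
      by (auto simp: w_def mapply_diff_left fun_eq_iff)
  qed simp
  with T TU fin show ?thesis by (intro rep_isoI)
qed

text \<open>The point at which algebraic closedness of the complex numbers enters, through the
  nonempty spectrum of a matrix.\<close>

lemma exists_eigenvalue:
  fixes T :: "nat \<Rightarrow> nat \<Rightarrow> complex"
  assumes "d > 0" and T: "T \<in> mats {..<d} {..<d}"
  shows "\<exists>c v. v \<in> vecs {..<d} \<and> v \<noteq> (\<lambda>_. 0) \<and> mapply {..<d} T v = (\<lambda>x. c * v x)"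
proof -
  let ?A = "mat d d (\<lambda>(i, j). T i j)"
  have A: "?A \<in> carrier_mat d d" by simp
  from spectrum_non_empty[OF A \<open>d > 0\<close>] obtain k v where "eigenvector ?A v k"
    by (auto simp: spectrum_def eigenvalue_def)
  then have v: "v \<in> carrier_vec d" "v \<noteq> 0\<^sub>v d" "?A *\<^sub>v v = k \<cdot>\<^sub>v v" by (auto simp: eigenvector_def)
  define w where "w = (\<lambda>i. if i < d then v $ i else 0)"
  have "mapply {..<d} T w i = k * w i" for i
  proof (cases "i < d")
    case True
    have "(?A *\<^sub>v v) $ i = (\<Sum>j<d. T i j * v $ j)"
      using True v(1) by (simp add: scalar_prod_def atLeast0LessThan)
    with True v(1,3) show ?thesis by (simp add: mapply_def w_def)
  next
    case False
    with T show ?thesis by (simp add: mapply_def w_def matsD)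
  qed
  moreover have "w \<noteq> (\<lambda>_. 0)"
  proof
    assume "w = (\<lambda>_. 0)"
    then have "\<And>i. i < d \<Longrightarrow> v $ i = 0" by (metis w_def)
    with v(1,2) show False by (auto intro!: eq_vecI)
  qed
  moreover have "w \<in> vecs {..<d}" by (auto simp: w_def vecs_def)
  ultimately show ?thesis by blast
qed

text \<open>Subtracting an eigenvalue leaves an intertwiner with nonzero kernel. By irreducibility
  that kernel is the whole space.\<close>

lemma schur_scalar:
  fixes \<rho> :: "(nat \<Rightarrow> nat) \<Rightarrow> nat \<Rightarrow> nat \<Rightarrow> complex"
  assumes \<rho>: "irreducible_rep n {..<d} \<rho>" "srep n {..<d} \<rho>" and T: "intw n {..<d} \<rho> {..<d} \<rho> T"
  shows "\<exists>c. T = smul c (idm {..<d})"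
proof -
  have "d > 0" using \<rho>(1) by (auto simp: irreducible_rep_def)
  then obtain c v where v: "v \<in> vecs {..<d}" "v \<noteq> (\<lambda>_. 0)" "mapply {..<d} T v = (\<lambda>x. c * v x)"
    using exists_eigenvalue intwD(1)[OF T] by blast
  define S where "S = T - smul c (idm {..<d})"
  have S: "intw n {..<d} \<rho> {..<d} \<rho> S"
    unfolding S_def by (intro intw_diff T intw_smul intw_idm \<rho>(2))
  let ?K = "{v \<in> vecs {..<d}. mapply {..<d} S v = (\<lambda>_. 0)}"
  have "v \<in> ?K" using v by (simp add: S_def mapply_diff_left mapply_smul mapply_idm)
  moreover have "?K = {\<lambda>_. 0} \<or> ?K = vecs {..<d}"
    using \<rho>(1) kernel_invariant[OF S \<rho>(2) \<rho>(2)] unfolding irreducible_rep_def by blast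
  ultimately have K: "?K = vecs {..<d}" using v(2) by blast
  have "S = 0"
    by (rule mats_eqI_mapply[OF _ intwD(1)[OF S]]) (use K in auto)
  then have "T = smul c (idm {..<d})" unfolding S_def by (metis diff_eq_eq add_0)
  then show ?thesis by blast
qed

subsection \<open>Complete reducibility\<close>

text \<open>The action on \<open>W\<close> in the coordinates of a basis,
  \<open>B \<rho>(p) A\<close>. It is multiplicative because \<open>A B\<close> acts as the identity
  on the invariant space \<open>W\<close>.\<close>

lemma subrep:
  assumes \<rho>: "srep n I \<rho>" and W: "invariant_subspace n I \<rho> W"
  obtains d :: nat and A B \<sigma> where "srep n {..<d} \<sigma>" "intw n {..<d} \<sigma> I \<rho> A" "B \<in> mats {..<d} I"
    "mmult I B A = idm {..<d}" "\<And>c. mapply {..<d} A c \<in> W"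
    "\<And>v. v \<in> W \<Longrightarrow> mapply {..<d} A (mapply I B v) = v"
proof -
  note fin = srepD(1)[OF \<rho>]
  have W': "subspace_of I W" "\<And>p v. p \<in> perms n \<Longrightarrow> v \<in> W \<Longrightarrow> mapply I (\<rho> p) v \<in> W"
    using W by (auto simp: invariant_subspace_alt[OF \<rho>])
  obtain d :: nat and A B where A: "A \<in> mats I {..<d}" and B: "B \<in> mats {..<d} I"
    and BA: "mmult I B A = idm {..<d}" and range: "\<And>c. mapply {..<d} A c \<in> W"
    and fixW: "\<And>v. v \<in> W \<Longrightarrow> mapply {..<d} A (mapply I B v) = v"
    by (rule subspace_basis[OF fin W'(1)]) (rule that)
  define \<sigma> where "\<sigma> p = mmult I B (mmult I (\<rho> p) A)" for p
  have \<sigma>m: "\<sigma> p \<in> mats {..<d} {..<d}" if "p \<in> perms n" for p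
    unfolding \<sigma>_def using A B srepD(2)[OF \<rho> that] by simp
  have tw: "mmult {..<d} A (\<sigma> p) = mmult I (\<rho> p) A" if p: "p \<in> perms n" for p
  proof (rule mats_eqI_mapply)
    show "mmult {..<d} A (\<sigma> p) \<in> mats I {..<d}" "mmult I (\<rho> p) A \<in> mats I {..<d}"
      using A \<sigma>m[OF p] srepD(2)[OF \<rho> p] by auto
    fix v
    have "mapply {..<d} (mmult {..<d} A (\<sigma> p)) v
      = mapply {..<d} A (mapply I B (mapply I (\<rho> p) (mapply {..<d} A v)))"
      unfolding \<sigma>_def using fin by (simp add: mapply_mmult)
    also have "\<dots> = mapply I (\<rho> p) (mapply {..<d} A v)"
      by (intro fixW W'(2) p range)
    also have "\<dots> = mapply {..<d} (mmult I (\<rho> p) A) v" using fin by (simp add: mapply_mmult)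
    finally show "mapply {..<d} (mmult {..<d} A (\<sigma> p)) v = mapply {..<d} (mmult I (\<rho> p) A) v" .
  qed simp
  have "srep n {..<d} \<sigma>" unfolding srep_def
  proof (intro conjI ballI)
    show "\<sigma> id = idm {..<d}"
      using A BA fin by (simp add: \<sigma>_def srepD(3)[OF \<rho>] mmult_idm_left)
    fix p q assume p: "p \<in> perms n" and q: "q \<in> perms n"
    have "mmult {..<d} (\<sigma> p) (\<sigma> q) = mmult I B (mmult I (\<rho> p) (mmult {..<d} A (\<sigma> q)))"
      unfolding \<sigma>_def[of p] using fin by (simp add: mmult_assoc)
    also have "\<dots> = mmult I B (mmult I (mmult I (\<rho> p) (\<rho> q)) A)" using fin by (simp add: tw[OF q] mmult_assoc)
    finally show "\<sigma> (p \<circ> q) = mmult {..<d} (\<sigma> p) (\<sigma> q)" by (simp add: \<sigma>_def srepD(4)[OF \<rho> p q])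
  qed (use \<sigma>m in auto)
  moreover have "intw n {..<d} \<sigma> I \<rho> A" using A tw by (simp add: intw_def)
  ultimately show ?thesis using that B BA range fixW by blast
qed

lemma subspace_ne_zero_dim:
  assumes "subspace_of I W" "W \<noteq> {\<lambda>_. 0}" "\<And>v. v \<in> W \<Longrightarrow> mapply {..<d} A (mapply I B v) = v"
  shows "d > (0::nat)"
proof (rule ccontr)
  assume "\<not> d > 0"
  then have "v = (\<lambda>_. 0)" if "v \<in> W" for v
    using assms(3)[OF that] by (auto simp: mapply_def fun_eq_iff)
  with assms(1,2) show False by (auto simp: subspace_of_def)
qed

text \<open>A nonzero subrepresentation of least dimension. A nonzero invariant subspace of it
  embeds into \<open>W\<close> too, so it has at least the same dimension and is everything.\<close>

lemma exists_irreducible_subrep: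
  assumes \<rho>: "srep n I \<rho>" and W: "invariant_subspace n I \<rho> W" and ne: "W \<noteq> {\<lambda>_. 0}"
  obtains d :: nat and A B \<sigma> where "srep n {..<d} \<sigma>" "irreducible_rep n {..<d} \<sigma>" "intw n {..<d} \<sigma> I \<rho> A"
    "B \<in> mats {..<d} I" "mmult I B A = idm {..<d}" "\<And>c. mapply {..<d} A c \<in> W"
proof -
  note fin = srepD(1)[OF \<rho>]
  define good where "good d A B \<sigma> \<longleftrightarrow> d > 0 \<and> srep n {..<d} \<sigma> \<and> intw n {..<d} \<sigma> I \<rho> A \<and>
    B \<in> mats {..<d} I \<and> mmult I B A = idm {..<d} \<and> (\<forall>c. mapply {..<d} A c \<in> W)" for d :: nat and A B \<sigma>
  have "subspace_of I W" using W by (simp add: invariant_subspace_alt[OF \<rho>])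
  obtain e :: nat and A B \<sigma> where "srep n {..<e} \<sigma>" "intw n {..<e} \<sigma> I \<rho> A" "B \<in> mats {..<e} I"
    "mmult I B A = idm {..<e}" "\<And>c. mapply {..<e} A c \<in> W"
    "\<And>v. v \<in> W \<Longrightarrow> mapply {..<e} A (mapply I B v) = v"
    by (rule subrep[OF \<rho> W]) (rule that)
  with subspace_ne_zero_dim[OF \<open>subspace_of I W\<close> ne] have "good e A B \<sigma>"
    unfolding good_def by blast
  then have ex: "\<exists>d A B \<sigma>. good d A B \<sigma>" by blast
  define d where "d = (LEAST d. \<exists>A B \<sigma>. good d A B \<sigma>)"
  have "\<exists>A B \<sigma>. good d A B \<sigma>" unfolding d_def by (rule LeastI_ex[OF ex])
  then obtain A B and \<sigma> where g: "good d A B \<sigma>" by blast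
  have least: "d \<le> d'" if "good d' A' B' \<sigma>'" for d' A' B' \<sigma>'
    unfolding d_def using that by (intro Least_le) blast
  from g have d: "d > 0" and \<sigma>: "srep n {..<d} \<sigma>" and A: "intw n {..<d} \<sigma> I \<rho> A"
    and B: "B \<in> mats {..<d} I" and BA: "mmult I B A = idm {..<d}" and range: "\<And>c. mapply {..<d} A c \<in> W"
    by (auto simp: good_def)
  have "irreducible_rep n {..<d} \<sigma>" unfolding irreducible_rep_def
  proof (intro conjI allI impI)
    show "is_rep n {..<d} \<sigma>" by (rule srep_imp_is_rep[OF \<sigma>])
    show "{..<d} \<noteq> {}" using d by auto
    fix Z assume Z: "invariant_subspace n {..<d} \<sigma> Z"
    show "Z = {\<lambda>x. 0} \<or> Z = vecs {..<d}"
    proof (cases "Z = {\<lambda>_. 0}")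
      case False
      have Zs: "subspace_of {..<d} Z" using Z by (simp add: invariant_subspace_alt[OF \<sigma>])
      obtain d1 :: nat and A1 B1 \<sigma>1 where 1: "srep n {..<d1} \<sigma>1" "intw n {..<d1} \<sigma>1 {..<d} \<sigma> A1"
        "B1 \<in> mats {..<d1} {..<d}" "mmult {..<d} B1 A1 = idm {..<d1}" "\<And>c. mapply {..<d1} A1 c \<in> Z"
        "\<And>v. v \<in> Z \<Longrightarrow> mapply {..<d1} A1 (mapply {..<d} B1 v) = v"
        by (rule subrep[OF \<sigma> Z]) (rule that)
      have "d1 > 0" by (rule subspace_ne_zero_dim[OF Zs False 1(6)])
      have "good d1 (mmult {..<d} A A1) (mmult {..<d} B1 B) \<sigma>1" unfolding good_def
      proof (intro conjI allI)
        show "intw n {..<d1} \<sigma>1 I \<rho> (mmult {..<d} A A1)"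
          by (rule intw_comp[OF _ _ fin 1(2) A]) auto
        have "mmult I (mmult {..<d} B1 B) (mmult {..<d} A A1) = mmult {..<d} B1 (mmult {..<d} (mmult I B A) A1)"
          using fin by (simp add: mmult_assoc)
        also have "\<dots> = idm {..<d1}" using 1 by (simp add: BA mmult_idm_left[OF _ intwD(1)[OF 1(2)]])
        finally show "mmult I (mmult {..<d} B1 B) (mmult {..<d} A A1) = idm {..<d1}" .
        show "mapply {..<d1} (mmult {..<d} A A1) c \<in> W" for c
          using range by (simp add: mapply_mmult)
      qed (use 1 B \<open>d1 > 0\<close> in auto)
      then have "d \<le> d1" by (rule least)
      then have "vecs {..<d} \<subseteq> Z"
        using left_inverse_imp_surj[OF _ intwD(1)[OF 1(2)] 1(4)] 1(5) by fastforce
      with Zs show ?thesis by (auto simp: subspace_of_def)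
    qed simp
  qed
  with that \<sigma> A B BA range show ?thesis by blast
qed

text \<open>A direct sum of irreducibles inside \<open>\<rho>\<close>, given by embeddings
  \<open>A j\<close> and projections \<open>B j\<close> with \<open>B i A j\<close> equal to the
  identity for \<open>i = j\<close> and zero otherwise. Isomorphic constituents are allowed at this
  stage.\<close>

definition irr_system where
  "irr_system n I \<rho> k d \<sigma> A B \<longleftrightarrow>
    (\<forall>j<k. srep n {..<d j} (\<sigma> j) \<and> irreducible_rep n {..<d j} (\<sigma> j) \<and>
      intw n {..<d j} (\<sigma> j) I \<rho> (A j) \<and> intw n I \<rho> {..<d j} (\<sigma> j) (B j)) \<and>
    (\<forall>i<k. \<forall>j<k. mmult I (B i) (A j) = (\<lambda>x y. if i = j then idm {..<d i} x y else 0))"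
  for k :: nat and d :: "nat \<Rightarrow> nat"

lemma irr_systemD:
  assumes "irr_system n I \<rho> k d \<sigma> A B"
  shows "j < k \<Longrightarrow> srep n {..<d j} (\<sigma> j)" "j < k \<Longrightarrow> irreducible_rep n {..<d j} (\<sigma> j)"
    "j < k \<Longrightarrow> intw n {..<d j} (\<sigma> j) I \<rho> (A j)" "j < k \<Longrightarrow> intw n I \<rho> {..<d j} (\<sigma> j) (B j)"
    "i < k \<Longrightarrow> mmult I (B i) (A i) = idm {..<d i}"
    "i < k \<Longrightarrow> j < k \<Longrightarrow> i \<noteq> j \<Longrightarrow> mmult I (B i) (A j) = 0"
  using assms by (auto simp: irr_system_def fun_eq_iff)

lemma irreducible_dim_pos: "irreducible_rep n {..<d} \<sigma> \<Longrightarrow> 0 < (d::nat)"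
  by (auto simp: irreducible_rep_def)

text \<open>One vector from each constituent, the image of the basis vector with index 0, gives
  \<open>k\<close> independent vectors.\<close>

lemma irr_system_bound:
  assumes "finite I" and S: "irr_system n I \<rho> k d \<sigma> A B"
  shows "k \<le> card I"
proof -
  define A' where "A' = (\<lambda>x j. if j < k then A j x 0 else 0)"
  define B' where "B' = (\<lambda>j x. if j < k then B j 0 x else 0)"
  have "A' \<in> mats I {..<k}"
    by (rule matsI) (auto simp: A'_def matsD(1)[OF intwD(1)[OF irr_systemD(3)[OF S]]])
  moreover have "mmult I B' A' = idm {..<k}"
  proof (intro ext)
    fix i j
    show "mmult I B' A' i j = idm {..<k} i j"
    proof (cases "i < k \<and> j < k")
      case True
      then have "mmult I B' A' i j = mmult I (B i) (A j) 0 0"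
        by (simp add: mmult_def A'_def B'_def)
      also have "\<dots> = idm {..<k} i j"
        using True irreducible_dim_pos[OF irr_systemD(2)[OF S, of i]] irr_systemD(5)[OF S, of i]
          irr_systemD(6)[OF S, of i j] by (cases "i = j") (auto simp: idm_def)
      finally show ?thesis .
    qed (auto simp: mmult_def A'_def B'_def idm_def)
  qed
  ultimately show ?thesis using card_le_of_left_inverse[of I "{..<k}" A' B'] assms(1) by simp
qed

text \<open>Maschke's argument: every conjugate of \<open>B\<close> by the group is again a left
  inverse of the embedding \<open>A\<close>, so their mean is an equivariant left inverse.\<close>

lemma left_inverse_average:
  assumes \<rho>: "srep n I \<rho>" and \<sigma>: "srep n J \<sigma>" and A: "intw n J \<sigma> I \<rho> A" and B: "B \<in> mats J I"
    and BA: "mmult I B A = idm J"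
  obtains B' where "intw n I \<rho> J \<sigma> B'" "mmult I B' A = idm J"
proof -
  note fin = srepD(1)[OF \<rho>] srepD(1)[OF \<sigma>]
  have "mmult I (average n I \<rho> J \<sigma> B) A = (\<Sum>g\<in>perms n. idm J)"
    unfolding average_def mmult_sum_left
  proof (intro sum.cong refl)
    fix g assume g: "g \<in> perms n"
    have "mmult I (mmult J (\<sigma> g) (mmult I B (\<rho> (inv g)))) A = mmult J (\<sigma> g) (mmult I B (mmult I (\<rho> (inv g)) A))"
      using fin by (simp add: mmult_assoc)
    also have "\<dots> = mmult J (\<sigma> g) (mmult J (mmult I B A) (\<sigma> (inv g)))"
      using fin g by (simp add: mmult_assoc intwD(2)[OF A])
    also have "\<dots> = mmult J (\<sigma> g) (\<sigma> (inv g))"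
      unfolding BA using fin g srepD(2)[OF \<sigma> perms_inv[OF g]] by (simp add: mmult_idm_left)
    also have "\<dots> = idm J" using g by (simp add: srepD[OF \<sigma>] perms_inv_o)
    finally show "mmult I (mmult J (\<sigma> g) (mmult I B (\<rho> (inv g)))) A = idm J" .
  qed
  then have *: "mmult I (average n I \<rho> J \<sigma> B) A = smul (of_nat (card (perms n))) (idm J)"
    unfolding smul_const_sum .
  have "card (perms n) \<noteq> 0" using perms_id by (auto simp del: perms_id)
  then have "mmult I (smul (1 / of_nat (card (perms n))) (average n I \<rho> J \<sigma> B)) A = idm J"
    unfolding mmult_smul * smul_smul(1) by (simp add: smul_smul)
  with that intw_smul[OF average_intw[OF \<rho> \<sigma> B]] show ?thesis by blast
qed

text \<open>The common kernel of the projections is invariant, and \<open>v\<close> shows that it is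
  nonzero, so it contains an irreducible subrepresentation to be added to the system.\<close>

lemma irr_system_extend:
  assumes \<rho>: "srep n I \<rho>" and S: "irr_system n I \<rho> k d \<sigma> A B"
    and v: "v \<in> vecs I" "v \<noteq> (\<lambda>_. 0)" "\<And>j. j < k \<Longrightarrow> mapply I (B j) v = (\<lambda>_. 0)"
  shows "\<exists>d' \<sigma>' A' B'. irr_system n I \<rho> (Suc k) d' \<sigma>' A' B'"
proof -
  note fin = srepD(1)[OF \<rho>]
  define W where "W = {v \<in> vecs I. \<forall>j<k. mapply I (B j) v = (\<lambda>_. 0)}"
  have "invariant_subspace n I \<rho> W"
    unfolding invariant_subspace_alt[OF \<rho>] subspace_of_def
  proof (intro conjI ballI allI)
    fix p v assume p: "p \<in> perms n" and v: "v \<in> W"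
    have "mapply I (B j) (mapply I (\<rho> p) v) = (\<lambda>_. 0)" if "j < k" for j
      using intw_mapply[OF irr_systemD(4)[OF S that] \<rho> irr_systemD(1)[OF S that] p, of v] v that
      by (simp add: W_def)
    with srepD(2)[OF \<rho> p] show "mapply I (\<rho> p) v \<in> W" by (simp add: W_def)
  qed (auto simp: W_def mapply_add mapply_scale vecs_def)
  moreover have "W \<noteq> {\<lambda>_. 0}" using v by (auto simp: W_def)
  ultimately obtain e :: nat and A0 B0 \<tau> where \<tau>: "srep n {..<e} \<tau>" "irreducible_rep n {..<e} \<tau>"
    and A0: "intw n {..<e} \<tau> I \<rho> A0" and B0: "B0 \<in> mats {..<e} I" "mmult I B0 A0 = idm {..<e}"
    and range: "\<And>c. mapply {..<e} A0 c \<in> W"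
    by (rule exists_irreducible_subrep[OF \<rho>]) (rule that)
  obtain B1 where B1: "intw n I \<rho> {..<e} \<tau> B1" "mmult I B1 A0 = idm {..<e}"
    by (rule left_inverse_average[OF \<rho> \<tau>(1) A0 B0]) (rule that)
  have BA0: "mmult I (B j) A0 = 0" if j: "j < k" for j
  proof (rule mats_eqI_mapply)
    show "mmult I (B j) A0 \<in> mats {..<d j} {..<e}"
      using intwD(1)[OF irr_systemD(4)[OF S j]] intwD(1)[OF A0] by simp
    fix c
    show "mapply {..<e} (mmult I (B j) A0) c = mapply {..<e} 0 c"
      using range[of c] j fin by (simp add: W_def mapply_mmult)
  qed auto
  \<comment> \<open>The averaged projection \<open>B1\<close> need not vanish on the earlier
    constituents. \<open>Q\<close> kills them and fixes \<open>A0\<close>, so \<open>B1\<close>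
    composed with \<open>Q\<close> does.\<close>
  define Q where "Q = idm I - (\<Sum>j<k. mmult {..<d j} (A j) (B j))"
  have Q: "intw n I \<rho> I \<rho> Q" unfolding Q_def
    using irr_systemD[OF S] fin \<rho> by (auto intro!: intw_diff intw_idm intw_sum intw_comp[of _ "{..<d _}"])
  have QA0: "mmult I Q A0 = A0"
    using intwD(1)[OF A0] fin
    by (simp add: Q_def mmult_diff mmult_sum_left mmult_assoc BA0 mmult_idm_left)
  have QA: "mmult I Q (A j) = 0" if j: "j < k" for j
  proof -
    have "mmult I (mmult {..<d i} (A i) (B i)) (A j) = (if i = j then A j else 0)" if i: "i < k" for i
      using irr_systemD(5)[OF S j] irr_systemD(6)[OF S i j] intwD(1)[OF irr_systemD(3)[OF S j]]
      by (simp add: mmult_assoc[OF _ fin] mmult_idm_right)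
    then have "(\<Sum>i<k. mmult I (mmult {..<d i} (A i) (B i)) (A j)) = A j"
      using j by simp
    then show ?thesis using intwD(1)[OF irr_systemD(3)[OF S j]] fin
      by (simp add: Q_def mmult_diff mmult_sum_left mmult_idm_left)
  qed
  define B2 where "B2 = mmult I B1 Q"
  have B2: "intw n I \<rho> {..<e} \<tau> B2" unfolding B2_def by (intro intw_comp[OF fin fin _ Q B1(1)]) simp
  have B2A0: "mmult I B2 A0 = idm {..<e}"
    using B1(2) fin by (simp add: B2_def mmult_assoc QA0)
  have B2A: "mmult I B2 (A j) = 0" if "j < k" for j
    using fin by (simp add: B2_def mmult_assoc QA[OF that])
  have "irr_system n I \<rho> (Suc k) (d(k := e)) (\<sigma>(k := \<tau>)) (A(k := A0)) (B(k := B2))"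
    unfolding irr_system_def
  proof (intro conjI allI impI)
    fix i j assume "i < Suc k" "j < Suc k"
    then show "mmult I ((B(k := B2)) i) ((A(k := A0)) j)
        = (\<lambda>x y. if i = j then idm {..<(d(k := e)) i} x y else 0)"
      using irr_systemD(5)[OF S, of i] irr_systemD(6)[OF S, of i j] BA0[of i] B2A[of j] B2A0
      by (auto simp: less_Suc_eq fun_eq_iff)
  qed (use irr_systemD[OF S] \<tau> A0 B2 in \<open>auto simp: less_Suc_eq\<close>)
  then show ?thesis by blast
qed

text \<open>Take the largest system. The remainder of a vector after subtracting its components is
  killed by all projections, so a nonzero remainder would allow an extension.\<close>

lemma irr_system_complete:
  assumes \<rho>: "srep n I \<rho>"
  obtains k d \<sigma> A B where "irr_system n I \<rho> k d \<sigma> A B" "(\<Sum>j<k. mmult {..<d j} (A j) (B j)) = idm I"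
proof -
  note fin = srepD(1)[OF \<rho>]
  define S where "S = {k. \<exists>d \<sigma> A B. irr_system n I \<rho> k d \<sigma> A B}"
  have "0 \<in> S" by (auto simp: S_def irr_system_def)
  moreover have "finite S"
    by (rule finite_subset[of _ "{..card I}"]) (auto simp: S_def irr_system_bound[OF fin])
  ultimately have Max: "Max S \<in> S" "\<And>k. k \<in> S \<Longrightarrow> k \<le> Max S"
    using Max_in[of S] Max_ge[of S] by blast+
  then obtain d \<sigma> A B where sys: "irr_system n I \<rho> (Max S) d \<sigma> A B" by (auto simp: S_def)
  let ?k = "Max S"
  let ?P = "\<Sum>j<?k. mmult {..<d j} (A j) (B j)"
  have Pm: "?P \<in> mats I I"
    using intwD(1)[OF irr_systemD(3)[OF sys]] intwD(1)[OF irr_systemD(4)[OF sys]]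
    by (intro sum_mats mmult_mats) auto
  have "?P = idm I"
  proof (rule mats_eqI_mapply[OF fin Pm])
    fix v assume v: "v \<in> vecs I"
    define w where "w = mapply I (idm I - ?P) v"
    have w: "w \<in> vecs I" unfolding w_def using Pm by simp
    have "mapply I (B i) w = (\<lambda>_. 0)" if i: "i < ?k" for i
    proof -
      have "mmult I (B i) (mmult {..<d j} (A j) (B j)) = (if i = j then B i else 0)" if j: "j < ?k" for j
        using irr_systemD(5)[OF sys i] irr_systemD(6)[OF sys i j] intwD(1)[OF irr_systemD(4)[OF sys i]] fin
        by (cases "i = j") (simp_all add: mmult_assoc[symmetric] mmult_idm_left)
      then have "mmult I (B i) ?P = B i" using i by (simp add: mmult_sum_right)
      then have "mmult I (B i) (idm I - ?P) = 0"
        using intwD(1)[OF irr_systemD(4)[OF sys i]] fin by (simp add: mmult_diff mmult_idm_right)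
      then show ?thesis unfolding w_def using fin by (simp add: mapply_mmult[symmetric])
    qed
    then have "w = (\<lambda>_. 0)"
      using irr_system_extend[OF \<rho> sys w] Max(2)[of "Suc ?k"] by (fastforce simp: S_def)
    then show "mapply I ?P v = mapply I (idm I) v"
      by (auto simp: w_def mapply_diff_left fun_eq_iff)
  qed simp
  with sys that show ?thesis by blast
qed

subsection \<open>Characters\<close>

definition mtrace :: "'a set \<Rightarrow> ('a \<Rightarrow> 'a \<Rightarrow> complex) \<Rightarrow> complex" where
  "mtrace I M = (\<Sum>x\<in>I. M x x)"

lemma mtrace_mmult: "mtrace I (mmult J M N) = mtrace J (mmult I N M)"
  unfolding mtrace_def mmult_def by (subst sum.swap) (simp add: mult.commute)

lemma mtrace_conj:
  assumes \<sigma>: "srep n I \<sigma>" and "p \<in> perms n" "g \<in> perms n"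
  shows "mtrace I (\<sigma> (p \<circ> g \<circ> inv p)) = mtrace I (\<sigma> g)"
proof -
  have "mtrace I (\<sigma> (p \<circ> g \<circ> inv p)) = mtrace I (mmult I (\<sigma> (p \<circ> g)) (\<sigma> (inv p)))"
    using assms by (simp add: srepD(4)[OF \<sigma>])
  also have "\<dots> = mtrace I (mmult I (\<sigma> (inv p)) (\<sigma> (p \<circ> g)))" by (rule mtrace_mmult)
  also have "\<dots> = mtrace I (\<sigma> (inv p \<circ> (p \<circ> g)))" using assms by (simp add: srepD(4)[OF \<sigma>])
  also have "inv p \<circ> (p \<circ> g) = g" using assms by (simp add: o_assoc perms_inv_o)
  finally show ?thesis .
qed

definition unit_mat :: "'a \<Rightarrow> 'b \<Rightarrow> 'a \<Rightarrow> 'b \<Rightarrow> complex" where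
  "unit_mat x y = (\<lambda>u v. if u = x \<and> v = y then 1 else 0)"

lemma unit_mat_mats: "x \<in> I \<Longrightarrow> y \<in> J \<Longrightarrow> unit_mat x y \<in> mats I J"
  by (auto simp: unit_mat_def mats_def)

lemma average_unit_mat:
  fixes \<rho> :: "(nat \<Rightarrow> nat) \<Rightarrow> 'a \<Rightarrow> 'a \<Rightarrow> complex" and \<tau> :: "(nat \<Rightarrow> nat) \<Rightarrow> 'b \<Rightarrow> 'b \<Rightarrow> complex"
  assumes "finite I" "finite J" "x \<in> J" "y \<in> I"
  shows "average n I \<rho> J \<tau> (unit_mat x y) u v = (\<Sum>g\<in>perms n. \<tau> g u x * \<rho> (inv g) y v)"
proof -
  have *: "mmult I (unit_mat x y) M w v = (if w = x then M y v else 0)" for M :: "'a \<Rightarrow> 'a \<Rightarrow> complex" and w v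
  proof -
    have *: "mmult I (unit_mat x y) M w v = (\<Sum>z\<in>I. if z = y then if w = x then M y v else 0 else 0)"
      unfolding mmult_def unit_mat_def by (intro sum.cong) auto
    then show ?thesis using assms by simp
  qed
  have "mmult J M (mmult I (unit_mat x y) N) u v = M u x * N y v"
    for M :: "'b \<Rightarrow> 'b \<Rightarrow> complex" and N :: "'a \<Rightarrow> 'a \<Rightarrow> complex"
    using assms unfolding mmult_def[of J] * by (simp add: if_distrib cong: if_cong)
  then show ?thesis by (simp add: average_def sum_fun_apply)
qed

text \<open>Expresses the pairing of two characters through averaged matrix units, which are
  intertwiners, so that Schur's lemma evaluates it. \<open>inv g\<close> stands where the usual
  inner product has a complex conjugate.\<close>

lemma character_pairing:
  assumes "finite I" "finite J"
  shows "(\<Sum>g\<in>perms n. mtrace J (\<tau> g) * mtrace I (\<rho> (inv g)))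
    = (\<Sum>x\<in>J. \<Sum>y\<in>I. average n I \<rho> J \<tau> (unit_mat x y) x y)"
proof -
  have "(\<Sum>g\<in>perms n. mtrace J (\<tau> g) * mtrace I (\<rho> (inv g)))
      = (\<Sum>g\<in>perms n. \<Sum>x\<in>J. \<Sum>y\<in>I. \<tau> g x x * \<rho> (inv g) y y)"
    by (simp add: mtrace_def sum_product)
  also have "\<dots> = (\<Sum>x\<in>J. \<Sum>y\<in>I. \<Sum>g\<in>perms n. \<tau> g x x * \<rho> (inv g) y y)"
    by (subst sum.swap, rule sum.cong[OF refl], rule sum.swap)
  also have "\<dots> = (\<Sum>x\<in>J. \<Sum>y\<in>I. average n I \<rho> J \<tau> (unit_mat x y) x y)"
    using assms by (intro sum.cong refl) (simp add: average_unit_mat)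
  finally show ?thesis .
qed

lemma characters_orthogonal:
  assumes "irreducible_rep n I \<rho>" "srep n I \<rho>" "irreducible_rep n J \<tau>" "srep n J \<tau>" "\<not> rep_iso n I \<rho> J \<tau>"
  shows "(\<Sum>g\<in>perms n. mtrace J (\<tau> g) * mtrace I (\<rho> (inv g))) = 0"
proof -
  have "average n I \<rho> J \<tau> (unit_mat x y) = 0" if "x \<in> J" "y \<in> I" for x y
    using schur[OF assms(1-4) average_intw[OF assms(2,4) unit_mat_mats[OF that]]] assms(5) by blast
  then show ?thesis using assms by (simp add: character_pairing srepD(1))
qed

text \<open>Each averaged matrix unit is a scalar matrix. Its trace is computed a second time by
  multiplying \<open>\<rho> (inv g)\<close> with \<open>\<rho> g\<close>, which fixes the scalar as
  the group order divided by \<open>d\<close> for \<open>x = y\<close> and as zero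
  otherwise.\<close>

lemma character_norm:
  fixes \<rho> :: "(nat \<Rightarrow> nat) \<Rightarrow> nat \<Rightarrow> nat \<Rightarrow> complex"
  assumes irr: "irreducible_rep n {..<d} \<rho>" and \<rho>: "srep n {..<d} \<rho>"
  shows "(\<Sum>g\<in>perms n. mtrace {..<d} (\<rho> g) * mtrace {..<d} (\<rho> (inv g))) \<noteq> 0"
proof -
  let ?avg = "\<lambda>x y. average n {..<d} \<rho> {..<d} \<rho> (unit_mat x y)"
  let ?N = "of_nat (card (perms n)) :: complex"
  have d: "d > 0" by (rule irreducible_dim_pos[OF irr])
  have avg: "?avg x y x y = (if x = y then ?N / of_nat d else 0)" if xy: "x < d" "y < d" for x y
  proof -
    obtain c where c: "?avg x y = smul c (idm {..<d})"
      using schur_scalar[OF irr \<rho> average_intw[OF \<rho> \<rho> unit_mat_mats]] xy by blast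
    have "of_nat d * c = mtrace {..<d} (?avg x y)"
      unfolding c by (simp add: mtrace_def smul_def idm_def)
    also have "\<dots> = (\<Sum>z<d. \<Sum>g\<in>perms n. \<rho> g z x * \<rho> (inv g) y z)"
      using xy by (simp add: mtrace_def average_unit_mat)
    also have "\<dots> = (\<Sum>g\<in>perms n. mmult {..<d} (\<rho> (inv g)) (\<rho> g) y x)"
      unfolding mmult_def by (subst sum.swap) (simp add: mult.commute)
    also have "\<dots> = (if x = y then ?N else 0)"
      using xy by (simp add: srepD(3,4)[OF \<rho>] perms_inv_o idm_def)
    finally have "c = (if x = y then ?N / of_nat d else 0)" using d by (auto simp: field_simps)
    then show ?thesis using xy by (simp add: c smul_def idm_def)
  qed
  have "(\<Sum>g\<in>perms n. mtrace {..<d} (\<rho> g) * mtrace {..<d} (\<rho> (inv g)))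
      = (\<Sum>x<d. \<Sum>y<d. if x = y then ?N / of_nat d else 0)"
    unfolding character_pairing[OF finite_lessThan finite_lessThan] using avg by (intro sum.cong refl) auto
  also have "\<dots> = ?N" using d by simp
  finally show ?thesis using perms_id[of n] by (auto simp del: perms_id)
qed

text \<open>Characters are determined by their values on \<open>R\<close>. More characters than
  elements of \<open>R\<close> would satisfy a linear relation, and pairing it with a character that
  occurs in it contradicts orthogonality.\<close>

lemma irreducibles_le_classes:
  fixes d :: "nat \<Rightarrow> nat"
  assumes irr: "\<And>j. j < m \<Longrightarrow> irreducible_rep n {..<d j} (\<sigma> j)"
    and rep: "\<And>j. j < m \<Longrightarrow> srep n {..<d j} (\<sigma> j)"
    and noniso: "\<And>i j. i < m \<Longrightarrow> j < m \<Longrightarrow> i \<noteq> j \<Longrightarrow> \<not> rep_iso n {..<d i} (\<sigma> i) {..<d j} (\<sigma> j)"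
    and R: "finite R" "R \<subseteq> perms n" "\<And>g. g \<in> perms n \<Longrightarrow> \<exists>r\<in>R. \<exists>p\<in>perms n. g = p \<circ> r \<circ> inv p"
  shows "m \<le> card R"
proof (rule ccontr)
  assume "\<not> ?thesis"
  then have "card R < card {..<m}" by simp
  from underdetermined_system[OF R(1) _ this, of "\<lambda>r j. mtrace {..<d j} (\<sigma> j r)"] obtain a i where
    i: "i < m" "a i \<noteq> 0" and *: "\<And>r. r \<in> R \<Longrightarrow> (\<Sum>j<m. mtrace {..<d j} (\<sigma> j r) * a j) = 0" by auto
  have 0: "(\<Sum>j<m. mtrace {..<d j} (\<sigma> j g) * a j) = 0" if g: "g \<in> perms n" for g
  proof -
    obtain r p where r: "r \<in> R" "p \<in> perms n" "g = p \<circ> r \<circ> inv p" using R(3)[OF g] by blast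
    then have "mtrace {..<d j} (\<sigma> j g) = mtrace {..<d j} (\<sigma> j r)" if "j < m" for j
      using mtrace_conj[OF rep[OF that]] R(2) by auto
    with *[OF r(1)] show ?thesis by simp
  qed
  let ?S = "\<lambda>j. \<Sum>g\<in>perms n. mtrace {..<d j} (\<sigma> j g) * mtrace {..<d i} (\<sigma> i (inv g))"
  have "0 = (\<Sum>g\<in>perms n. (\<Sum>j<m. mtrace {..<d j} (\<sigma> j g) * a j) * mtrace {..<d i} (\<sigma> i (inv g)))"
    by (simp add: 0)
  also have "\<dots> = (\<Sum>g\<in>perms n. \<Sum>j<m. a j * (mtrace {..<d j} (\<sigma> j g) * mtrace {..<d i} (\<sigma> i (inv g))))"
    by (simp add: sum_distrib_right mult.assoc) (simp add: mult.left_commute mult.commute)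
  also have "\<dots> = (\<Sum>j<m. a j * ?S j)"
    by (subst sum.swap) (simp add: sum_distrib_left)
  also have "\<dots> = (\<Sum>j<m. if j = i then a i * ?S i else 0)"
    using i irr rep noniso by (intro sum.cong refl) (auto intro!: characters_orthogonal)
  also have "\<dots> = a i * ?S i" using i by simp
  finally show False using i character_norm[OF irr rep] by simp
qed

subsection \<open>A criterion for Gelfand models\<close>

text \<open>An isomorphism between two constituents gives the endomorphism \<open>K\<close> moving
  constituent \<open>i\<close> onto \<open>j\<close>. With the projection \<open>L\<close> onto
  \<open>i\<close>, \<open>K L = K\<close> but \<open>L K = 0\<close>, so commuting forces
  \<open>K = 0\<close> and hence the isomorphism to vanish.\<close>

lemma irr_system_noniso:
  assumes \<rho>: "srep n I \<rho>" and S: "irr_system n I \<rho> k d \<sigma> A B"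
    and comm: "\<And>K L. intw n I \<rho> I \<rho> K \<Longrightarrow> intw n I \<rho> I \<rho> L \<Longrightarrow> mmult I K L = mmult I L K"
    and ij: "i < k" "j < k" "i \<noteq> j"
  shows "\<not> rep_iso n {..<d i} (\<sigma> i) {..<d j} (\<sigma> j)"
proof
  note fin = srepD(1)[OF \<rho>]
  note S' = irr_systemD[OF S]
  assume "rep_iso n {..<d i} (\<sigma> i) {..<d j} (\<sigma> j)"
  then obtain T U where T: "intw n {..<d i} (\<sigma> i) {..<d j} (\<sigma> j) T" and UT: "mmult {..<d j} U T = idm {..<d i}"
    using rep_iso_supported S'(1) ij by metis
  define K where "K = mmult {..<d j} (A j) (mmult {..<d i} T (B i))"
  define L where "L = mmult {..<d i} (A i) (B i)"
  have "intw n I \<rho> I \<rho> K" unfolding K_def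
    by (intro intw_comp[OF fin _ fin _ S'(3)] intw_comp[OF fin _ _ _ T] S'(4) ij) auto
  moreover have "intw n I \<rho> I \<rho> L" unfolding L_def
    by (intro intw_comp[OF fin _ fin _ S'(3)] S'(4) ij) auto
  ultimately have "mmult I K L = mmult I L K" by (rule comm)
  moreover have "mmult I L K = 0"
  proof -
    have "mmult I L K = mmult {..<d i} (A i) (mmult {..<d j} (mmult I (B i) (A j)) (mmult {..<d i} T (B i)))"
      unfolding K_def L_def using fin by (simp add: mmult_assoc)
    then show ?thesis using ij by (simp add: S'(6))
  qed
  moreover have "mmult I K L = K"
  proof -
    have "mmult I K L = mmult {..<d j} (A j) (mmult {..<d i} T (mmult {..<d i} (mmult I (B i) (A i)) (B i)))"
      unfolding K_def L_def using fin by (simp add: mmult_assoc)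
    then show ?thesis using ij intwD(1)[OF S'(4)[OF ij(1)]] by (simp add: S'(5) K_def mmult_idm_left)
  qed
  ultimately have "K = 0" by simp
  have "T = mmult {..<d j} (mmult I (B j) (A j)) (mmult {..<d i} T (mmult I (B i) (A i)))"
    using ij intwD(1)[OF T] by (simp add: S'(5) mmult_idm_left mmult_idm_right)
  also have "\<dots> = mmult I (B j) (mmult I K (A i))"
    unfolding K_def using fin by (simp add: mmult_assoc)
  also have "\<dots> = 0" by (simp add: \<open>K = 0\<close>)
  finally have "idm {..<d i} = 0" using UT by simp
  then have "idm {..<d i} 0 0 = 0" by simp
  then show False using irreducible_dim_pos[OF S'(2)[OF ij(1)]] by (simp add: idm_def)
qed

text \<open>By Schur's lemma an endomorphism is zero between different constituents and a scalar on
  each one, so \<open>k\<close> numbers determine it. With more than \<open>k\<close> of them, some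
  nontrivial combination has all these scalars equal to zero; entry \<open>0 0\<close> of a block
  reads off its scalar.\<close>

lemma independent_intertwiners_le:
  assumes \<rho>: "srep n I \<rho>" and S: "irr_system n I \<rho> k d \<sigma> A B"
    and complete: "(\<Sum>j<k. mmult {..<d j} (A j) (B j)) = idm I"
    and noniso: "\<And>i j. i < k \<Longrightarrow> j < k \<Longrightarrow> i \<noteq> j \<Longrightarrow> \<not> rep_iso n {..<d i} (\<sigma> i) {..<d j} (\<sigma> j)"
    and R: "finite R" "\<And>r. r \<in> R \<Longrightarrow> intw n I \<rho> I \<rho> (K r)"
      "\<And>a. (\<Sum>r\<in>R. smul (a r) (K r)) = 0 \<Longrightarrow> \<forall>r\<in>R. a r = 0"
  shows "card R \<le> k"
proof (rule ccontr)
  note fin = srepD(1)[OF \<rho>]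
  note S' = irr_systemD[OF S]
  assume "\<not> ?thesis"
  then have "card {..<k} < card R" by simp
  from underdetermined_system[OF _ R(1) this, of "\<lambda>j r. mmult I (B j) (mmult I (K r) (A j)) 0 0"]
  obtain a where a: "\<exists>r\<in>R. a r \<noteq> 0"
    "\<And>j. j < k \<Longrightarrow> (\<Sum>r\<in>R. mmult I (B j) (mmult I (K r) (A j)) 0 0 * a r) = 0" by auto
  define L where "L = (\<Sum>r\<in>R. smul (a r) (K r))"
  have L: "intw n I \<rho> I \<rho> L" unfolding L_def by (intro intw_sum intw_smul R(2))
  have block: "mmult I (B i) (mmult I L (A j)) = 0" if ij: "i < k" "j < k" for i j
  proof (cases "i = j")
    case False
    then show ?thesis
      using schur[OF S'(2)[OF ij(2)] S'(1)[OF ij(2)] S'(2)[OF ij(1)] S'(1)[OF ij(1)]]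
        intw_comp[OF _ fin _ intw_comp[OF _ fin fin S'(3)[OF ij(2)] L] S'(4)[OF ij(1)]] noniso[of j i] ij
      by blast
  next
    case True
    have tw: "intw n {..<d j} (\<sigma> j) {..<d j} (\<sigma> j) (mmult I (B j) (mmult I L (A j)))"
      using intw_comp[OF _ fin _ intw_comp[OF _ fin fin S'(3)[OF ij(2)] L] S'(4)[OF ij(2)]] by simp
    obtain c where c: "mmult I (B j) (mmult I L (A j)) = smul c (idm {..<d j})"
      using schur_scalar[OF S'(2)[OF ij(2)] S'(1)[OF ij(2)] tw] by blast
    have "c = mmult I (B j) (mmult I L (A j)) 0 0"
      unfolding c using irreducible_dim_pos[OF S'(2)[OF ij(2)]] by (simp add: smul_def idm_def)
    also have "\<dots> = 0"
      using a(2)[OF ij(2)]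
      by (simp add: L_def mmult_sum_left mmult_sum_right mmult_smul sum_fun_apply) (simp add: smul_def mult.commute)
    finally show ?thesis unfolding True c by (simp add: smul_def fun_eq_iff)
  qed
  \<comment> \<open>Inserting the decomposition of the identity on both sides writes
    \<open>L\<close> as the sum of its blocks, all of which vanish.\<close>
  have "L = mmult I (idm I) (mmult I L (idm I))"
    using intwD(1)[OF L] fin by (simp add: mmult_idm_left mmult_idm_right)
  also have "\<dots> = (\<Sum>i<k. \<Sum>j<k. mmult {..<d i} (A i) (mmult {..<d j} (mmult I (B i) (mmult I L (A j))) (B j)))"
    unfolding complete[symmetric] mmult_sum_left mmult_sum_right using fin
    by (simp add: mmult_assoc) (rule sum.swap)
  also have "\<dots> = 0" by (simp add: block)
  finally have "L = 0" .
  with R(3)[of a] a(1) show False unfolding L_def by blast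
qed

lemma irr_system_rep_iso:
  assumes \<rho>: "srep n I \<rho>" and S: "irr_system n I \<rho> k d \<sigma> A B"
    and complete: "(\<Sum>j<k. mmult {..<d j} (A j) (B j)) = idm I"
  shows "rep_iso n I \<rho> (SIGMA j:{..<k}. {..<d j}) (dsum \<sigma>)"
proof -
  note fin = srepD(1)[OF \<rho>]
  note S' = irr_systemD[OF S]
  let ?J = "SIGMA j:{..<k}. {..<d j}"
  define T where "T = (\<lambda>(j, a) x. B j a x)"
  define U where "U = (\<lambda>x (j, a). A j x a)"
  show ?thesis unfolding rep_iso_def
  proof (intro exI[of _ T] exI[of _ U] conjI ballI)
    fix x y assume "x \<in> I" "y \<in> I"
    have "mmult ?J U T x y = (\<Sum>j<k. mmult {..<d j} (A j) (B j)) x y"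
      by (simp add: mmult_def T_def U_def sum.Sigma sum_fun_apply case_prod_unfold)
    with \<open>x \<in> I\<close> show "mmult ?J U T x y = mid x y" by (simp add: complete idm_def mid_def)
  next
    fix x y assume xy: "x \<in> ?J" "y \<in> ?J"
    obtain i a j b where [simp]: "x = (i, a)" "y = (j, b)" by (cases x, cases y)
    have "mmult I T U x y = mmult I (B i) (A j) a b" by (simp add: mmult_def T_def U_def)
    also have "\<dots> = mid x y" using xy S'(5)[of i] S'(6)[of i j]
      by (cases "i = j") (auto simp: idm_def mid_def)
    finally show "mmult I T U x y = mid x y" .
  next
    fix p x y assume p: "p \<in> perms n" and x: "x \<in> ?J"
    obtain i a where [simp]: "x = (i, a)" by (cases x)
    have i: "i < k" using x by simp
    have "mmult ?J (dsum \<sigma> p) T x y = (\<Sum>j<k. \<Sum>b<d j. (if i = j then \<sigma> i p a b else 0) * B j b y)"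
      by (simp add: mmult_def T_def dsum_def sum.Sigma case_prod_unfold cong: if_cong)
    also have "\<dots> = (\<Sum>j<k. if j = i then \<Sum>b<d i. \<sigma> i p a b * B i b y else 0)"
      by (intro sum.cong refl) auto
    also have "\<dots> = mmult {..<d i} (\<sigma> i p) (B i) a y" using i by (simp add: mmult_def)
    also have "\<dots> = mmult I T (\<rho> p) x y"
      by (simp add: intwD(2)[OF S'(4)[OF i] p]) (simp add: mmult_def T_def)
    finally show "mmult ?J (dsum \<sigma> p) T x y = mmult I T (\<rho> p) x y" .
  qed
qed

text \<open>Commuting endomorphisms make the constituents pairwise non-isomorphic, and the
  independent \<open>K r\<close> give \<open>card R \<le> k\<close>. An irreducible outside the list
  would make \<open>k + 1\<close> inequivalent ones, more than \<open>card R\<close> allows.\<close>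

theorem gelfand_model_criterion:
  assumes \<rho>: "srep n I \<rho>"
    and comm: "\<And>K L. intw n I \<rho> I \<rho> K \<Longrightarrow> intw n I \<rho> I \<rho> L \<Longrightarrow> mmult I K L = mmult I L K"
    and R: "finite R" "R \<subseteq> perms n" "\<And>g. g \<in> perms n \<Longrightarrow> \<exists>r\<in>R. \<exists>p\<in>perms n. g = p \<circ> r \<circ> inv p"
    and K: "\<And>r. r \<in> R \<Longrightarrow> intw n I \<rho> I \<rho> (K r)"
      "\<And>a. (\<Sum>r\<in>R. smul (a r) (K r)) = 0 \<Longrightarrow> \<forall>r\<in>R. a r = 0"
  shows "gelfand_model n I \<rho>"
proof -
  obtain k d \<sigma> A B where S: "irr_system n I \<rho> k d \<sigma> A B"
    and complete: "(\<Sum>j<k. mmult {..<d j} (A j) (B j)) = idm I"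
    by (rule irr_system_complete[OF \<rho>]) (rule that)
  note S' = irr_systemD[OF S]
  have noniso: "\<not> rep_iso n {..<d i} (\<sigma> i) {..<d j} (\<sigma> j)" if "i < k" "j < k" "i \<noteq> j" for i j
    using irr_system_noniso[OF \<rho> S comm] that by blast
  have "card R \<le> k"
    by (rule independent_intertwiners_le[OF \<rho> S complete noniso R(1) K])
  have exhaust: "\<exists>j<k. rep_iso n {..<m} \<tau> {..<d j} (\<sigma> j)"
    if \<tau>: "irreducible_rep n {..<m} \<tau>" for m :: nat and \<tau>
  proof (rule ccontr)
    assume none: "\<not> ?thesis"
    define \<tau>' where "\<tau>' p = mrestrict {..<m} {..<m} (\<tau> p)" for p
    have irr': "irreducible_rep n {..<m} \<tau>'"
      unfolding \<tau>'_def by (rule irreducible_rep_mrestrict[OF \<tau>])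
    have rep': "srep n {..<m} \<tau>'"
      unfolding \<tau>'_def using \<tau> by (intro is_rep_imp_srep) (simp add: irreducible_rep_def)
    have none': "\<not> rep_iso n {..<m} \<tau>' {..<d j} (\<sigma> j)" if "j < k" for j
      using none that rep_iso_cong[of n "{..<m}" \<tau>' \<tau> "{..<d j}" "\<sigma> j"] by (auto simp: \<tau>'_def mrestrict_def)
    then have none'': "\<not> rep_iso n {..<d j} (\<sigma> j) {..<m} \<tau>'" if "j < k" for j
      using rep_iso_sym S'(1) rep' that by metis
    have "Suc k \<le> card R"
      by (rule irreducibles_le_classes[of "Suc k" n "d(k := m)" "\<sigma>(k := \<tau>')", OF _ _ _ R])
        (use S' irr' rep' noniso none' none'' in \<open>auto simp: less_Suc_eq\<close>)
    with \<open>card R \<le> k\<close> show False by simp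
  qed
  show ?thesis unfolding gelfand_model_def
    using S'(2) noniso exhaust irr_system_rep_iso[OF \<rho> S complete]
    by (intro exI[of _ k] exI[of _ d] exI[of _ \<sigma>]) blast
qed

subsection \<open>Signed conjugation of involutions\<close>

definition cact :: "(nat \<Rightarrow> nat) \<Rightarrow> (nat \<Rightarrow> nat) \<Rightarrow> nat \<Rightarrow> nat" where
  "cact p w = p \<circ> w \<circ> inv p"

definition vsign :: "(nat \<Rightarrow> nat) \<Rightarrow> (nat \<Rightarrow> nat) \<Rightarrow> complex" where
  "vsign p w = (\<Prod>x | x < w x. if p x < p (w x) then 1 else -1)"

definition ori :: "(nat \<Rightarrow> nat) \<Rightarrow> nat \<Rightarrow> complex" where
  "ori w x = (if x < w x then 1 else -1)"

text \<open>One point from each 2-cycle of \<open>w\<close>, that is, an orientation of the edges.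
  The first conjunct also keeps fixed points out.\<close>

definition transversal :: "(nat \<Rightarrow> nat) \<Rightarrow> nat set \<Rightarrow> bool" where
  "transversal w T \<longleftrightarrow> (\<forall>x\<in>T. w x \<notin> T) \<and> (\<forall>x. w x \<noteq> x \<longrightarrow> x \<in> T \<or> w x \<in> T)"

lemma invols_perms: "w \<in> invols n \<Longrightarrow> w \<in> perms n"
  by (simp add: invols_def)

lemma invols_twice: "w \<in> invols n \<Longrightarrow> w (w x) = x"
  by (auto simp: invols_def dest: fun_cong[of _ _ x])

lemma finite_invols [simp]: "finite (invols n)"
  by (simp add: invols_def)

lemma perms_moved: "p \<in> perms n \<Longrightarrow> p x \<noteq> x \<Longrightarrow> x \<in> {1..n}"
  using permutes_not_in by (fastforce simp: perms_def)

lemma perms_inject [simp]: "p \<in> perms n \<Longrightarrow> p x = p y \<longleftrightarrow> x = y"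
  using perms_bij bij_is_inj inj_eq by metis

lemma perms_inv_apply [simp]:
  assumes "p \<in> perms n" shows "inv p (p x) = x" "p (inv p x) = x"
  using perms_bij[OF assms] by (simp_all add: bij_is_inj bij_is_surj surj_f_inv_f)

lemma cact_apply [simp]: "p \<in> perms n \<Longrightarrow> cact p w (p x) = p (w x)"
  by (simp add: cact_def)

lemma cact_perms [simp]: "p \<in> perms n \<Longrightarrow> w \<in> perms n \<Longrightarrow> cact p w \<in> perms n"
  by (simp add: cact_def)

lemma involsI: "w \<in> perms n \<Longrightarrow> (\<And>x. w (w x) = x) \<Longrightarrow> w \<in> invols n"
  by (auto simp: invols_def)

lemma cact_invols [simp]:
  assumes "p \<in> perms n" "w \<in> invols n" shows "cact p w \<in> invols n"
proof (rule involsI)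
  show "cact p w (cact p w x) = x" for x
    using assms by (simp add: cact_def invols_twice)
qed (use assms in \<open>simp add: invols_perms\<close>)

lemma cact_comp: "p \<in> perms n \<Longrightarrow> q \<in> perms n \<Longrightarrow> cact (p \<circ> q) w = cact p (cact q w)"
  by (simp add: cact_def perms_inv_comp o_assoc)

lemma cact_id [simp]: "cact id w = w"
  by (simp add: cact_def)

lemma cact_eqI: "p \<in> perms n \<Longrightarrow> (\<And>x. p (w x) = v (p x)) \<Longrightarrow> cact p w = v"
  by (auto simp: cact_def fun_eq_iff)

lemma cact_inv_cact: "p \<in> perms n \<Longrightarrow> cact (inv p) (cact p w) = w"
  using cact_comp[of "inv p" n p w] by (simp add: perms_inv_o)

lemma cact_cact_inv: "p \<in> perms n \<Longrightarrow> cact p (cact (inv p) w) = w"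
  using cact_comp[of p n "inv p" w] by (simp add: perms_inv_o)

lemma ori_sq [simp]: "ori w x * ori w x = 1"
  by (simp add: ori_def)

lemma ori_flip: "w \<in> invols n \<Longrightarrow> w x \<noteq> x \<Longrightarrow> ori w (w x) = - ori w x"
  by (auto simp: ori_def invols_twice)

lemma transversal_finite:
  assumes "w \<in> perms n" "transversal w T" shows "finite T"
proof (rule finite_subset)
  have "w x \<noteq> x" if "x \<in> T" for x using assms(2) that unfolding transversal_def by metis
  then show "T \<subseteq> {1..n}" using perms_moved[OF assms(1)] by blast
qed simp

lemma transversal_less: "w \<in> invols n \<Longrightarrow> transversal w {x. x < w x}"
  by (auto simp: transversal_def invols_twice)

text \<open>Replacing \<open>x\<close> by \<open>w x\<close> flips both orientations in its factor
  and leaves the product unchanged. Hence the smaller points used in the definition can be exchanged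
  for any transversal.\<close>

lemma vsign_transversal:
  assumes w: "w \<in> invols n" and p: "p \<in> perms n" and T: "transversal w T"
  shows "vsign p w = (\<Prod>x\<in>T. ori w x * ori (cact p w) (p x))"
proof -
  let ?t = "\<lambda>x. if x < w x then x else w x"
  have ww: "w (w x) = x" for x by (rule invols_twice[OF w])
  have ori: "ori (cact p w) (p x) = (if p x < p (w x) then 1 else -1)" for x
    using p by (simp add: ori_def)
  have "(\<Prod>x\<in>T. ori w x * ori (cact p w) (p x)) = (\<Prod>x | x < w x. if p x < p (w x) then 1 else -1)"
  proof (rule prod.reindex_bij_witness[of _ "\<lambda>x. if x \<in> T then x else w x" ?t])
    fix x assume x: "x \<in> T"
    then have wx: "w x \<notin> T" "w x \<noteq> x" using T by (auto simp: transversal_def)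
    show "(if ?t x \<in> T then ?t x else w (?t x)) = x" using x wx ww by auto
    show "?t x \<in> {x. x < w x}" using wx ww by auto
    have "p (w x) \<noteq> p x" using p wx by simp
    then show "(if p (?t x) < p (w (?t x)) then 1 else -1) = ori w x * ori (cact p w) (p x)"
      using wx unfolding ori by (auto simp: ori_def ww)
  next
    fix x assume x: "x \<in> {x. x < w x}"
    then have *: "x \<in> T \<or> w x \<in> T" using T by (auto simp: transversal_def)
    then show "(if x \<in> T then x else w x) \<in> T" by auto
    show "?t (if x \<in> T then x else w x) = x" using x ww by auto
  qed
  then show ?thesis by (simp add: vsign_def)
qed

lemma transversal_cact:
  assumes p: "p \<in> perms n" and T: "transversal w T"
  shows "transversal (cact p w) (p ` T)"
  unfolding transversal_def
proof (intro conjI ballI allI impI)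
  fix y assume "y \<in> p ` T"
  then show "cact p w y \<notin> p ` T" using p T by (auto simp: transversal_def)
next
  fix y assume y: "cact p w y \<noteq> y"
  obtain x where [simp]: "y = p x" using perms_inv_apply(2)[OF p] by metis
  from y show "y \<in> p ` T \<or> cact p w y \<in> p ` T" using p T by (auto simp: transversal_def)
qed

text \<open>The cocycle identity that makes \<open>vrep\<close> multiplicative. Over the transversal
  carried along by \<open>q\<close>, the intermediate orientation occurs twice and cancels.\<close>

lemma vsign_comp:
  assumes w: "w \<in> invols n" and p: "p \<in> perms n" and q: "q \<in> perms n"
  shows "vsign (p \<circ> q) w = vsign p (cact q w) * vsign q w"
proof -
  let ?T = "{x. x < w x}"
  have T: "transversal w ?T" by (rule transversal_less[OF w])
  have "vsign p (cact q w) = (\<Prod>x\<in>q ` ?T. ori (cact q w) x * ori (cact p (cact q w)) (p x))"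
    by (rule vsign_transversal[OF _ p transversal_cact[OF q T]]) (use w q in simp)
  also have "\<dots> = (\<Prod>x\<in>?T. ori (cact q w) (q x) * ori (cact p (cact q w)) (p (q x)))"
    using q by (subst prod.reindex) (auto simp: inj_on_def)
  finally have "vsign p (cact q w) * vsign q w = (\<Prod>x\<in>?T. ori (cact q w) (q x) *
      ori (cact p (cact q w)) (p (q x)) * (ori w x * ori (cact q w) (q x)))"
    by (simp add: vsign_transversal[OF w q T] prod.distrib)
  also have "\<dots> = (\<Prod>x\<in>?T. ori w x * ori (cact (p \<circ> q) w) ((p \<circ> q) x))"
    using p q by (intro prod.cong refl) (simp add: cact_comp ori_def)
  also have "\<dots> = vsign (p \<circ> q) w" using w p q T by (intro vsign_transversal[symmetric]) auto
  finally show ?thesis by simp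
qed

lemma vsign_sq [simp]: "vsign p w * vsign p w = 1"
  unfolding vsign_def prod.distrib[symmetric] by (intro prod.neutral) auto

lemma vsign_nonzero [simp]: "vsign p w \<noteq> 0"
  by (metis vsign_sq mult_zero_left zero_neq_one)

lemma vsign_id [simp]: "vsign id w = 1"
  unfolding vsign_def by (intro prod.neutral) auto

text \<open>On a stable transversal \<open>g\<close> only permutes the orientation factors, so the
  sign is a square.\<close>

lemma vsign_stable_transversal:
  assumes w: "w \<in> invols n" and g: "g \<in> perms n" and "cact g w = w"
    and T: "transversal w T" "g ` T \<subseteq> T"
  shows "vsign g w = 1"
proof -
  have fin: "finite T" using transversal_finite[OF invols_perms[OF w] T(1)] .
  have inj: "inj_on g T" using g by (auto simp: inj_on_def)
  have im: "g ` T = T" by (rule endo_inj_surj[OF fin T(2) inj])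
  have "vsign g w = (\<Prod>x\<in>T. ori w x) * (\<Prod>x\<in>T. ori w (g x))"
    using vsign_transversal[OF w g T(1)] assms(3) by (simp add: prod.distrib)
  also have "(\<Prod>x\<in>T. ori w (g x)) = (\<Prod>x\<in>T. ori w x)"
    using prod.reindex[OF inj, of "ori w"] by (simp add: im)
  finally show ?thesis by (simp add: prod.distrib[symmetric])
qed

subsection \<open>The representation on involutions\<close>

definition vrep :: "nat \<Rightarrow> (nat \<Rightarrow> nat) \<Rightarrow> (nat \<Rightarrow> nat) \<Rightarrow> (nat \<Rightarrow> nat) \<Rightarrow> complex" where
  "vrep n p u w = (if u \<in> invols n \<and> w \<in> invols n \<and> u = cact p w then vsign p w else 0)"

lemma srep_vrep: "srep n (invols n) (vrep n)"
  unfolding srep_def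
proof (intro conjI ballI)
  show "vrep n p \<in> mats (invols n) (invols n)" for p
    by (auto simp: vrep_def mats_def)
  show "vrep n id = idm (invols n)"
    by (intro ext) (auto simp: vrep_def idm_def)
  fix p q assume pq: "p \<in> perms n" "q \<in> perms n"
  show "vrep n (p \<circ> q) = mmult (invols n) (vrep n p) (vrep n q)"
  proof (intro ext)
    fix u w
    show "vrep n (p \<circ> q) u w = mmult (invols n) (vrep n p) (vrep n q) u w"
    proof (cases "w \<in> invols n")
      case w: True
      have "mmult (invols n) (vrep n p) (vrep n q) u w
          = (\<Sum>y\<in>invols n. if y = cact q w then vrep n p u y * vsign q w else 0)"
        unfolding mmult_def using w by (intro sum.cong refl) (simp add: vrep_def[of n q])
      also have "\<dots> = vrep n p u (cact q w) * vsign q w" using w pq by simp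
      also have "\<dots> = vrep n (p \<circ> q) u w"
        using w pq by (simp add: vrep_def cact_comp vsign_comp)
      finally show ?thesis by simp
    qed (simp add: vrep_def mmult_def)
  qed
qed simp

lemma sgen_perms: "i \<in> {1..<n} \<Longrightarrow> sgen i \<in> perms n"
  by (auto simp: sgen_def perms_def intro!: permutes_swap_id)

lemma inv_sgen: "inv (sgen i) = sgen i"
  by (simp add: sgen_def)

text \<open>An adjacent transposition reverses the order of \<open>i\<close> and
  \<open>Suc i\<close> only, so it produces a sign exactly when these form a 2-cycle of
  \<open>w\<close>. Commuting with \<open>sgen i\<close> and having a descent at \<open>i\<close>
  says the same: if both points are fixed there is no descent.\<close>

lemma vsign_sgen:
  assumes i: "i \<in> {1..<n}" and w: "w \<in> invols n"
  shows "vsign (sgen i) w = sign_sw i w"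
proof -
  have less: "sgen i x < sgen i y \<longleftrightarrow> (x, y) \<noteq> (i, Suc i)" if "x < y" for x y
    using that by (auto simp: sgen_def Transposition.transpose_def)
  have "w y = x" if "w x = y" for x y using invols_twice[OF w] that by blast
  note flip = this
  have desc: "(sgen i \<circ> w \<circ> sgen i = w \<and> in_des i w) \<longleftrightarrow> w i = Suc i"
  proof
    assume a: "sgen i \<circ> w \<circ> sgen i = w \<and> in_des i w"
    then have s: "sgen i (w (sgen i x)) = w x" for x by (metis comp_apply)
    from s[of i] have "sgen i (w (Suc i)) = w i" by (simp add: sgen_def)
    then have "w (Suc i) = i \<and> w i = Suc i \<or> w (Suc i) = Suc i \<and> w i = i \<or> w (Suc i) = w i"
      by (auto simp: sgen_def Transposition.transpose_def split: if_splits)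
    then show "w i = Suc i" using a by (auto simp: in_des_def)
  next
    assume a: "w i = Suc i"
    then have b: "w (Suc i) = i" by (rule flip)
    have "sgen i (w (sgen i x)) = w x" for x
    proof -
      consider "x = i" | "x = Suc i" | "x \<noteq> i" "x \<noteq> Suc i" by blast
      then show ?thesis
      proof cases
        case 3
        moreover have "w x \<noteq> i" "w x \<noteq> Suc i" using 3 a b flip by metis+
        ultimately show ?thesis by (simp add: sgen_def)
      qed (auto simp: sgen_def a b)
    qed
    then show "sgen i \<circ> w \<circ> sgen i = w \<and> in_des i w" using a b by (auto simp: in_des_def)
  qed
  have fin: "finite {x. x < w x}"
    using transversal_finite[OF invols_perms[OF w] transversal_less[OF w]] .
  have "vsign (sgen i) w = (\<Prod>x | x < w x. if x = i then if w i = Suc i then -1 else 1 else 1)"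
    unfolding vsign_def by (intro prod.cong refl) (auto simp: less)
  also have "\<dots> = (if w i = Suc i then -1 else 1)" using fin by simp
  finally show ?thesis by (simp add: sign_sw_def desc)
qed

lemma gen_action_vrep: "gen_action n (vrep n)"
  by (auto simp: gen_action_def vrep_def vsign_sgen cact_def inv_sgen o_assoc)

lemma perms_induct_sgen [consumes 1, case_names id sgen]:
  assumes p: "p \<in> perms n" and id: "P id"
    and step: "\<And>i q. i \<in> {1..<n} \<Longrightarrow> q \<in> perms n \<Longrightarrow> P q \<Longrightarrow> P (sgen i \<circ> q)"
  shows "P p"
proof -
  have t: "P (Transposition.transpose a b \<circ> q)" if "1 \<le> a" "a < b" "b \<le> n" "q \<in> perms n" "P q" for a b q
    using that(2,3,4,5)
  proof (induction b arbitrary: q)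
    case (Suc b)
    show ?case
    proof (cases "a = b")
      case True
      have "P (sgen a \<circ> q)" using True Suc.prems that(1) by (intro step) auto
      with True show ?thesis by (simp only: sgen_def)
    next
      case False
      with Suc.prems have ab: "a < b" "b \<in> {1..<n}" using that(1) by auto
      have *: "Transposition.transpose a b \<in> perms n"
        using ab that(1) by (auto simp: perms_def intro!: permutes_swap_id)
      \<comment> \<open>Conjugating the transposition of \<open>a\<close> and \<open>b\<close> by
        \<open>sgen b\<close> gives that of \<open>a\<close> and \<open>Suc b\<close>.\<close>
      have "P (sgen b \<circ> (Transposition.transpose a b \<circ> (sgen b \<circ> q)))"
        using ab Suc.prems sgen_perms[OF ab(2)] * by (intro step Suc.IH perms_comp) auto
      also have "sgen b \<circ> (Transposition.transpose a b \<circ> (sgen b \<circ> q)) = Transposition.transpose a (Suc b) \<circ> q"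
        using ab by (auto simp: fun_eq_iff sgen_def Transposition.transpose_def)
      finally show ?thesis .
    qed
  qed simp
  have "p permutes {1..n}" "finite {1..n}" using p by (simp_all add: perms_def)
  then show ?thesis
  proof (induction rule: permutes_induct)
    case (swap a b q)
    then have q: "q \<in> perms n" by (simp add: perms_def)
    consider "a < b" | "b < a" | "a = b" by linarith
    then show ?case
    proof cases
      case 1
      show ?thesis by (rule t) (use 1 swap q in auto)
    next
      case 2
      have "P (Transposition.transpose b a \<circ> q)" by (rule t) (use 2 swap q in auto)
      then show ?thesis by (simp only: transpose_commute)
    qed (use swap in auto)
  qed (rule id)
qed

lemma vrep_unique:
  assumes \<rho>: "is_rep n (invols n) \<rho>" and gen: "gen_action n \<rho>" and p: "p \<in> perms n"
    and uw: "u \<in> invols n" "w \<in> invols n"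
  shows "\<rho> p u w = vrep n p u w"
proof -
  have "\<forall>u\<in>invols n. \<forall>w\<in>invols n. \<rho> p u w = vrep n p u w" using p
  proof (induction rule: perms_induct_sgen)
    case id
    show ?case
    proof (intro ballI)
      fix u w assume "u \<in> invols n" "w \<in> invols n"
      with \<rho> show "\<rho> id u w = vrep n id u w"
        unfolding srepD(3)[OF srep_vrep] is_rep_def mid_def idm_def by meson
    qed
  next
    case (sgen i q)
    note s = sgen_perms[OF sgen(1)]
    show ?case
    proof (intro ballI)
      fix u w assume u: "u \<in> invols n" and w: "w \<in> invols n"
      have "\<rho> (sgen i \<circ> q) u w = mmult (invols n) (\<rho> (sgen i)) (\<rho> q) u w"
        using \<rho> s sgen(2) u w by (simp add: is_rep_def)
      also have "\<dots> = mmult (invols n) (vrep n (sgen i)) (vrep n q) u w"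
        unfolding mmult_def
        using gen gen_action_vrep[of n] sgen(1,3) u w by (intro sum.cong refl) (simp add: gen_action_def)
      also have "\<dots> = vrep n (sgen i \<circ> q) u w"
        by (simp add: srepD(4)[OF srep_vrep s sgen(2)])
      finally show "\<rho> (sgen i \<circ> q) u w = vrep n (sgen i \<circ> q) u w" .
    qed
  qed
  with uw show ?thesis by blast
qed

text \<open>The intertwining relation read at the entry \<open>(cact p u, w)\<close>, where one
  summand survives on each side. It says that \<open>K\<close> is invariant under simultaneous
  conjugation up to sign.\<close>

lemma intw_vrep_apply:
  assumes K: "intw n (invols n) (vrep n) (invols n) (vrep n) K" and p: "p \<in> perms n"
    and u: "u \<in> invols n" and w: "w \<in> invols n"
  shows "vsign p u * K u w = K (cact p u) (cact p w) * vsign p w"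
proof -
  have inj: "cact p u = cact p y \<longleftrightarrow> y = u" for y using cact_inv_cact[OF p] by metis
  have "mmult (invols n) (vrep n p) K (cact p u) w = (\<Sum>y\<in>invols n. if y = u then vsign p u * K u w else 0)"
    unfolding mmult_def using p u by (intro sum.cong refl) (auto simp: vrep_def inj)
  moreover have "mmult (invols n) K (vrep n p) (cact p u) w
      = (\<Sum>y\<in>invols n. if y = cact p w then K (cact p u) y * vsign p w else 0)"
    unfolding mmult_def using w by (intro sum.cong refl) (simp add: vrep_def)
  ultimately show ?thesis using intwD(2)[OF K p] p u w by simp
qed

subsection \<open>Pairs of involutions\<close>

lemma permsI:
  assumes "\<And>x. x \<notin> {1..n} \<Longrightarrow> p x = x" "\<And>x. q (p x) = x" "\<And>x. p (q x) = x"
  shows "p \<in> perms n"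
proof -
  have "\<exists>!x. p x = y" for y
    by (rule ex1I[of _ "q y"]) (use assms(2,3) in \<open>auto\<close>)
  with assms(1) show ?thesis by (auto simp: perms_def permutes_def)
qed

lemma funpow_app: "(f ^^ i) ((f ^^ j) x) = (f ^^ (i + j)) x"
  by (simp add: funpow_add)

lemma perms_funpow [simp]: "p \<in> perms n \<Longrightarrow> p ^^ j \<in> perms n"
  by (simp add: perms_def permutes_funpow)

lemma perms_finite_order:
  assumes "p \<in> perms n" obtains N where "N > 0" "p ^^ N = id"
proof -
  have "permutation p"
    using assms permutation_permutes[of p] finite_atLeastAtMost[of 1 n] by (auto simp: perms_def)
  then obtain N where "p ^^ N = id" "N > 0" by (rule permutation_is_nilpotent)
  then show ?thesis by (intro that)
qed

lemma funpow_mult_fixed: "(f ^^ a) x = x \<Longrightarrow> (f ^^ (a * b)) x = x"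
  by (induction b) (simp_all add: funpow_add)

text \<open>Counts edges reversed along a path: \<open>f\<close> gives the orientations before the
  reflection, \<open>F\<close> those after it, and the reflection permutes the edges by
  \<open>r\<close>.\<close>

lemma prod_negated_reindex:
  fixes f :: "nat \<Rightarrow> complex"
  assumes "\<And>i. i \<in> A \<Longrightarrow> r i \<in> A" "\<And>i. i \<in> A \<Longrightarrow> r (r i) = i"
    and "\<And>i. i \<in> A \<Longrightarrow> f i * f i = 1" "\<And>i. i \<in> A \<Longrightarrow> F i = - f (r i)"
  shows "(\<Prod>i\<in>A. f i * F i) = (-1) ^ card A"
proof -
  have "(\<Prod>i\<in>A. F i) = (\<Prod>i\<in>A. - f i)"
    by (rule prod.reindex_bij_witness[of _ r r]) (use assms in auto)
  then have "(\<Prod>i\<in>A. f i * F i) = (\<Prod>i\<in>A. f i * (- f i))" by (simp only: prod.distrib)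
  also have "\<dots> = (\<Prod>i\<in>A. -1)" using assms(3) by (intro prod.cong refl) simp
  finally show ?thesis by simp
qed

lemma perms_funpow_back:
  assumes "p \<in> perms n" obtains j where "(p ^^ j) ((p ^^ i) x) = x"
proof -
  obtain N where N: "N > 0" "p ^^ N = id" using perms_finite_order[OF assms] .
  have "(p ^^ (N * i - i)) ((p ^^ i) x) = (p ^^ (N * i)) x"
    using N(1) by (cases N) (simp_all add: funpow_app add.commute)
  also have "\<dots> = x" by (rule funpow_mult_fixed) (simp add: N)
  finally show ?thesis by (rule that)
qed

text \<open>A label for each cycle. It serves to two-colour the cycles of a pair of involutions and
  later as the base point of a cycle.\<close>

definition orbit_min :: "(nat \<Rightarrow> nat) \<Rightarrow> nat \<Rightarrow> nat" where
  "orbit_min p x = (LEAST y. \<exists>i. y = (p ^^ i) x)"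

lemma orbit_min_in: "\<exists>i. orbit_min p x = (p ^^ i) x"
  unfolding orbit_min_def by (rule LeastI_ex) blast

lemma orbit_min_apply:
  assumes p: "p \<in> perms n" shows "orbit_min p (p x) = orbit_min p x"
proof -
  have "(\<exists>i. y = (p ^^ i) (p x)) \<longleftrightarrow> (\<exists>i. y = (p ^^ i) x)" for y
  proof
    assume "\<exists>i. y = (p ^^ i) (p x)"
    then obtain i where "y = (p ^^ Suc i) x" by (auto simp: funpow_swap1)
    then show "\<exists>i. y = (p ^^ i) x" by blast
  next
    assume "\<exists>i. y = (p ^^ i) x"
    then obtain i where "y = (p ^^ i) x" by blast
    moreover obtain j where "(p ^^ j) ((p ^^ 1) x) = x" using perms_funpow_back[OF p] .
    ultimately have "y = (p ^^ i) ((p ^^ j) (p x))" by simp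
    then show "\<exists>i. y = (p ^^ i) (p x)" unfolding funpow_app by blast
  qed
  then show ?thesis by (simp add: orbit_min_def)
qed

locale involution_pair =
  fixes n u w
  assumes u: "u \<in> invols n" and w: "w \<in> invols n"
begin

text \<open>The rotation of the dihedral group generated by the two reflections \<open>u\<close> and
  \<open>w\<close>: two steps along a component of the graph.\<close>

definition c :: "nat \<Rightarrow> nat" where "c x = u (w x)"

lemma uu [simp]: "u (u x) = x" and ww [simp]: "w (w x) = x"
  using invols_twice u w by auto

lemma up [simp]: "u \<in> perms n" and wp [simp]: "w \<in> perms n"
  using invols_perms u w by auto

lemma c_perms [simp]: "c \<in> perms n"
  using perms_comp[OF up wp] by (simp add: c_def[abs_def] comp_def)

lemma u_c [simp]: "u (c x) = w x"
  by (simp add: c_def)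

lemma c_pow_inject [simp]: "(c ^^ j) x = (c ^^ j) y \<longleftrightarrow> x = y"
  using perms_inject[OF perms_funpow[OF c_perms]] .

text \<open>The dihedral relation, conjugation by \<open>u\<close> inverts \<open>c\<close>, stated
  with natural exponents only.\<close>

lemma c_u_c: "(c ^^ j) (u ((c ^^ j) x)) = u x"
proof (induction j arbitrary: x)
  case (Suc j)
  have "(c ^^ Suc j) (u ((c ^^ Suc j) x)) = c ((c ^^ j) (u ((c ^^ j) (c x))))"
    by (simp add: funpow_swap1)
  also have "\<dots> = c (u (c x))" by (simp only: Suc)
  also have "\<dots> = u x" by (simp add: c_def)
  finally show ?case .
qed simp

lemma outside_fixed: "x \<notin> {1..n} \<Longrightarrow> (c ^^ j) x = x" "x \<notin> {1..n} \<Longrightarrow> u x = x" "x \<notin> {1..n} \<Longrightarrow> w x = x"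
  using perms_moved[OF perms_funpow[OF c_perms]] perms_moved[OF up] perms_moved[OF wp] by blast+

text \<open>An orbit of \<open>\<langle>u, w\<rangle>\<close> with an even number \<open>2 h\<close> of points and an end point fixed by \<open>u\<close> is a path;
  \<open>c ^ h\<close> reflects it and reverses exactly one edge, the middle one.\<close>

lemma even_path:
  assumes y: "u y = y" and no_odd: "\<And>M. odd M \<Longrightarrow> (c ^^ M) y \<noteq> y"
  shows "\<exists>g\<in>perms n. cact g u = u \<and> cact g w = w \<and> vsign g u * vsign g w = -1"
proof -
  define m where "m = (LEAST m. 0 < m \<and> (c ^^ m) y = y)"
  obtain N where "N > 0" "c ^^ N = id" using perms_finite_order[OF c_perms] .
  then have "0 < N \<and> (c ^^ N) y = y" by simp
  then have m: "0 < m" "(c ^^ m) y = y"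
    unfolding m_def by (metis (mono_tags, lifting) LeastI)+
  have least: "m \<le> i" if "0 < i" "(c ^^ i) y = y" for i
    unfolding m_def using that by (intro Least_le) simp
  have "even m" using no_odd m(2) by blast
  then obtain h where h: "m = 2 * h" by blast
  with m(1) have "h > 0" by simp
  define Y where "Y i = (c ^^ i) y" for i
  have Y0: "Y 0 = y" by (simp add: Y_def)
  have Y_add: "(c ^^ i) (Y j) = Y (i + j)" for i j by (simp add: Y_def funpow_add)
  have Y_per: "Y i = y" if "m dvd i" for i
    using funpow_mult_fixed[OF m(2)] that by (auto simp: Y_def)
  have Y_cong: "Y (i + m) = Y i" for i
    using Y_add[of i m] Y_per[of m] by (simp add: Y_def)
  have Y_inj': "i = j" if "i \<le> j" "j < m" "Y i = Y j" for i j
  proof (rule ccontr)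
    assume "i \<noteq> j"
    have "(c ^^ i) (Y (j - i)) = (c ^^ i) y" using that by (simp add: Y_add) (simp add: Y_def)
    then have "(c ^^ (j - i)) y = y" by (simp add: Y_def)
    from least[OF _ this] that \<open>i \<noteq> j\<close> show False by simp
  qed
  have Y_inj: "Y i = Y j \<longleftrightarrow> i = j" if "i < m" "j < m" for i j
    using Y_inj'[of i j] Y_inj'[of j i] that by (metis nle_le)
  \<comment> \<open>With indices read modulo \<open>m\<close>, \<open>u\<close> maps index
    \<open>i\<close> to \<open>-i\<close> and \<open>w\<close> maps it to \<open>-i - 1\<close>. As
    \<open>y\<close> is an end point, its \<open>c\<close>-orbit is the whole path; the other end is
    \<open>Y h\<close>.\<close>
  have uY: "u (Y i) = Y k" if "m dvd i + k" for i k
  proof -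
    have "(c ^^ i) (u (Y i)) = y" using c_u_c[of i y] y by (simp add: Y_def)
    also have "y = (c ^^ i) (Y k)" using Y_per[OF that] by (simp add: Y_add)
    finally show ?thesis by simp
  qed
  have wY: "w (Y i) = Y k" if "m dvd i + k + 1" for i k
  proof -
    have "w (Y i) = u (Y (Suc i))" by (simp add: Y_def)
    with uY[of "Suc i" k] that show ?thesis by simp
  qed
  define S where "S = Y ` {..<m}"
  have S: "Y i \<in> S" for i
  proof -
    have "Y i = Y (i mod m)" unfolding Y_def by (rule funpow_mod_eq[OF m(2), symmetric])
    then show ?thesis using m(1) by (auto simp: S_def)
  qed
  have Su: "u x \<in> S" if x: "x \<in> S" for x
  proof -
    obtain i where i: "x = Y i" "i < m" using x by (auto simp: S_def)
    then show ?thesis using uY[of i "m - i"] S by simp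
  qed
  have Sw: "w x \<in> S" if x: "x \<in> S" for x
  proof -
    obtain i where i: "x = Y i" "i < m" using x by (auto simp: S_def)
    then show ?thesis using wY[of i "m - i - 1"] S by simp
  qed
  have Su': "u x \<in> S \<longleftrightarrow> x \<in> S" and Sw': "w x \<in> S \<longleftrightarrow> x \<in> S" for x
    using Su[of x] Su[of "u x"] Sw[of x] Sw[of "w x"] unfolding uu ww by blast+
  \<comment> \<open>A shift of the indices by half the period is an involution commuting with both
    reflections. It exchanges the end points \<open>Y 0\<close> and \<open>Y h\<close>.\<close>
  define g where "g x = (if x \<in> S then (c ^^ h) x else x)" for x
  have gY: "g (Y i) = Y (i + h)" for i using S by (simp add: g_def Y_add add.commute)
  have gg: "g (g x) = x" for x
  proof (cases "x \<in> S")
    case True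
    then obtain i where "x = Y i" by (auto simp: S_def)
    then show ?thesis using Y_cong[of i] by (simp add: gY h mult_2 add.assoc)
  qed (simp add: g_def)
  have g: "g \<in> perms n"
    by (rule permsI[of n g g]) (simp_all only: gg, simp add: g_def outside_fixed)
  have gu: "cact g u = u"
  proof (rule cact_eqI[OF g])
    fix x show "g (u x) = u (g x)"
    proof (cases "x \<in> S")
      case True
      then obtain i where i: "x = Y i" "i < m" by (auto simp: S_def)
      have "u (Y i) = Y (m - i)" "u (Y (i + h)) = Y (m - i + h)"
        using i h by (auto intro!: uY)
      then show ?thesis by (simp add: i gY)
    qed (simp add: g_def Su')
  qed
  have gw: "cact g w = w"
  proof (rule cact_eqI[OF g])
    fix x show "g (w x) = w (g x)"
    proof (cases "x \<in> S")
      case True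
      then obtain i where i: "x = Y i" "i < m" by (auto simp: S_def)
      have "w (Y i) = Y (m - i - 1)" "w (Y (i + h)) = Y (m - i - 1 + h)"
        using i h by (auto intro!: wY)
      then show ?thesis by (simp add: i gY)
    qed (simp add: g_def Sw')
  qed
  \<comment> \<open>The indices below \<open>h\<close> meet each edge of the path once. Index 0 is
    left out for \<open>u\<close>, which fixes \<open>Y 0\<close>, so the path has
    \<open>h - 1\<close> edges of \<open>u\<close> and \<open>h\<close> of \<open>w\<close>.\<close>
  define Tu where "Tu = {x. x \<notin> S \<and> x < u x} \<union> Y ` {1..<h}"
  define Tw where "Tw = {x. x \<notin> S \<and> x < w x} \<union> Y ` {..<h}"
  have Yin: "Y i \<in> Y ` {a..<b} \<longleftrightarrow> i \<in> {a..<b}" if "i < m" "b \<le> m" for i a b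
    using that by (auto simp: Y_inj)
  have Tu: "transversal u Tu" unfolding transversal_def
  proof (intro conjI ballI allI impI)
    fix x assume "x \<in> Tu"
    then consider "x \<notin> S" "x < u x" | i where "x = Y i" "i \<in> {1..<h}" by (auto simp: Tu_def)
    then show "u x \<notin> Tu"
    proof cases
      case 1
      then have "u x \<notin> Y ` {1..<h}" using S Su'[of x] by force
      with 1 show ?thesis by (auto simp: Tu_def)
    next
      case 2
      then have "u x = Y (m - i)" using uY[of i "m - i"] h by simp
      then show ?thesis using 2 S Yin[of "m - i" h 1] h by (auto simp: Tu_def)
    qed
  next
    fix x assume ux: "u x \<noteq> x"
    show "x \<in> Tu \<or> u x \<in> Tu"
    proof (cases "x \<in> S")
      case False
      with ux show ?thesis by (auto simp: Tu_def Su')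
    next
      case True
      then obtain i where i: "x = Y i" "i < m" by (auto simp: S_def)
      have ui: "u x = Y (m - i)" using i uY[of i "m - i"] by simp
      have "i \<noteq> 0" using ux i y Y0 by (metis)
      moreover have "i \<noteq> h" using ux i ui h by auto
      ultimately have "i \<in> {1..<h} \<or> m - i \<in> {1..<h}" using i h by auto
      then show ?thesis using i ui by (auto simp: Tu_def)
    qed
  qed
  have Tw: "transversal w Tw" unfolding transversal_def
  proof (intro conjI ballI allI impI)
    fix x assume "x \<in> Tw"
    then consider "x \<notin> S" "x < w x" | i where "x = Y i" "i < h" by (auto simp: Tw_def)
    then show "w x \<notin> Tw"
    proof cases
      case 1
      then have "w x \<notin> Y ` {..<h}" using S Sw'[of x] by force
      with 1 show ?thesis by (auto simp: Tw_def)
    next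
      case 2
      then have "w x = Y (m - i - 1)" using wY[of i "m - i - 1"] h by simp
      then show ?thesis using 2 S Yin[of "m - i - 1" h 0] h by (auto simp: Tw_def atLeast0LessThan)
    qed
  next
    fix x assume wx: "w x \<noteq> x"
    show "x \<in> Tw \<or> w x \<in> Tw"
    proof (cases "x \<in> S")
      case False
      with wx show ?thesis by (auto simp: Tw_def Sw')
    next
      case True
      then obtain i where i: "x = Y i" "i < m" by (auto simp: S_def)
      have wi: "w x = Y (m - i - 1)" using i wY[of i "m - i - 1"] by simp
      have "i < h \<or> m - i - 1 < h" using i h by auto
      then show ?thesis using i wi by (auto simp: Tw_def)
    qed
  qed
  have split: "(\<Prod>x\<in>{x. x \<notin> S \<and> x < v x} \<union> Y ` A. ori v x * ori v (g x)) = (\<Prod>i\<in>A. ori v (Y i) * ori v (Y (i + h)))"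
    if v: "v \<in> invols n" and A: "A \<subseteq> {..<h}" for v A
  proof -
    have fin: "finite {x. x \<notin> S \<and> x < v x}"
      by (rule finite_subset[OF _ transversal_finite[OF invols_perms[OF v] transversal_less[OF v]]]) auto
    have disj: "{x. x \<notin> S \<and> x < v x} \<inter> Y ` A = {}" using S by auto
    have finA: "finite A" using A finite_subset by blast
    have inj: "inj_on Y A"
    proof (rule inj_onI)
      fix i j assume "i \<in> A" "j \<in> A" "Y i = Y j"
      moreover from this have "i < m" "j < m" using A h by auto
      ultimately show "i = j" by (simp add: Y_inj)
    qed
    have "(\<Prod>x\<in>{x. x \<notin> S \<and> x < v x}. ori v x * ori v (g x)) = 1"
      by (intro prod.neutral) (auto simp: g_def)
    then show ?thesis using finA
      by (simp add: prod.union_disjoint[OF fin _ disj] prod.reindex[OF inj] gY)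
  qed
  have "vsign g u = (\<Prod>i\<in>{1..<h}. ori u (Y i) * ori u (Y (i + h)))"
    unfolding vsign_transversal[OF u g Tu] gu Tu_def by (rule split[OF u]) auto
  \<comment> \<open>\<open>Y i\<close> is moved to the opposite end of the edge at
    \<open>Y (h - i)\<close>, which explains both the reindexing and the minus sign.\<close>
  also have "\<dots> = (-1) ^ card {1..<h}"
  proof (rule prod_negated_reindex[of _ "\<lambda>i. h - i"])
    fix i assume i: "i \<in> {1..<h}"
    have "h - i + (i + h) = m" using i h by auto
    then have "Y (i + h) = u (Y (h - i))" by (intro uY[symmetric]) simp
    moreover have "i + h < m" "h - i < m" "i + h \<noteq> h - i" using i h by auto
    then have "Y (i + h) \<noteq> Y (h - i)" by (simp only: Y_inj not_False_eq_True)
    ultimately show "ori u (Y (i + h)) = - ori u (Y (h - i))"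
      using ori_flip[OF u, of "Y (h - i)"] by simp
  qed auto
  finally have vu: "vsign g u = (-1) ^ (h - 1)" by simp
  have "vsign g w = (\<Prod>i\<in>{..<h}. ori w (Y i) * ori w (Y (i + h)))"
    unfolding vsign_transversal[OF w g Tw] gw Tw_def by (rule split[OF w]) auto
  also have "\<dots> = (-1) ^ card {..<h}"
  proof (rule prod_negated_reindex[of _ "\<lambda>i. h - 1 - i"])
    fix i assume i: "i \<in> {..<h}"
    have "h - 1 - i + (i + h) + 1 = m" using i h by auto
    then have "Y (i + h) = w (Y (h - 1 - i))" by (intro wY[symmetric]) simp
    moreover have "i + h < m" "h - 1 - i < m" "i + h \<noteq> h - 1 - i" using i h by auto
    then have "Y (i + h) \<noteq> Y (h - 1 - i)" by (simp only: Y_inj not_False_eq_True)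
    ultimately show "ori w (Y (i + h)) = - ori w (Y (h - 1 - i))"
      using ori_flip[OF w, of "Y (h - 1 - i)"] by simp
  qed auto
  finally have "vsign g w = (-1) ^ h" by simp
  moreover have "(-1) ^ (h - 1) * (-1) ^ h = (-1 :: complex)"
    using \<open>h > 0\<close> by (cases h) (simp_all add: power_add[symmetric])
  ultimately show ?thesis using g gu gw vu by auto
qed

text \<open>Characterises the path components without graph theory: on a path a single
  \<open>c\<close>-orbit contains both \<open>x\<close> and \<open>u x\<close>, whereas on a cycle
  \<open>u\<close> exchanges two \<open>c\<close>-orbits.\<close>

definition path_points :: "nat set" where
  "path_points = {x. \<exists>j. u x = (c ^^ j) x}"

text \<open>Going half of the \<open>j\<close> steps from \<open>x\<close> to \<open>u x\<close>
  reaches a point fixed by a reflection: by \<open>u\<close> if \<open>j\<close> is even, by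
  \<open>w\<close> if \<open>j\<close> is odd.\<close>

lemma path_points_end:
  assumes "x \<in> path_points"
  obtains i where "u ((c ^^ i) x) = (c ^^ i) x \<or> w ((c ^^ i) x) = (c ^^ i) x"
proof -
  obtain j where j: "u x = (c ^^ j) x" using assms by (auto simp: path_points_def)
  show ?thesis
  proof (cases "even j")
    case True
    then obtain i where i: "j = i + i" by (metis evenE mult_2)
    have "(c ^^ i) (u ((c ^^ i) x)) = (c ^^ i) ((c ^^ i) x)"
      by (simp only: c_u_c j i funpow_add comp_apply)
    then show ?thesis using that by auto
  next
    case False
    then obtain i where i: "j = Suc i + i" by (metis oddE mult_2 Suc_eq_plus1 add_Suc)
    have "(c ^^ Suc i) (u ((c ^^ Suc i) x)) = (c ^^ Suc i) ((c ^^ i) x)"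
      by (simp only: c_u_c j i funpow_add comp_apply)
    then have "u ((c ^^ Suc i) x) = (c ^^ i) x" by (simp only: c_pow_inject)
    then show ?thesis using that[of i] by simp
  qed
qed

lemma path_points_u: "u x \<in> path_points \<longleftrightarrow> x \<in> path_points"
proof -
  have *: "u x \<in> path_points" if x: "x \<in> path_points" for x
  proof -
    obtain j where j: "u x = (c ^^ j) x" using x by (auto simp: path_points_def)
    obtain k where "(c ^^ k) (u x) = x" unfolding j using perms_funpow_back[OF c_perms] .
    then have "u (u x) = (c ^^ k) (u x)" by simp
    then show ?thesis unfolding path_points_def by blast
  qed
  from *[of x] *[of "u x"] show ?thesis by auto
qed

lemma path_points_c: "x \<in> path_points \<Longrightarrow> c x \<in> path_points"
proof -
  assume "x \<in> path_points"
  then obtain j where j: "u x = (c ^^ j) x" by (auto simp: path_points_def)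
  obtain k where k: "(c ^^ k) ((c ^^ 2) (u (c x))) = u (c x)" using perms_funpow_back[OF c_perms] .
  have "(c ^^ 2) (u (c x)) = c (u x)" by (simp add: c_def numeral_2_eq_2)
  also have "\<dots> = (c ^^ j) (c x)" by (simp add: j funpow_swap1)
  finally have "u (c x) = (c ^^ (k + j)) (c x)" using k by (simp add: funpow_app)
  then show ?thesis unfolding path_points_def by blast
qed

lemma path_points_w: "w x \<in> path_points \<longleftrightarrow> x \<in> path_points"
proof -
  have *: "w x \<in> path_points" if "x \<in> path_points" for x
    using path_points_c[OF that] path_points_u[of "c x"] by simp
  from *[of x] *[of "w x"] show ?thesis by auto
qed

lemma orbit_min_w: "orbit_min c (w x) = orbit_min c (u x)"
  using orbit_min_apply[OF c_perms, of "w x"] by (simp add: c_def)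

lemma orbit_min_uw: "orbit_min c (u (w x)) = orbit_min c x"
  using orbit_min_apply[OF c_perms, of x] by (simp add: c_def)

lemma orbit_min_neq:
  assumes "x \<notin> path_points" shows "orbit_min c (u x) \<noteq> orbit_min c x"
proof
  assume "orbit_min c (u x) = orbit_min c x"
  then obtain i j where ij: "(c ^^ j) (u x) = (c ^^ i) x" using orbit_min_in by metis
  obtain k where "(c ^^ k) ((c ^^ j) (u x)) = u x" using perms_funpow_back[OF c_perms] .
  then have "u x = (c ^^ (k + i)) x" by (simp add: ij funpow_app)
  then show False using assms by (auto simp: path_points_def)
qed

text \<open>On paths with an odd number of points the swapping permutation is the reflection \<open>c ^ k u\<close>;
  on cycles it is a rotation by one step, which exists because the \<open>c\<close>-orbits two-colour the cycle.\<close>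

lemma exists_swap:
  assumes odd: "\<And>x. x \<in> path_points \<Longrightarrow> \<exists>M. odd M \<and> (c ^^ M) x = x"
  shows "\<exists>p\<in>perms n. cact p u = w \<and> cact p w = u \<and> vsign (p \<circ> p) u = 1"
proof -
  obtain M where M: "\<And>x. x \<in> path_points \<Longrightarrow> odd (M x) \<and> (c ^^ M x) x = x" using odd by metis
  \<comment> \<open>A single odd exponent that serves all paths at once. With
    \<open>L = 2 k + 1\<close>, \<open>c ^ (2 k)\<close> is the inverse of \<open>c\<close> on path
    points, which is what makes \<open>c ^ k u\<close> conjugate \<open>u\<close> to
    \<open>w\<close>.\<close>
  define L where "L = (\<Prod>x\<in>path_points \<inter> {1..n}. M x)"
  have "odd L" using M by (auto simp: L_def even_prod_iff)
  then obtain k where k: "L = Suc (k + k)" by (metis oddE mult_2 Suc_eq_plus1)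
  have cL: "(c ^^ Suc (k + k)) x = x" if x: "x \<in> path_points" for x
  proof (cases "x \<in> {1..n}")
    case True
    then have "M x dvd L" unfolding L_def using x by (intro dvd_prodI) auto
    then show ?thesis unfolding k[symmetric] using funpow_mult_fixed[of "M x" c x] M[OF x] by (auto elim!: dvdE)
  qed (rule outside_fixed)
  let ?P = path_points
  \<comment> \<open>On each cycle, the one of its two \<open>c\<close>-orbits with the smaller
    label. By \<open>Bu\<close> and \<open>Bw\<close> both involutions exchange it with the other
    orbit.\<close>
  define B where "B = {x. x \<notin> ?P \<and> orbit_min c x < orbit_min c (u x)}"
  have Bu: "u x \<in> B \<longleftrightarrow> x \<notin> B" if "x \<notin> ?P" for x
    using that orbit_min_neq[OF that] by (auto simp: B_def path_points_u)
  have Bw: "w x \<in> B \<longleftrightarrow> x \<notin> B" if "x \<notin> ?P" for x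
    using that orbit_min_neq[OF that] by (auto simp: B_def path_points_w orbit_min_w orbit_min_uw)
  define r where "r x = (c ^^ k) (u x)" for x
  have Pc: "(c ^^ j) x \<in> ?P" if "x \<in> ?P" for x j using that by (induction j) (auto intro: path_points_c)
  have rP: "r x \<in> ?P" if "x \<in> ?P" for x using that by (simp add: r_def Pc path_points_u)
  have rr: "r (r x) = x" for x using c_u_c[of k "u x"] by (simp add: r_def)
  \<comment> \<open>Off the paths, using \<open>u\<close> on \<open>B\<close> and \<open>w\<close>
    elsewhere moves every point one edge in the same direction around its cycle; \<open>q\<close> is
    the inverse.\<close>
  define p where "p x = (if x \<in> ?P then r x else if x \<in> B then u x else w x)" for x
  define q where "q x = (if x \<in> ?P then r x else if x \<in> B then w x else u x)" for x
  have p: "p \<in> perms n"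
  proof (rule permsI[of n p q])
    show "q (p x) = x" for x
      by (cases "x \<in> ?P"; cases "x \<in> B") (simp_all add: p_def q_def rP rr path_points_u path_points_w Bu Bw)
    show "p (q x) = x" for x
      by (cases "x \<in> ?P"; cases "x \<in> B") (simp_all add: p_def q_def rP rr path_points_u path_points_w Bu Bw)
    show "p x = x" if "x \<notin> {1..n}" for x
      using outside_fixed[OF that] by (simp add: p_def r_def)
  qed
  have pu: "p (u x) = w (p x)" for x
  proof (cases "x \<in> ?P")
    case True
    have "(c ^^ Suc k) (u ((c ^^ Suc k) (u x))) = x" using c_u_c[of "Suc k" "u x"] by simp
    also have "x = (c ^^ Suc k) ((c ^^ k) x)"
      using cL[OF True] by (simp only: funpow_app add_Suc)
    finally have "u ((c ^^ Suc k) (u x)) = (c ^^ k) x" by (simp only: c_pow_inject)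
    then show ?thesis using True by (simp add: p_def path_points_u r_def)
  next
    case False
    then show ?thesis by (simp add: p_def path_points_u Bu)
  qed
  have pw: "p (w x) = u (p x)" for x
  proof (cases "x \<in> ?P")
    case True
    have "(c ^^ k) (u ((c ^^ k) (u x))) = x" using c_u_c[of k "u x"] by simp
    also have "x = (c ^^ k) ((c ^^ Suc k) x)"
      using cL[OF True] by (simp only: funpow_app add_Suc_right)
    finally have "u ((c ^^ k) (u x)) = (c ^^ Suc k) x" by (simp only: c_pow_inject)
    also have "\<dots> = (c ^^ k) (c x)" by (simp add: funpow_swap1)
    finally show ?thesis using True by (simp add: p_def path_points_w r_def c_def)
  next
    case False
    then show ?thesis by (simp add: p_def path_points_w Bw)
  qed
  have "cact (p \<circ> p) u = u"
    by (rule cact_eqI[of _ n]) (simp_all add: p pu pw)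
  \<comment> \<open>The square of \<open>p\<close> is the identity on paths and rotates cycles by
    two steps, preserving \<open>B\<close>. So any choice on the paths together with
    \<open>B\<close> is a stable transversal.\<close>
  moreover have "transversal u ({x. x \<in> ?P \<and> x < u x} \<union> B)" unfolding transversal_def
  proof (intro conjI ballI allI impI)
    fix x assume "x \<in> {x. x \<in> ?P \<and> x < u x} \<union> B"
    then consider "x \<in> ?P" "x < u x" | "x \<in> B" "x \<notin> ?P" by (auto simp: B_def)
    then show "u x \<notin> {x. x \<in> ?P \<and> x < u x} \<union> B"
    proof cases
      case 1
      then show ?thesis by (auto simp: B_def path_points_u)
    next
      case 2
      then show ?thesis by (simp add: Bu path_points_u)
    qed
  next
    fix x assume "u x \<noteq> x"
    then show "x \<in> {x. x \<in> ?P \<and> x < u x} \<union> B \<or> u x \<in> {x. x \<in> ?P \<and> x < u x} \<union> B"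
      by (cases "x \<in> ?P") (auto simp: path_points_u Bu)
  qed
  moreover have "(p \<circ> p) ` ({x. x \<in> ?P \<and> x < u x} \<union> B) \<subseteq> {x. x \<in> ?P \<and> x < u x} \<union> B"
  proof -
    have "p (p x) = x" if "x \<in> ?P" for x using that by (simp add: p_def rP rr)
    moreover have "p (p x) \<in> B" if "x \<in> B" for x
    proof -
      have "x \<notin> ?P" using that by (simp add: B_def)
      with that show ?thesis by (simp add: p_def path_points_u path_points_w Bu Bw)
    qed
    ultimately show ?thesis by auto
  qed
  ultimately have "vsign (p \<circ> p) u = 1"
    using p by (intro vsign_stable_transversal[OF u]) auto
  moreover have "cact p u = w" "cact p w = u" using p pu pw by (auto intro!: cact_eqI)
  ultimately show ?thesis using p by blast
qed

end

section \<open>Symmetry of the endomorphisms\<close>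

lemma commuting_sign_imp_zero:
  assumes K: "intw n (invols n) (vrep n) (invols n) (vrep n) K"
    and u: "u \<in> invols n" and w: "w \<in> invols n"
    and g: "\<exists>g\<in>perms n. cact g u = u \<and> cact g w = w \<and> vsign g u * vsign g w = -1"
  shows "K u w = 0 \<and> K w u = 0"
proof -
  obtain g where g: "g \<in> perms n" "cact g u = u" "cact g w = w" "vsign g u * vsign g w = -1" using g by blast
  have sgn: "vsign g w = - vsign g u"
    using g(4) vsign_sq[of g u] by (metis mult.assoc mult.left_neutral mult_minus1_right mult.right_neutral)
  have "vsign g u * K u w = K u w * vsign g w" "vsign g w * K w u = K w u * vsign g u"
    using intw_vrep_apply[OF K g(1) u w] intw_vrep_apply[OF K g(1) w u] g by auto
  then show ?thesis by (auto simp: sgn)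
qed

text \<open>Either every path has an odd number of points and a swap relates the two entries, or an
  even path makes both vanish. An odd power of \<open>c\<close> fixing the point is the test for an
  odd path.\<close>

lemma intw_vrep_symmetric:
  assumes K: "intw n (invols n) (vrep n) (invols n) (vrep n) K"
    and u: "u \<in> invols n" and w: "w \<in> invols n"
  shows "K u w = K w u"
proof -
  interpret uw: involution_pair n u w by unfold_locales (fact u w)+
  interpret wu: involution_pair n w u by unfold_locales (fact u w)+
  show ?thesis
  proof (cases "\<forall>x\<in>uw.path_points. \<exists>M. odd M \<and> (uw.c ^^ M) x = x")
    case True
    then obtain p where p: "p \<in> perms n" "cact p u = w" "cact p w = u" "vsign (p \<circ> p) u = 1"
      using uw.exists_swap by blast
    \<comment> \<open>The cocycle identity factors the sign of the square. Both signs square to 1,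
      so they agree and cancel from the intertwining relation.\<close>
    have "vsign p w * vsign p u = 1" using vsign_comp[OF u p(1) p(1)] p by simp
    then have "vsign p w = vsign p u"
      using vsign_sq[of p u] by (metis mult.assoc mult.left_neutral mult.right_neutral)
    moreover have "vsign p u * K u w = K w u * vsign p w"
      using intw_vrep_apply[OF K p(1) u w] p by simp
    ultimately show ?thesis by simp
  next
    case False
    then obtain x where x: "x \<in> uw.path_points" "\<And>M. odd M \<Longrightarrow> (uw.c ^^ M) x \<noteq> x" by blast
    obtain i where i: "u ((uw.c ^^ i) x) = (uw.c ^^ i) x \<or> w ((uw.c ^^ i) x) = (uw.c ^^ i) x"
      using uw.path_points_end[OF x(1)] .
    define y where "y = (uw.c ^^ i) x"
    have y: "(uw.c ^^ M) y \<noteq> y" if "odd M" for M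
    proof -
      have "(uw.c ^^ M) y = (uw.c ^^ i) ((uw.c ^^ M) x)"
        by (simp only: y_def funpow_app add.commute)
      then show ?thesis using x(2)[OF that] by (simp add: y_def)
    qed
    \<comment> \<open>Exchanging the two involutions inverts \<open>c\<close>, so the parity
      condition carries over to the case where the end point is fixed by \<open>w\<close>.\<close>
    have "(uw.c ^^ M) ((wu.c ^^ M) z) = z" for M z
    proof (induction M arbitrary: z)
      case (Suc M)
      have "uw.c (wu.c z) = z" for z by (simp add: uw.c_def wu.c_def)
      then show ?case using Suc by (simp add: funpow_swap1)
    qed simp
    then have y': "(wu.c ^^ M) y \<noteq> y" if "odd M" for M using y[OF that] by metis
    from i have "u y = y \<or> w y = y" by (simp add: y_def)
    then show ?thesis
    proof
      assume "u y = y"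
      from commuting_sign_imp_zero[OF K u w uw.even_path[OF this y]] show ?thesis by simp
    next
      assume "w y = y"
      from commuting_sign_imp_zero[OF K w u wu.even_path[OF this y']] show ?thesis by simp
    qed
  qed
qed

text \<open>The product of two endomorphisms is again one and hence symmetric, while transposing a
  product of symmetric matrices reverses its factors.\<close>

lemma intw_vrep_commute:
  assumes K: "intw n (invols n) (vrep n) (invols n) (vrep n) K"
    and L: "intw n (invols n) (vrep n) (invols n) (vrep n) L"
  shows "mmult (invols n) K L = mmult (invols n) L K"
proof (rule mats_eqI[of _ "invols n" "invols n"])
  let ?I = "invols n"
  have KL: "intw n ?I (vrep n) ?I (vrep n) (mmult ?I K L)"
    by (rule intw_comp[OF _ _ _ L K]) simp_all
  show "mmult ?I K L \<in> mats ?I ?I" "mmult ?I L K \<in> mats ?I ?I"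
    using intwD(1)[OF K] intwD(1)[OF L] by auto
  fix u w assume uw: "u \<in> ?I" "w \<in> ?I"
  have "mmult ?I K L u w = mmult ?I K L w u" by (rule intw_vrep_symmetric[OF KL uw])
  also have "\<dots> = mmult ?I L K u w"
    unfolding mmult_def using uw
    by (intro sum.cong refl) (simp add: intw_vrep_symmetric[OF K] intw_vrep_symmetric[OF L] mult.commute)
  finally show "mmult ?I K L u w = mmult ?I L K u w" .
qed

section \<open>Signs on the stabiliser of a pair with a common transversal\<close>

lemma prod_transversal_eq:
  fixes f :: "nat \<Rightarrow> complex"
  assumes v: "v \<in> invols n" and T: "transversal v T" and T': "transversal v T'"
    and f: "\<And>x. v x \<noteq> x \<Longrightarrow> f (v x) = f x"
  shows "(\<Prod>x\<in>T. f x) = (\<Prod>x\<in>T'. f x)"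
proof (rule prod.reindex_bij_witness[of _ "\<lambda>x. if x \<in> T then x else v x" "\<lambda>x. if x \<in> T' then x else v x"])
  have vv: "v (v x) = x" for x by (rule invols_twice[OF v])
  have moved: "v x \<noteq> x \<and> v x \<notin> T \<and> (x \<in> T' \<or> v x \<in> T')" if "x \<in> T" for x
    using that T T' unfolding transversal_def by metis
  have moved': "v x \<noteq> x \<and> v x \<notin> T' \<and> (x \<in> T \<or> v x \<in> T)" if "x \<in> T'" for x
    using that T T' unfolding transversal_def by metis
  show "(if (if x \<in> T' then x else v x) \<in> T then (if x \<in> T' then x else v x) else v (if x \<in> T' then x else v x)) = x"
    "(if x \<in> T' then x else v x) \<in> T'" "f (if x \<in> T' then x else v x) = f x" if "x \<in> T" for x
    using moved[OF that] that vv f by auto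
  show "(if (if x \<in> T then x else v x) \<in> T' then (if x \<in> T then x else v x) else v (if x \<in> T then x else v x)) = x"
    "(if x \<in> T then x else v x) \<in> T" if "x \<in> T'" for x
    using moved'[OF that] that vv by auto
qed

lemma vsign_orient_transversal:
  assumes v: "v \<in> invols n" and g: "g \<in> perms n" and gv: "cact g v = v" and T: "transversal v T"
  shows "vsign g v = (\<Prod>x\<in>T. if g x \<in> T then 1 else -1)"
proof -
  define b where "b x = (if x \<in> T then 1 else -1 :: complex)" for x
  define e where "e x = ori v x * b x" for x
  have flip: "b (v x) = - b x" if "v x \<noteq> x" for x
    using that T unfolding transversal_def b_def by auto
  have e: "e (v x) = e x" if "v x \<noteq> x" for x
    using flip[OF that] ori_flip[OF v that] by (simp add: e_def)
  have bb: "b x * b x = 1" for x by (simp add: b_def)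
  have ori: "ori v x = e x * b x" for x by (simp add: e_def mult.assoc bb)
  have ee: "e x * e x = 1" for x unfolding e_def using bb[of x] ori_sq[of v x] by (simp add: mult_ac)
  have "(\<Prod>x\<in>T. e (g x)) = (\<Prod>x\<in>g ` T. e x)"
    using g by (subst prod.reindex) (auto simp: inj_on_def)
  also have "\<dots> = (\<Prod>x\<in>T. e x)"
    using transversal_cact[OF g T] by (intro prod_transversal_eq[OF v _ T]) (simp_all add: gv e)
  finally have eg: "(\<Prod>x\<in>T. e (g x)) = (\<Prod>x\<in>T. e x)" .
  have "vsign g v = (\<Prod>x\<in>T. ori v x * ori v (g x))"
    using vsign_transversal[OF v g T] by (simp add: gv)
  also have "\<dots> = (\<Prod>x\<in>T. e x * e (g x) * b (g x))"
    by (intro prod.cong refl) (simp add: ori b_def)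
  also have "\<dots> = (\<Prod>x\<in>T. e x) * (\<Prod>x\<in>T. e x) * (\<Prod>x\<in>T. b (g x))"
    by (simp only: prod.distrib eg)
  also have "(\<Prod>x\<in>T. e x) * (\<Prod>x\<in>T. e x) = 1"
    unfolding prod.distrib[symmetric] by (simp only: ee prod.neutral_const)
  finally show ?thesis by (simp add: b_def)
qed

text \<open>The sign computed from \<open>T\<close> refers only to \<open>g\<close> and
  \<open>T\<close>, so \<open>u\<close> and \<open>w\<close> give the same value.\<close>

lemma common_transversal_sign:
  assumes "u \<in> invols n" "w \<in> invols n" "g \<in> perms n" "cact g u = u" "cact g w = w"
    and "transversal u T" "transversal w T"
  shows "vsign g u * vsign g w = 1"
proof -
  have "vsign g u = vsign g w"
    using vsign_orient_transversal[of u n g T] vsign_orient_transversal[of w n g T] assms by simp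
  then show ?thesis by simp
qed

subsection \<open>Orbits of permutations\<close>

definition orbit_pos :: "(nat \<Rightarrow> nat) \<Rightarrow> nat \<Rightarrow> nat" where
  "orbit_pos g x = (LEAST i. (g ^^ i) (orbit_min g x) = x)"

lemma orbit_pos_eq:
  assumes "g \<in> perms n" shows "(g ^^ orbit_pos g x) (orbit_min g x) = x"
proof -
  obtain i where "orbit_min g x = (g ^^ i) x" using orbit_min_in by blast
  moreover obtain j where "(g ^^ j) ((g ^^ i) x) = x" using perms_funpow_back[OF assms] .
  ultimately show ?thesis unfolding orbit_pos_def by (metis (mono_tags, lifting) LeastI)
qed

lemma orbit_pos_le: "(g ^^ i) (orbit_min g x) = x \<Longrightarrow> orbit_pos g x \<le> i"
  unfolding orbit_pos_def by (rule Least_le)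

lemma orbit_min_funpow: "g \<in> perms n \<Longrightarrow> orbit_min g ((g ^^ i) x) = orbit_min g x"
  by (induction i) (simp_all add: orbit_min_apply)

lemma orbit_min_idem: "g \<in> perms n \<Longrightarrow> orbit_min g (orbit_min g x) = orbit_min g x"
  using orbit_min_in[of g x] orbit_min_funpow by metis

lemma orbit_pos_wrap:
  assumes "g \<in> perms n" "g x = orbit_min g x" shows "orbit_pos g (g x) = 0"
  using orbit_pos_le[where g = g and i = 0 and x = "g x"] assms
  by (simp add: orbit_min_apply orbit_min_idem[OF assms(1)])

lemma orbit_pos_Suc:
  assumes g: "g \<in> perms n" and ne: "g x \<noteq> orbit_min g x" shows "orbit_pos g (g x) = Suc (orbit_pos g x)"
proof (rule antisym)
  show "orbit_pos g (g x) \<le> Suc (orbit_pos g x)"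
    by (rule orbit_pos_le) (simp add: orbit_min_apply[OF g] orbit_pos_eq[OF g])
  have eq: "(g ^^ orbit_pos g (g x)) (orbit_min g x) = g x"
    using orbit_pos_eq[OF g, of "g x"] by (simp add: orbit_min_apply[OF g])
  with ne have "orbit_pos g (g x) \<noteq> 0" by (metis funpow_0)
  then obtain i where i: "orbit_pos g (g x) = Suc i" using not0_implies_Suc by blast
  with eq have "(g ^^ i) (orbit_min g x) = x" using g by simp
  from orbit_pos_le[OF this] i show "Suc (orbit_pos g x) \<le> orbit_pos g (g x)" by simp
qed

text \<open>Stands in for comparing orbits: a permutation and a pair of involutions have the same
  orbits when they have the same invariant sets, and this notion is transported directly by
  conjugation.\<close>

definition invariant_set :: "(nat \<Rightarrow> nat) \<Rightarrow> nat set \<Rightarrow> bool" where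
  "invariant_set g S \<longleftrightarrow> g ` S \<subseteq> S"

lemma invariant_set_funpow: "invariant_set g S \<Longrightarrow> x \<in> S \<Longrightarrow> (g ^^ i) x \<in> S"
  by (induction i) (auto simp: invariant_set_def)

lemma invariant_set_inv:
  assumes g: "g \<in> perms n" and S: "invariant_set g S" "x \<in> S" shows "inv g x \<in> S"
proof -
  obtain j where "(g ^^ j) ((g ^^ 1) (inv g x)) = inv g x" using perms_funpow_back[OF g] .
  then have "inv g x = (g ^^ j) x" using g by simp
  with invariant_set_funpow[OF S] show ?thesis by simp
qed

text \<open>The points of odd position in their cycle are a common transversal of \<open>u\<close> and \<open>w\<close>.
  On a cycle of odd length, \<open>u\<close> and \<open>w\<close> form the path obtained by cutting the cycle at its base point,
  on a cycle of even length they form the cycle itself.\<close>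

lemma exists_involution_pair:
  assumes g: "g \<in> perms n"
  shows "\<exists>u w T. u \<in> invols n \<and> w \<in> invols n \<and> transversal u T \<and> transversal w T \<and>
    (\<forall>S. invariant_set u S \<and> invariant_set w S \<longleftrightarrow> invariant_set g S)"
proof -
  define T where "T = {x. odd (orbit_pos g x)}"
  have T1: "g x \<notin> T" if "x \<in> T" for x
    using that orbit_pos_wrap[OF g] orbit_pos_Suc[OF g] by (cases "g x = orbit_min g x") (auto simp: T_def)
  have T2: "g x = orbit_min g x" if "x \<notin> T" "g x \<notin> T" for x
    using that orbit_pos_Suc[OF g, of x] by (cases "g x = orbit_min g x") (simp_all add: T_def)
  have T3: "inv g x \<notin> T" if "x \<in> T" for x using T1[of "inv g x"] that g by auto
  \<comment> \<open>\<open>u\<close> joins a point of odd position to its predecessor in the cycle,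
    \<open>w\<close> joins it to its successor. Thus the only step of \<open>g\<close> that may fail
    to be an edge is the one back to the base point.\<close>
  define u where "u x = (if x \<in> T then inv g x else if g x \<in> T then g x else x)" for x
  define w where "w x = (if x \<in> T then g x else if inv g x \<in> T then inv g x else x)" for x
  have out: "g x = x" "inv g x = x" if "x \<notin> {1..n}" for x
    using perms_moved[OF g] perms_moved[OF perms_inv[OF g]] that by blast+
  have uu: "u (u x) = x" for x using g T1 T3 by (simp add: u_def)
  have ww: "w (w x) = x" for x using g T1 T3 by (simp add: w_def)
  have "u \<in> perms n" by (rule permsI[of n u u]) (simp_all only: uu, simp add: u_def out)
  then have u: "u \<in> invols n" using uu by (rule involsI)
  have "w \<in> perms n" by (rule permsI[of n w w]) (simp_all only: ww, simp add: w_def out)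
  then have w: "w \<in> invols n" using ww by (rule involsI)
  have Tu: "transversal u T" using T1 T3 by (auto simp: transversal_def u_def)
  have Tw: "transversal w T" using T1 T3 by (auto simp: transversal_def w_def)
  have "invariant_set u S \<and> invariant_set w S" if "invariant_set g S" for S
    using that invariant_set_inv[OF g that] by (auto simp: invariant_set_def u_def w_def)
  moreover have "invariant_set g S" if S: "invariant_set u S" "invariant_set w S" for S
    unfolding invariant_set_def
  proof clarify
    fix x assume x: "x \<in> S"
    have Su: "u y \<in> S" and Sw: "w y \<in> S" if "y \<in> S" for y using S that by (auto simp: invariant_set_def)
    let ?b = "orbit_min g x"
    have b: "orbit_min g ?b = ?b" by (rule orbit_min_idem[OF g])
    consider "x \<in> T" | "x \<notin> T" "g x \<in> T" | "g x = ?b" using T2 by blast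
    then show "g x \<in> S"
    proof cases
      case 1
      then show ?thesis using Sw[OF x] by (simp add: w_def)
    next
      case 2
      then show ?thesis using Su[OF x] by (simp add: u_def)
    next
      case 3
      \<comment> \<open>The closing step is replaced by walking backwards from \<open>x\<close> to
        the base point. No step on the way wraps around, since \<open>orbit_pos\<close> is the least
        exponent reaching \<open>x\<close>, so each is an edge.\<close>
      have "(g ^^ 0) ?b \<in> S"
      proof (rule inc_induct[of 0 "orbit_pos g x" "\<lambda>i. (g ^^ i) ?b \<in> S"])
        show "(g ^^ orbit_pos g x) ?b \<in> S" using x by (simp add: orbit_pos_eq[OF g])
        fix i assume i: "i < orbit_pos g x" "(g ^^ Suc i) ?b \<in> S"
        define z where "z = (g ^^ i) ?b"
        have gz: "g z = (g ^^ Suc i) ?b" by (simp add: z_def)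
        have gzS: "g z \<in> S" unfolding gz by (rule i(2))
        have "g z \<noteq> orbit_min g z"
        proof
          assume "g z = orbit_min g z"
          then have *: "(g ^^ Suc i) ?b = ?b" unfolding gz by (simp only: z_def orbit_min_funpow[OF g] b)
          have "x = (g ^^ orbit_pos g x) ?b" by (simp add: orbit_pos_eq[OF g])
          also have "orbit_pos g x = orbit_pos g x - Suc i + Suc i" using i by simp
          also have "(g ^^ (orbit_pos g x - Suc i + Suc i)) ?b = (g ^^ (orbit_pos g x - Suc i)) ?b"
            by (simp only: funpow_app[symmetric] *)
          finally have "orbit_pos g x \<le> orbit_pos g x - Suc i" by (intro orbit_pos_le) simp
          with i show False by simp
        qed
        then consider "z \<in> T" | "z \<notin> T" "g z \<in> T" using T2 by blast
        then have "z \<in> S"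
        proof cases
          case 1
          then show ?thesis using Sw[OF gzS] 1 T1[OF 1] g by (simp add: w_def)
        next
          case 2
          then show ?thesis using Su[OF gzS] 2 g by (simp add: u_def)
        qed
        then show "(g ^^ i) ?b \<in> S" by (simp add: z_def)
      qed simp
      with 3 show ?thesis by simp
    qed
  qed
  ultimately show ?thesis using u w Tu Tw by blast
qed

section \<open>Conjugacy from corresponding orbits\<close>

definition orbit_of :: "(nat \<Rightarrow> nat) \<Rightarrow> nat \<Rightarrow> nat set" where
  "orbit_of g x = range (\<lambda>i. (g ^^ i) x)"

lemma orbit_of_self: "x \<in> orbit_of g x"
  unfolding orbit_of_def by (rule range_eqI[of _ _ 0]) simp

lemma invariant_orbit_of: "invariant_set g (orbit_of g x)"
  by (auto simp: invariant_set_def orbit_of_def intro: range_eqI[of _ _ "Suc _"])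

lemma orbit_of_least: "invariant_set g S \<Longrightarrow> x \<in> S \<Longrightarrow> orbit_of g x \<subseteq> S"
  by (auto simp: orbit_of_def invariant_set_funpow)

lemma funpow_fixed_iff_card_orbit:
  assumes g: "g \<in> perms n"
  shows "(g ^^ m) x = x \<longleftrightarrow> card (orbit_of g x) dvd m"
proof -
  define k where "k = (LEAST k. 0 < k \<and> (g ^^ k) x = x)"
  obtain N where "N > 0" "g ^^ N = id" using perms_finite_order[OF g] .
  then have "0 < N \<and> (g ^^ N) x = x" by simp
  then have "0 < k \<and> (g ^^ k) x = x" unfolding k_def by (rule LeastI)
  then have k: "0 < k" "(g ^^ k) x = x" by auto
  have least: "k \<le> i" if "0 < i" "(g ^^ i) x = x" for i
    unfolding k_def using that by (intro Least_le) simp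
  have fixed: "(g ^^ m) x = x \<longleftrightarrow> k dvd m" for m
  proof
    assume "(g ^^ m) x = x"
    then have "(g ^^ (m mod k)) x = x" using funpow_mod_eq[OF k(2)] by simp
    with least[of "m mod k"] mod_less_divisor[OF k(1), of m] show "k dvd m"
      by (metis dvd_eq_mod_eq_0 leD neq0_conv)
  next
    assume "k dvd m"
    then show "(g ^^ m) x = x" using funpow_mult_fixed[OF k(2)] by (auto elim!: dvdE)
  qed
  have "orbit_of g x = (\<lambda>i. (g ^^ i) x) ` {..<k}"
    unfolding orbit_of_def using mod_less_divisor[OF k(1)] funpow_mod_eq[OF k(2)]
    by (auto intro!: image_eqI[of _ _ "_ mod k"])
  moreover have "inj_on (\<lambda>i. (g ^^ i) x) {..<k}"
  proof -
    have "i = j" if "i \<le> j" "j < k" "(g ^^ i) x = (g ^^ j) x" for i j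
    proof (rule ccontr)
      assume "i \<noteq> j"
      have "(g ^^ i) ((g ^^ (j - i)) x) = (g ^^ i) x" using that by (simp add: funpow_app)
      then have "(g ^^ (j - i)) x = x" using perms_inject[OF perms_funpow[OF g]] by blast
      with least[of "j - i"] that \<open>i \<noteq> j\<close> show False by simp
    qed
    then show ?thesis unfolding inj_on_def by (metis lessThan_iff nle_le)
  qed
  ultimately have "card (orbit_of g x) = k" by (simp add: card_image)
  with fixed show ?thesis by simp
qed

text \<open>\<open>q\<close> matches the cycles merely as sets, but then corresponding cycles have
  equal length, and the cycle type determines the conjugacy class.\<close>

lemma conjugate_if_orbits_correspond:
  assumes g: "g \<in> perms n" and h: "h \<in> perms n" and q: "q \<in> perms n"
    and corr: "\<And>S. invariant_set g S \<longleftrightarrow> invariant_set h (q ` S)"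
  shows "\<exists>p\<in>perms n. h = cact p g"
proof -
  have orb: "orbit_of h (q x) = q ` orbit_of g x" for x
  proof
    show "orbit_of h (q x) \<subseteq> q ` orbit_of g x"
      using corr invariant_orbit_of[of g] orbit_of_self by (intro orbit_of_least) auto
    have "q ` (inv q ` orbit_of h (q x)) = orbit_of h (q x)" using q by (force simp: image_image)
    with corr[of "inv q ` orbit_of h (q x)"] have "invariant_set g (inv q ` orbit_of h (q x))"
      by (simp add: invariant_orbit_of)
    moreover have "x \<in> inv q ` orbit_of h (q x)"
      using orbit_of_self[of "q x" h] q by (intro image_eqI[of _ _ "q x"]) auto
    ultimately have "orbit_of g x \<subseteq> inv q ` orbit_of h (q x)" by (rule orbit_of_least)
    then show "q ` orbit_of g x \<subseteq> orbit_of h (q x)" using q by auto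
  qed
  have per: "(h ^^ m) (q x) = q x" if "(g ^^ m) x = x" for m x
  proof -
    have "card (orbit_of h (q x)) = card (orbit_of g x)"
      unfolding orb using q by (intro card_image) (auto simp: inj_on_def)
    with that show ?thesis using funpow_fixed_iff_card_orbit[OF g] funpow_fixed_iff_card_orbit[OF h] by simp
  qed
  \<comment> \<open>Aligns the cycles: base points go where \<open>q\<close> sends them, and
    \<open>i\<close> steps of \<open>g\<close> from there become \<open>i\<close> steps of
    \<open>h\<close>. Equal periods make this consistent at the wrap-around.\<close>
  define p where "p x = (h ^^ orbit_pos g x) (q (orbit_min g x))" for x
  have pg: "p (g x) = h (p x)" for x
  proof (cases "g x = orbit_min g x")
    case True
    have "(g ^^ Suc (orbit_pos g x)) (orbit_min g x) = orbit_min g x"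
      using True by (simp add: orbit_pos_eq[OF g])
    then have "(h ^^ Suc (orbit_pos g x)) (q (orbit_min g x)) = q (orbit_min g x)" by (rule per)
    then show ?thesis using orbit_pos_wrap[OF g True] by (simp add: p_def orbit_min_apply[OF g])
  next
    case False
    then show ?thesis by (simp add: p_def orbit_pos_Suc[OF g] orbit_min_apply[OF g])
  qed
  have pg_pow: "p ((g ^^ i) x) = (h ^^ i) (p x)" for i x by (induction i) (simp_all add: pg)
  have surj: "\<exists>x. y = p x" for y
  proof -
    define z where "z = inv q y"
    let ?b = "orbit_min g z"
    have pos0: "orbit_pos g ?b = 0" using orbit_pos_le[where g = g and i = 0 and x = ?b] by (simp add: orbit_min_idem[OF g])
    have "z \<in> orbit_of g ?b" using orbit_pos_eq[OF g, of z] unfolding orbit_of_def by (metis rangeI)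
    then have "y \<in> orbit_of h (q ?b)" unfolding orb using q by (auto simp: z_def intro!: image_eqI[of _ _ "inv q y"])
    then obtain i where "y = (h ^^ i) (q ?b)" by (auto simp: orbit_of_def)
    also have "q ?b = p ?b" by (simp add: p_def pos0 orbit_min_idem[OF g])
    finally show ?thesis unfolding pg_pow[symmetric] by blast
  qed
  have out: "p x = x" if "x \<notin> {1..n}" for x
  proof -
    have fix1: "(g ^^ i) x = x" "(h ^^ i) x = x" "q x = x" for i
      using perms_moved[OF perms_funpow[OF g]] perms_moved[OF perms_funpow[OF h]] perms_moved[OF q] that by blast+
    have "orbit_min g x = x" using orbit_min_in[of g x] fix1 by auto
    then show ?thesis by (simp add: p_def fix1)
  qed
  have "{1..n} \<subseteq> p ` {1..n}"
  proof
    fix y assume y: "y \<in> {1..n}"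
    obtain x where "y = p x" using surj by blast
    with y out[of x] show "y \<in> p ` {1..n}" by (cases "x \<in> {1..n}") auto
  qed
  then have inj: "inj_on p {1..n}" and eq: "p ` {1..n} = {1..n}"
    using finite_surj_inj[of "{1..n}" p] card_image_le[of "{1..n}" p] card_seteq[of "p ` {1..n}" "{1..n}"]
    by auto
  have "p permutes {1..n}" using inj eq out by (intro bij_imp_permutes) (auto simp: bij_betw_def)
  then have p: "p \<in> perms n" by (simp add: perms_def)
  have "cact p g = h" using pg by (intro cact_eqI[OF p])
  with p show ?thesis by blast
qed

lemma invariant_set_cact:
  assumes p: "p \<in> perms n"
  shows "invariant_set (cact p v) (p ` S) \<longleftrightarrow> invariant_set v S"
proof -
  have "cact p v ` p ` S = p ` v ` S" using p by (simp add: image_image)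
  then show ?thesis
    unfolding invariant_set_def by (simp add: inj_image_subset_iff[OF bij_is_inj[OF perms_bij[OF p]]])
qed

subsection \<open>The Gelfand model\<close>

lemma exists_class_representatives:
  obtains R where "R \<subseteq> perms n" "\<And>g. g \<in> perms n \<Longrightarrow> \<exists>r\<in>R. \<exists>p\<in>perms n. g = cact p r"
    "\<And>r s p. r \<in> R \<Longrightarrow> s \<in> R \<Longrightarrow> p \<in> perms n \<Longrightarrow> s = cact p r \<Longrightarrow> s = r"
proof -
  define cls where "cls g = (\<lambda>p. cact p g) ` perms n" for g
  have self: "g \<in> cls g" for g unfolding cls_def by (rule image_eqI[of _ _ id]) auto
  have sub: "cls (cact p g) \<subseteq> cls g" if "p \<in> perms n" for p g
    using that by (auto simp: cls_def cact_comp[symmetric])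
  have eq: "cls (cact p g) = cls g" if p: "p \<in> perms n" for p g
    using sub[OF p, of g] sub[OF perms_inv[OF p], of "cact p g"] by (simp add: cact_inv_cact[OF p])
  define rep where "rep g = (SOME h. h \<in> cls g)" for g
  have rep: "rep g \<in> cls g" for g unfolding rep_def by (rule someI[of "\<lambda>h. h \<in> cls g", OF self])
  have cls_rep: "cls (rep g) = cls g" for g
  proof -
    obtain p where "p \<in> perms n" "rep g = cact p g" using rep[of g] by (auto simp: cls_def)
    with eq show ?thesis by simp
  qed
  have rep_eq: "rep g = rep g'" if "cls g = cls g'" for g g' using that by (simp add: rep_def)
  show ?thesis
  proof (rule that[of "rep ` perms n"])
    show "rep ` perms n \<subseteq> perms n"
    proof clarify
      fix g assume "g \<in> perms n"
      moreover obtain p where "p \<in> perms n" "rep g = cact p g" using rep[of g] by (auto simp: cls_def)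
      ultimately show "rep g \<in> perms n" by simp
    qed
    fix g assume "g \<in> perms n"
    moreover have "g \<in> cls (rep g)" using self[of g] by (simp add: cls_rep)
    ultimately show "\<exists>r\<in>rep ` perms n. \<exists>p\<in>perms n. g = cact p r" by (auto simp: cls_def)
  next
    fix r s p assume *: "r \<in> rep ` perms n" "s \<in> rep ` perms n" "p \<in> perms n" "s = cact p r"
    then obtain g g' where gg': "r = rep g" "s = rep g'" by auto
    have "cls s = cls r" unfolding *(4) by (rule eq[OF *(3)])
    then show "s = r" unfolding gg' cls_rep by (intro rep_eq) simp
  qed
qed

text \<open>The entry is a signed count of the conjugations taking \<open>(u, w)\<close> to
  \<open>(u', w')\<close>. It vanishes off the orbit of the pair, and on the diagonal it sums the
  sign over the stabiliser.\<close>

lemma average_vrep_apply: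
  assumes u: "u \<in> invols n" and w: "w \<in> invols n" and u': "u' \<in> invols n" and w': "w' \<in> invols n"
  shows "average n (invols n) (vrep n) (invols n) (vrep n) (unit_mat u w) u' w'
    = (\<Sum>g\<in>perms n. if u' = cact g u \<and> w' = cact g w then vsign g u * vsign g w else 0)"
  unfolding average_unit_mat[OF finite_invols finite_invols u w]
proof (intro sum.cong refl)
  fix g assume g: "g \<in> perms n"
  have inv: "w = cact (inv g) w' \<longleftrightarrow> w' = cact g w"
    using cact_inv_cact[OF g] cact_cact_inv[OF g] by metis
  have "vsign (inv g) (cact g w) = vsign g w"
  proof -
    have "vsign (inv g) (cact g w) * vsign g w = 1"
      using vsign_comp[OF w perms_inv[OF g] g] by (simp add: perms_inv_o[OF g])
    then have "vsign (inv g) (cact g w) * (vsign g w * vsign g w) = vsign g w"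
      by (simp only: mult.assoc[symmetric] mult_1)
    then show ?thesis by simp
  qed
  then show "vrep n g u' u * vrep n (inv g) w w' = (if u' = cact g u \<and> w' = cact g w then vsign g u * vsign g w else 0)"
    using assms by (auto simp: vrep_def inv)
qed

lemma gelfand_model_vrep: "gelfand_model n (invols n) (vrep n)"
proof -
  obtain R where R: "R \<subseteq> perms n" "\<And>g. g \<in> perms n \<Longrightarrow> \<exists>r\<in>R. \<exists>p\<in>perms n. g = cact p r"
    and distinct: "\<And>r s p. r \<in> R \<Longrightarrow> s \<in> R \<Longrightarrow> p \<in> perms n \<Longrightarrow> s = cact p r \<Longrightarrow> s = r"
    using exists_class_representatives[of n] by blast
  have fin: "finite R" by (rule finite_subset[OF R(1)]) simp
  have "\<forall>g\<in>perms n. \<exists>u w T. u \<in> invols n \<and> w \<in> invols n \<and> transversal u T \<and> transversal w T \<and>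
      (\<forall>S. invariant_set u S \<and> invariant_set w S \<longleftrightarrow> invariant_set g S)"
    using exists_involution_pair by blast
  then obtain u w T where *: "\<forall>g\<in>perms n. u g \<in> invols n \<and> w g \<in> invols n \<and>
      transversal (u g) (T g) \<and> transversal (w g) (T g) \<and>
      (\<forall>S. invariant_set (u g) S \<and> invariant_set (w g) S \<longleftrightarrow> invariant_set g S)"
    by metis
  then have uw: "u g \<in> invols n" "w g \<in> invols n" "transversal (u g) (T g)" "transversal (w g) (T g)"
    "invariant_set g S \<longleftrightarrow> invariant_set (u g) S \<and> invariant_set (w g) S"
    if "g \<in> R" for g S
    using that R(1) by blast+
  define K where "K r = average n (invols n) (vrep n) (invols n) (vrep n) (unit_mat (u r) (w r))" for r
  \<comment> \<open>The common transversal makes every stabilising permutation contribute 1, so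
    nothing cancels.\<close>
  have diag: "K r (u r) (w r) \<noteq> 0" if r: "r \<in> R" for r
  proof -
    let ?stab = "{g \<in> perms n. u r = cact g (u r) \<and> w r = cact g (w r)}"
    have "K r (u r) (w r) = (\<Sum>g\<in>perms n. if u r = cact g (u r) \<and> w r = cact g (w r) then 1 else 0)"
      unfolding K_def average_vrep_apply[OF uw(1,2)[OF r] uw(1,2)[OF r]]
      using common_transversal_sign[OF uw(1,2)[OF r] _ _ _ uw(3,4)[OF r]]
      by (intro sum.cong refl) auto
    also have "\<dots> = of_nat (card ?stab)" by (simp flip: sum.inter_filter)
    finally have "K r (u r) (w r) = of_nat (card ?stab)" .
    moreover have "?stab \<noteq> {}" "finite ?stab" by (auto intro: exI[of _ id])
    then have "card ?stab \<noteq> 0" by (simp only: card_0_eq not_False_eq_True)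
    ultimately show ?thesis by simp
  qed
  \<comment> \<open>A conjugation between the two pairs would carry the invariant sets of
    \<open>r\<close> to those of \<open>s\<close>, making them conjugate representatives and hence
    equal.\<close>
  have off_diag: "K r (u s) (w s) = 0" if rs: "r \<in> R" "s \<in> R" "r \<noteq> s" for r s
  proof -
    have "\<not> (u s = cact g (u r) \<and> w s = cact g (w r))" if g: "g \<in> perms n" for g
    proof
      assume c: "u s = cact g (u r) \<and> w s = cact g (w r)"
      have "invariant_set r S \<longleftrightarrow> invariant_set s (g ` S)" for S
        using c by (simp add: uw(5)[OF rs(1)] uw(5)[OF rs(2)] invariant_set_cact[OF g])
      moreover have "r \<in> perms n" "s \<in> perms n" using rs R(1) by auto
      ultimately obtain p where "p \<in> perms n" "s = cact p r"
        using conjugate_if_orbits_correspond[of r n s g] g by blast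
      from distinct[OF rs(1,2) this] rs(3) show False by simp
    qed
    then show ?thesis
      unfolding K_def average_vrep_apply[OF uw(1,2)[OF rs(1)] uw(1,2)[OF rs(2)]] by (intro sum.neutral) auto
  qed
  show ?thesis
  proof (rule gelfand_model_criterion[OF srep_vrep intw_vrep_commute fin R(1), where K = K])
    show "\<exists>r\<in>R. \<exists>p\<in>perms n. g = p \<circ> r \<circ> inv p" if "g \<in> perms n" for g
      using R(2)[OF that] by (simp add: cact_def)
    show "intw n (invols n) (vrep n) (invols n) (vrep n) (K r)" if "r \<in> R" for r
      unfolding K_def using uw[OF that] by (intro average_intw srep_vrep unit_mat_mats)
    fix a assume "(\<Sum>r\<in>R. smul (a r) (K r)) = 0"
    then have 0: "(\<Sum>r\<in>R. a r * K r x y) = 0" for x y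
      by (simp add: fun_eq_iff sum_fun_apply smul_def)
    show "\<forall>r\<in>R. a r = 0"
    proof
      fix s assume s: "s \<in> R"
      have "(\<Sum>r\<in>R. a r * K r (u s) (w s)) = (\<Sum>r\<in>R. if r = s then a s * K s (u s) (w s) else 0)"
        using off_diag s by (intro sum.cong refl) auto
      with 0 have "a s * K s (u s) (w s) = 0" using s fin by simp
      with diag[OF s] show "a s = 0" by simp
    qed
  qed
qed

text \<open>Existence, given by \<open>vrep\<close>, keeps the universal claim from being vacuous.
  The generators determine all entries on involutions, so any such \<open>\<rho>\<close> inherits
  the decomposition of \<open>vrep\<close>.\<close>

theorem theorem1p2:
  fixes n :: nat
  shows "(\<exists>\<rho>. is_rep n (invols n) \<rho> \<and> gen_action n \<rho>) \<and>
         (\<forall>\<rho>. is_rep n (invols n) \<rho> \<and> gen_action n \<rho> \<longrightarrow> gelfand_model n (invols n) \<rho>)"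
proof (intro conjI allI impI)
  show "\<exists>\<rho>. is_rep n (invols n) \<rho> \<and> gen_action n \<rho>"
    using srep_imp_is_rep[OF srep_vrep] gen_action_vrep by blast
next
  fix \<rho> assume "is_rep n (invols n) \<rho> \<and> gen_action n \<rho>"
  then have "vrep n p x y = \<rho> p x y" if "p \<in> perms n" "x \<in> invols n" "y \<in> invols n" for p x y
    using vrep_unique that by metis
  then have "rep_iso n (invols n) \<rho> J \<sigma>" if "rep_iso n (invols n) (vrep n) J \<sigma>" for J :: "(nat \<times> nat) set" and \<sigma>
    using rep_iso_cong that by blast
  then show "gelfand_model n (invols n) \<rho>"
    using gelfand_model_vrep[of n] unfolding gelfand_model_def by blast
qed

end
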